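(* Let $Q\subset\mathbb{R}^n$ be a bounded open set with smooth boundary, $\lambda$ the first eigenvalue of $-\Delta$ on $Q$ with homogeneous Dirichlet boundary condition, $\alpha>0$, $\beta\in(0,\lambda)$, $0<\delta<\lambda-\beta$, and $g,h\in L^1_{loc}(\mathbb{R},L^\infty(Q))$. Suppose $\int_{-\infty}^\tau e^{\delta s}\big(\|g(s,\cdot)\|_{L^\infty(Q)}+\|h(s,\cdot)\|_{L^\infty(Q)}\big)ds<\infty$ for every $\tau\in\mathbb{R}$, and, for every $c>0$, $\lim_{r\to-\infty}e^{cr}\int_{-\infty}^0e^{\delta s}\big(\|g(s+r,\cdot)\|_{L^\infty(Q)}+\|h(s+r,\cdot)\|_{L^\infty(Q)}\big)ds=0$. Consider the linear problem $$\frac{\partial\tilde v}{\partial t}-\Delta\tilde v-\beta\tilde v=z(t,\omega)\big(h(t,x)+|g(t,x)|\big)\ (x\in Q,\ t>\tau),\qquad\tilde v|_{\partial Q}=0,\qquad\tilde v(\tau,\cdot)=\tilde v_\tau,$$ with $z(t,\omega)=e^{-\alpha\omega(t)}$. Then this problem has a unique tempered complete quasi-solution $\xi:\mathbb{R}\times\Omega\to C_0(\overline{Q})$, which is given, for each $t\in\mathbb{R}$ and $\omega\in\Omega$, by $$\xi(t,\omega)=\int_{-\infty}^0e^{As}z(s,\omega)\big(h^t(s,\cdot)+|g^t(s,\cdot)|\big)ds .$$ In addition, $\xi$ pullback attracts all solutions in the sense that for every $t>0$, $\tau\in\mathbb{R}$ and $\omega\in\Omega$ (and initial datum $\tilde v_{\tau-t}\in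 C_0(\overline{Q})$), $$\|\tilde v(\tau,\tau-t,\omega^{-\tau},g,h,\tilde v_{\tau-t})-\xi(\tau,\omega)\|_{C_0(\overline{Q})}\le Me^{-(\lambda-\beta)t}\Big(\|\tilde v_{\tau-t}\|_{C_0(\overline{Q})}+\|\xi(\tau-t,\omega^{-t})\|_{C_0(\overline{Q})}\Big),$$ where $M$ is a positive constant independent of $t$, $\tau$ and $\omega$. Furthermore, if $g$ and $h$ are periodic in time with period $T>0$, then so is $\xi$, i.e. $\xi(t+T,\omega)=\xi(t,\omega)$ for all $t\in\mathbb{R}$ and $\omega\in\Omega$.
   Context: $C_0(\overline{Q})$ is the space of continuous functions on $\overline{Q}$ vanishing on $\partial Q$, with the supremum norm. $\Omega$ is the set of $\omega\in C(\mathbb{R},\mathbb{R})$ with $\omega(0)=0$, restricted to a set of full Wiener measure, invariant under $\omega\mapsto\omega(\cdot+t)-\omega(t)$, on which $\omega(t)/t\to0$ as $t\to\pm\infty$. Translations: $\omega^t(\cdot)=\omega(\cdot+t)$, $g^t(s,x)=g(s+t,x)$, $h^t(s,x)=h(s+t,x)$. Expressions evaluated at a translate $\omega^t$ (which need not vanish at $0$) are read literally, with $z(s,\omega^t)=e^{-\alpha\omega(s+t)}$; in particular $\xi(\tau,\omega^t)$ is given by the same formula with $\omega^t$ in place of $\omega$. $A=-\Delta-\beta I$ with homogeneous Dirichlet boundary condition, with associated analytic semigroup $\{e^{-At}\}_{t\ge0}$ in $C_0(\overline{Q})$; for $s\le0$, $e^{As}$ means $e^{-A|s|}$. The solution of the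 linear problem with initial datum $\tilde v_\tau\in C_0(\overline{Q})$ at time $\tau$ is $$\tilde v(t,\tau,\omega,g,h,\tilde v_\tau)=e^{-A(t-\tau)}\tilde v_\tau+\int_\tau^tz(s,\omega)e^{-A(t-s)}\big(h(s,\cdot)+|g(s,\cdot)|\big)ds,\quad t>\tau .$$ A mapping $\xi:\mathbb{R}\times\Omega\to C_0(\overline{Q})$ is a complete quasi-solution of the linear problem if for every $\tau\in\mathbb{R}$, $t>0$ and $\omega\in\Omega$, $\tilde v(t+\tau,\tau,\omega^{-\tau},g,h,\xi(\tau,\omega))=\xi(\tau+t,\omega^t)$. It is tempered if $\lim_{t\to-\infty}e^{ct}\|\xi(\tau+t,\omega^t)\|_{C_0(\overline{Q})}=0$ for every $c>0$, $\tau\in\mathbb{R}$ and $\omega\in\Omega$. *)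

theory Defs
  imports "HOL-Probability.Probability"
begin

section \<open>The separable Banach space of continuous functions vanishing at infinity\<close>

text \<open>
  \<open>C\<^sub>0(\<real>\<^sup>n)\<close> with the supremum norm is made a type so that the Bochner integral of the library
  (which needs a Banach space with a countable base) applies.  The space \<open>C\<^sub>0(cl Q)\<close>, which depends
  on the term \<open>Q\<close>, is then a closed subspace, see \<open>C0\<close> below.
\<close>

typedef (overloaded) ('a :: euclidean_space) c0 =
  "{f :: 'a \<Rightarrow>\<^sub>C real. (apply_bcontfun f \<longlongrightarrow> 0) at_infinity}"
  morphisms bcontfun_of_c0 Abs_c0
  by (rule exI[of _ 0]) simp

setup_lifting type_definition_c0

abbreviation apply_c0 :: "'a c0 \<Rightarrow> 'a::euclidean_space \<Rightarrow> real"
  where "apply_c0 f \<equiv> apply_bcontfun (bcontfun_of_c0 f)"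

lemma c0_eqI: "(\<And>x. apply_c0 f x = apply_c0 g x) \<Longrightarrow> f = g"
  by (metis bcontfun_eqI bcontfun_of_c0_inject)

lemma tendsto_apply_c0: "(apply_c0 f \<longlongrightarrow> 0) at_infinity"
  using bcontfun_of_c0[of f] by simp

lemma c0_of_continuous:
  fixes f :: "'a::euclidean_space \<Rightarrow> real"
  assumes "continuous_on UNIV f" "(f \<longlongrightarrow> 0) at_infinity"
  obtains u where "apply_c0 u = f"
proof -
  obtain b where b: "\<And>x. b \<le> norm x \<Longrightarrow> norm (f x) < 1"
    using tendstoD[OF assms(2), of 1] by (auto simp: eventually_at_infinity)
  have "bounded (f ` cball 0 b)"
    by (intro compact_imp_bounded compact_continuous_image continuous_on_subset[OF assms(1)]) auto
  then obtain c where c: "\<And>x. x \<in> cball 0 b \<Longrightarrow> norm (f x) \<le> c"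
    unfolding bounded_iff by blast
  have "norm (f x) \<le> max c 1" for x
    using b[of x] c[of x] by (cases "norm x \<le> b") auto
  then have "f \<in> bcontfun"
    by (rule bcontfun_normI[OF assms(1)])
  then obtain g where g: "f = apply_bcontfun g"
    by (rule bcontfunE)
  then have "apply_c0 (Abs_c0 g) = f"
    using assms(2) by (simp add: Abs_c0_inverse)
  then show thesis ..
qed

instantiation c0 :: (euclidean_space) real_vector
begin

lift_definition zero_c0 :: "'a c0" is 0
  by simp

lift_definition plus_c0 :: "'a c0 \<Rightarrow> 'a c0 \<Rightarrow> 'a c0" is "(+)"
  by (auto intro: tendsto_add_zero)

lift_definition minus_c0 :: "'a c0 \<Rightarrow> 'a c0 \<Rightarrow> 'a c0" is "(-)"
  using tendsto_diff by fastforce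

lift_definition uminus_c0 :: "'a c0 \<Rightarrow> 'a c0" is "uminus"
  using tendsto_minus by fastforce

lift_definition scaleR_c0 :: "real \<Rightarrow> 'a c0 \<Rightarrow> 'a c0" is "(*\<^sub>R)"
  by (auto intro: tendsto_mult_right_zero)

instance
proof
  fix a b c :: "'a c0" and r s :: real
  show "a + b + c = a + (b + c)" by transfer simp
  show "a + b = b + a" by transfer simp
  show "0 + a = a" by transfer simp
  show "- a + a = 0" by transfer simp
  show "a - b = a + - b" by transfer simp
  show "r *\<^sub>R (a + b) = r *\<^sub>R a + r *\<^sub>R b" by transfer (simp add: scaleR_add_right)
  show "(r + s) *\<^sub>R a = r *\<^sub>R a + s *\<^sub>R a" by transfer (simp add: scaleR_add_left)
  show "r *\<^sub>R s *\<^sub>R a = (r * s) *\<^sub>R a" by transfer simp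
  show "1 *\<^sub>R a = a" by transfer simp
qed

end

instantiation c0 :: (euclidean_space) real_normed_vector
begin

lift_definition norm_c0 :: "'a c0 \<Rightarrow> real" is norm .

lift_definition dist_c0 :: "'a c0 \<Rightarrow> 'a c0 \<Rightarrow> real" is dist .

definition sgn_c0 :: "'a c0 \<Rightarrow> 'a c0"
  where "sgn_c0 f = f /\<^sub>R norm f"

definition uniformity_c0 :: "('a c0 \<times> 'a c0) filter"
  where "uniformity_c0 = (INF e\<in>{0 <..}. principal {(x, y). dist x y < e})"

definition open_c0 :: "'a c0 set \<Rightarrow> bool"
  where "open_c0 S = (\<forall>x\<in>S. \<forall>\<^sub>F (x', y) in uniformity. x' = x \<longrightarrow> y \<in> S)"

instance
proof
  fix a b :: "'a c0" and r :: real
  show "dist a b = norm (a - b)"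
    by (simp add: dist_c0.rep_eq norm_c0.rep_eq minus_c0.rep_eq dist_norm)
  show "sgn a = a /\<^sub>R norm a"
    by (simp add: sgn_c0_def)
  show "norm a = 0 \<longleftrightarrow> a = 0"
    by (simp add: norm_c0.rep_eq zero_c0.rep_eq flip: bcontfun_of_c0_inject)
  show "norm (a + b) \<le> norm a + norm b"
    by (simp add: norm_c0.rep_eq plus_c0.rep_eq norm_triangle_ineq)
  show "norm (r *\<^sub>R a) = \<bar>r\<bar> * norm a"
    by (simp add: norm_c0.rep_eq scaleR_c0.rep_eq)
qed (rule uniformity_c0_def open_c0_def)+

end

lemma apply_c0_simps [simp]:
  "apply_c0 0 x = 0"
  "apply_c0 (f + g) x = apply_c0 f x + apply_c0 g x"
  "apply_c0 (f - g) x = apply_c0 f x - apply_c0 g x"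
  "apply_c0 (- f) x = - apply_c0 f x"
  "apply_c0 (a *\<^sub>R f) x = a * apply_c0 f x"
  by (simp_all add: zero_c0.rep_eq plus_c0.rep_eq minus_c0.rep_eq uminus_c0.rep_eq scaleR_c0.rep_eq)

lemma norm_c0_bounded: "\<bar>apply_c0 f x\<bar> \<le> norm f"
  using norm_bounded[of "bcontfun_of_c0 f" x] by (simp add: norm_c0.rep_eq)

lemma norm_c0_bound: "(\<And>x. \<bar>apply_c0 f x\<bar> \<le> b) \<Longrightarrow> norm f \<le> b"
  using norm_bound[of "bcontfun_of_c0 f" b] by (simp add: norm_c0.rep_eq)

instance c0 :: (euclidean_space) banach
proof
  fix X :: "nat \<Rightarrow> 'a c0"
  assume X: "Cauchy X"
  then have "Cauchy (\<lambda>n. bcontfun_of_c0 (X n))"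
    by (simp add: Cauchy_def dist_c0.rep_eq)
  then obtain l where l: "(\<lambda>n. bcontfun_of_c0 (X n)) \<longlonglongrightarrow> l"
    using Cauchy_convergent convergent_def by blast
  have "(apply_bcontfun l \<longlongrightarrow> 0) at_infinity"
  proof (rule tendstoI)
    fix e :: real
    assume e: "e > 0"
    then obtain n where n: "dist (bcontfun_of_c0 (X n)) l < e / 2"
      using metric_LIMSEQ_D[OF l, of "e/2"] by auto
    have "\<forall>\<^sub>F x in at_infinity. dist (apply_c0 (X n) x) 0 < e / 2"
      by (rule tendstoD[OF tendsto_apply_c0]) (use e in simp)
    then show "\<forall>\<^sub>F x in at_infinity. dist (apply_bcontfun l x) 0 < e"
    proof eventually_elim
      case (elim x)
      with dist_bounded[of "bcontfun_of_c0 (X n)" x l] n show ?case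
        by (simp add: dist_real_def abs_if split: if_splits)
    qed
  qed
  then have "bcontfun_of_c0 (Abs_c0 l) = l"
    by (simp add: Abs_c0_inverse)
  with l have "X \<longlonglongrightarrow> Abs_c0 l"
    by (simp add: tendsto_iff dist_c0.rep_eq)
  then show "convergent X"
    by (rule convergentI)
qed

lemma c0_countable_net:
  assumes e: "e > 0"
  obtains D :: "'a::euclidean_space c0 set"
  where "countable D" "\<And>f. \<exists>g\<in>D. dist f g \<le> 3 * e"
proof -
  define is_net :: "nat \<Rightarrow> nat \<Rightarrow> 'a list \<Rightarrow> bool" where
    "is_net N j xs \<longleftrightarrow> set xs \<subseteq> cball 0 (real N) \<and> cball 0 (real N) \<subseteq> (\<Union>x\<in>set xs. ball x (1 / Suc j))"
    for N j xs
  have "\<exists>xs. is_net N j xs" for N j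
  proof -
    have "x \<in> ball x (1 / Suc j)" for x :: 'a
      by simp
    then have cover: "cball (0::'a) (real N) \<subseteq> (\<Union>x\<in>cball 0 (real N). ball x (1 / Suc j))"
      by blast
    obtain K :: "'a set" where K: "K \<subseteq> cball 0 (real N)" "finite K"
        "cball 0 (real N) \<subseteq> (\<Union>x\<in>K. ball x (1 / Suc j))"
      by (rule compactE_image[OF compact_cball _ cover]) auto
    obtain xs where "set xs = K"
      using finite_list[OF K(2)] by blast
    then have "is_net N j xs"
      unfolding is_net_def using K(1,3) by simp
    then show ?thesis ..
  qed
  then obtain net where "\<And>N j. is_net N j (net N j)"
    by metis
  then have net: "\<And>N j. set (net N j) \<subseteq> cball 0 (real N)"
      "\<And>N j. cball 0 (real N) \<subseteq> (\<Union>x\<in>set (net N j). ball x (1 / Suc j))"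
    unfolding is_net_def by blast+
  have "\<exists>N j. (\<forall>x. x \<notin> cball 0 (real N) \<longrightarrow> \<bar>apply_c0 f x\<bar> < e) \<and>
      (\<forall>x\<in>cball 0 (real N). \<forall>y\<in>cball 0 (real N).
        dist x y < 1 / Suc j \<longrightarrow> dist (apply_c0 f x) (apply_c0 f y) < e)"
    for f :: "'a c0"
  proof -
    obtain b where b: "\<And>x. b \<le> norm x \<Longrightarrow> \<bar>apply_c0 f x\<bar> < e"
      using tendstoD[OF tendsto_apply_c0[of f] e] by (auto simp: eventually_at_infinity)
    obtain N :: nat where N: "b \<le> real N"
      using real_arch_simple by blast
    have "uniformly_continuous_on (cball 0 (real N)) (apply_c0 f)"
      by (intro compact_uniformly_continuous) auto
    then obtain d where d: "d > 0" "\<And>x y. x \<in> cball 0 (real N) \<Longrightarrow> y \<in> cball 0 (real N) \<Longrightarrow>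
        dist x y < d \<Longrightarrow> dist (apply_c0 f x) (apply_c0 f y) < e"
      using e unfolding uniformly_continuous_on_def by metis
    obtain j where "1 / Suc j < d"
      using nat_approx_posE[OF d(1)] by auto
    with N b d(2) show ?thesis
      by (intro exI[of _ N] exI[of _ j]) fastforce
  qed
  then obtain N j :: "'a c0 \<Rightarrow> nat"
    where N: "\<And>f x. x \<notin> cball 0 (real (N f)) \<Longrightarrow> \<bar>apply_c0 f x\<bar> < e"
      and j: "\<And>f x y. x \<in> cball 0 (real (N f)) \<Longrightarrow> y \<in> cball 0 (real (N f)) \<Longrightarrow>
        dist x y < 1 / Suc (j f) \<Longrightarrow> dist (apply_c0 f x) (apply_c0 f y) < e"
    by metis
  define \<Phi> where "\<Phi> f = (N f, j f, map (\<lambda>d. \<lfloor>apply_c0 f d / e\<rfloor>) (net (N f) (j f)))" for f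
  have close: "dist f g \<le> 3 * e" if "\<Phi> f = \<Phi> g" for f g
  proof -
    have eq: "N g = N f" "j g = j f"
      and vals: "\<And>d. d \<in> set (net (N f) (j f)) \<Longrightarrow> \<lfloor>apply_c0 f d / e\<rfloor> = \<lfloor>apply_c0 g d / e\<rfloor>"
      using that by (auto simp: \<Phi>_def)
    have "\<bar>apply_c0 (f - g) x\<bar> \<le> 3 * e" for x
    proof (cases "x \<in> cball 0 (real (N f))")
      case True
      then obtain d where d: "d \<in> set (net (N f) (j f))" "dist d x < 1 / Suc (j f)"
        using net(2)[of "N f" "j f"] by auto
      have "\<bar>apply_c0 f d / e - apply_c0 g d / e\<bar> < 1"
        using vals[OF d(1)] by linarith
      then have "\<bar>apply_c0 f d - apply_c0 g d\<bar> < e"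
        using e by (simp add: diff_divide_distrib[symmetric] abs_divide)
      moreover have "d \<in> cball 0 (real (N f))"
        using net(1) d(1) by blast
      then have "dist (apply_c0 f d) (apply_c0 f x) < e" "dist (apply_c0 g d) (apply_c0 g x) < e"
        using j[of d f x] j[of d g x] True d(2) eq by auto
      ultimately show ?thesis
        by (simp add: dist_real_def)
    next
      case False
      then show ?thesis
        using N[of x f] N[of x g] eq by simp
    qed
    then show ?thesis
      unfolding dist_norm by (rule norm_c0_bound)
  qed
  show thesis
  proof
    show "countable (range (\<lambda>p. inv \<Phi> p))"
      by simp
    show "\<exists>g\<in>range (inv \<Phi>). dist f g \<le> 3 * e" for f
      by (rule bexI[of _ "inv \<Phi> (\<Phi> f)"]) (auto intro!: close simp: f_inv_into_f)
  qed
qed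

instance c0 :: (euclidean_space) second_countable_topology
proof
  have "\<exists>D :: 'a c0 set. countable D \<and> (\<forall>f. \<exists>g\<in>D. dist f g \<le> 3 * (1 / (4 * real (Suc n))))" for n
    using c0_countable_net[of "1 / (4 * real (Suc n))"]
    by (metis mult_pos_pos of_nat_0_less_iff zero_less_Suc zero_less_divide_1_iff zero_less_numeral)
  then obtain D :: "nat \<Rightarrow> 'a c0 set"
    where D: "\<And>n. countable (D n)"
      "\<And>n f. \<exists>g\<in>D n. dist f g \<le> 3 * (1 / (4 * real (Suc n)))"
    by metis
  define B where "B = (\<Union>n. (\<lambda>g. ball g (1 / Suc n)) ` D n)"
  have "countable B"
    unfolding B_def using D(1) by auto
  moreover have "topological_basis B"
  proof (rule topological_basisI)
    show "open S" if "S \<in> B" for S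
      using that by (auto simp: B_def)
    fix S :: "'a c0 set" and f
    assume "open S" "f \<in> S"
    then obtain e where e: "e > 0" "ball f e \<subseteq> S"
      using openE by blast
    obtain n where n: "1 / Suc n < e / 2"
      using nat_approx_posE[of "e/2"] e by auto
    obtain g where g: "g \<in> D n" "dist f g \<le> 3 * (1 / (4 * real (Suc n)))"
      using D(2) by blast
    have lt: "dist f g < 1 / Suc n"
      by (rule le_less_trans[OF g(2)]) (simp add: field_simps)
    have "ball g (1 / Suc n) \<subseteq> ball f e"
    proof
      fix h assume "h \<in> ball g (1 / Suc n)"
      then show "h \<in> ball f e"
        using dist_triangle[of f h g] lt n by simp
    qed
    then show "\<exists>S'\<in>B. f \<in> S' \<and> S' \<subseteq> S"
      using g(1) e(2) lt
      by (intro bexI[of _ "ball g (1 / Suc n)"]) (auto simp: B_def dist_commute)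
  qed
  ultimately show "\<exists>B :: 'a c0 set set. countable B \<and> open = generate_topology B"
    using topological_basis_imp_subbasis by blast
qed

text \<open>
  A continuous function on the closure of \<open>Q\<close> vanishing on its boundary is identified with its
  extension by zero; the supremum over the closure of \<open>Q\<close> is then the norm of \<^typ>\<open>'a c0\<close>.
\<close>

definition C0 :: "'a::euclidean_space set \<Rightarrow> 'a c0 set"
  where "C0 Q = {u. \<forall>x. x \<notin> Q \<longrightarrow> apply_c0 u x = 0}"

lemma C0_extension:
  fixes f :: "'a::euclidean_space \<Rightarrow> real"
  assumes "open Q" "bounded Q" "continuous_on (closure Q) f" "\<And>x. x \<in> frontier Q \<Longrightarrow> f x = 0"
  shows "\<exists>!u. u \<in> C0 Q \<and> (\<forall>x\<in>closure Q. apply_c0 u x = f x)"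
proof -
  define g where "g x = (if x \<in> Q then f x else 0)" for x
  have g_cl: "g x = f x" if "x \<in> closure Q" for x
    using that assms(1,4) by (auto simp: g_def frontier_def interior_open)
  have "continuous_on (closure Q \<union> (- Q)) g"
  proof (rule continuous_on_closed_Un)
    show "continuous_on (closure Q) g"
      by (rule continuous_on_eq[OF assms(3)]) (simp add: g_cl)
    show "continuous_on (- Q) g"
      by (rule continuous_on_eq[of "- Q" "\<lambda>_. 0 :: real"]) (auto simp: g_def)
  qed (use assms(1) in auto)
  moreover have "closure Q \<union> (- Q) = UNIV"
    using closure_subset by blast
  ultimately have cont: "continuous_on UNIV g"
    by simp
  obtain b where b: "\<And>x. x \<in> Q \<Longrightarrow> norm x \<le> b"
    using assms(2) unfolding bounded_iff by blast
  have "\<forall>\<^sub>F x in at_infinity. g x = 0"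
    unfolding eventually_at_infinity
  proof (intro exI allI impI)
    fix x :: 'a assume "b + 1 \<le> norm x"
    then show "g x = 0"
      using b[of x] by (auto simp: g_def)
  qed
  then have "(g \<longlongrightarrow> 0) at_infinity"
    by (rule tendsto_eventually)
  from c0_of_continuous[OF cont this] obtain u where u: "apply_c0 u = g" .
  show ?thesis
  proof (rule ex1I[of _ u])
    show "u \<in> C0 Q \<and> (\<forall>x\<in>closure Q. apply_c0 u x = f x)"
      using u g_cl by (auto simp: C0_def g_def)
    fix v assume v: "v \<in> C0 Q \<and> (\<forall>x\<in>closure Q. apply_c0 v x = f x)"
    show "v = u"
    proof (rule c0_eqI)
      fix x show "apply_c0 v x = apply_c0 u x"
        using v u g_cl[of x] closure_subset[of Q] by (cases "x \<in> Q") (auto simp: C0_def g_def)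
    qed
  qed
qed


section \<open>Smooth functions, smooth domains and the Dirichlet Laplacian\<close>

fun Ck_on :: "nat \<Rightarrow> ('a::euclidean_space \<Rightarrow> real) \<Rightarrow> 'a set \<Rightarrow> bool" where
  "Ck_on 0 f U \<longleftrightarrow> continuous_on U f"
| "Ck_on (Suc k) f U \<longleftrightarrow> (\<forall>x\<in>U. f differentiable (at x)) \<and>
     (\<forall>i\<in>Basis. Ck_on k (\<lambda>x. frechet_derivative f (at x) i) U)"

definition smooth_on :: "('a::euclidean_space \<Rightarrow> real) \<Rightarrow> 'a set \<Rightarrow> bool"
  where "smooth_on f U \<longleftrightarrow> (\<forall>k. Ck_on k f U)"

definition smooth_boundary :: "'a::euclidean_space set \<Rightarrow> bool"
  where "smooth_boundary Q \<longleftrightarrow>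
    (\<forall>x\<in>frontier Q. \<exists>U \<rho>. open U \<and> x \<in> U \<and> smooth_on \<rho> U \<and>
       frechet_derivative \<rho> (at x) \<noteq> (\<lambda>_. 0) \<and> Q \<inter> U = {y \<in> U. \<rho> y < 0})"

definition laplacian :: "('a::euclidean_space \<Rightarrow> real) \<Rightarrow> 'a \<Rightarrow> real"
  where "laplacian f x =
    (\<Sum>i\<in>Basis. frechet_derivative (\<lambda>y. frechet_derivative f (at y) i) (at x) i)"

definition test_function :: "'a::euclidean_space set \<Rightarrow> ('a \<Rightarrow> real) \<Rightarrow> bool"
  where "test_function Q \<phi> \<longleftrightarrow> smooth_on \<phi> UNIV \<and> (\<exists>K. compact K \<and> K \<subseteq> Q \<and> (\<forall>x. x \<notin> K \<longrightarrow> \<phi> x = 0))"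

text \<open>
  The graph of \<open>-\<Delta>\<close> with homogeneous Dirichlet boundary condition in \<open>C\<^sub>0(cl Q)\<close>: its domain
  consists of those \<open>u\<close> in \<open>C\<^sub>0(cl Q)\<close> whose distributional Laplacian in \<open>Q\<close> is again in \<open>C\<^sub>0(cl Q)\<close>.
\<close>

definition dirichlet_neg_laplacian :: "'a::euclidean_space set \<Rightarrow> ('a c0 \<times> 'a c0) set"
  where "dirichlet_neg_laplacian Q = {(u, f). u \<in> C0 Q \<and> f \<in> C0 Q \<and>
    (\<forall>\<phi>. test_function Q \<phi> \<longrightarrow>
      (LINT x|lborel. apply_c0 u x * (- laplacian \<phi> x)) = (LINT x|lborel. apply_c0 f x * \<phi> x))}"

definition dirichlet_eigenvalue :: "'a::euclidean_space set \<Rightarrow> real \<Rightarrow> bool"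
  where "dirichlet_eigenvalue Q \<mu> \<longleftrightarrow> (\<exists>u. u \<noteq> 0 \<and> (u, \<mu> *\<^sub>R u) \<in> dirichlet_neg_laplacian Q)"

definition first_dirichlet_eigenvalue :: "'a::euclidean_space set \<Rightarrow> real \<Rightarrow> bool"
  where "first_dirichlet_eigenvalue Q lam \<longleftrightarrow>
    dirichlet_eigenvalue Q lam \<and> (\<forall>\<mu>. dirichlet_eigenvalue Q \<mu> \<longrightarrow> lam \<le> \<mu>)"

definition A_op :: "'a::euclidean_space set \<Rightarrow> real \<Rightarrow> ('a c0 \<times> 'a c0) set"
  where "A_op Q \<beta> = {(u, f - \<beta> *\<^sub>R u) | u f. (u, f) \<in> dirichlet_neg_laplacian Q}"


section \<open>The semigroup\<close>

definition C0_semigroup_on :: "'b::real_normed_vector set \<Rightarrow> (real \<Rightarrow> 'b \<Rightarrow> 'b) \<Rightarrow> bool"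
  where "C0_semigroup_on X S \<longleftrightarrow>
    (\<forall>t\<ge>0. (\<forall>u\<in>X. S t u \<in> X) \<and>
       (\<forall>u\<in>X. \<forall>v\<in>X. S t (u + v) = S t u + S t v) \<and>
       (\<forall>u\<in>X. \<forall>a. S t (a *\<^sub>R u) = a *\<^sub>R S t u) \<and>
       (\<exists>K. \<forall>u\<in>X. norm (S t u) \<le> K * norm u)) \<and>
    (\<forall>u\<in>X. S 0 u = u) \<and>
    (\<forall>s\<ge>0. \<forall>t\<ge>0. \<forall>u\<in>X. S (s + t) u = S s (S t u)) \<and>
    (\<forall>u\<in>X. ((\<lambda>t. S t u) \<longlongrightarrow> u) (at_right 0))"

definition generator_on :: "'b::real_normed_vector set \<Rightarrow> (real \<Rightarrow> 'b \<Rightarrow> 'b) \<Rightarrow> ('b \<times> 'b) set"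
  where "generator_on X S = {(u, f). u \<in> X \<and> f \<in> X \<and>
    ((\<lambda>t. (S t u - u) /\<^sub>R t) \<longlongrightarrow> f) (at_right 0)}"

text \<open>
  \<open>S t = e\<^bsup>-At\<^esup>\<close>, i.e. \<open>-A\<close> is the generator of \<open>S\<close>.  This determines \<open>S\<close> on \<open>C\<^sub>0(cl Q)\<close> uniquely;
  that \<open>S\<close> is analytic is a consequence and not a separate requirement.
\<close>

definition semigroup_of_A :: "'a::euclidean_space set \<Rightarrow> real \<Rightarrow> (real \<Rightarrow> 'a c0 \<Rightarrow> 'a c0) \<Rightarrow> bool"
  where "semigroup_of_A Q \<beta> S \<longleftrightarrow> C0_semigroup_on (C0 Q) S \<and>
    generator_on (C0 Q) S = {(u, - f) | u f. (u, f) \<in> A_op Q \<beta>}"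

text \<open>
  For \<open>t > 0\<close> the operator \<open>e\<^bsup>-At\<^esup>\<close> is applied to functions \<open>f\<close> in \<open>L\<^sup>\<infinity>(Q)\<close> that are not in
  \<open>C\<^sub>0(cl Q)\<close>.  It extends to a map into \<open>C\<^sub>0(cl Q)\<close> (with a bounded heat kernel), and the extension is
  given by the common limit of \<open>e\<^bsup>-At\<^esup> f\<^sub>k\<close> for all bounded sequences \<open>f\<^sub>k\<close> in \<open>C\<^sub>0(cl Q)\<close> that
  converge to \<open>f\<close> almost everywhere in \<open>Q\<close>.  For \<open>T = S 0\<close> and \<open>f\<close> not in \<open>C\<^sub>0(cl Q)\<close> the value is
  unspecified; it only enters integrands at one point.
\<close>

definition Linf_extension ::
    "'a::euclidean_space set \<Rightarrow> ('a c0 \<Rightarrow> 'a c0) \<Rightarrow> ('a \<Rightarrow> real) \<Rightarrow> 'a c0"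
  where "Linf_extension Q T f = (THE u. u \<in> C0 Q \<and>
    (\<forall>fk :: nat \<Rightarrow> 'a c0. range fk \<subseteq> C0 Q \<and> bounded (range fk) \<and>
       (AE x in lebesgue_on Q. (\<lambda>k. apply_c0 (fk k) x) \<longlonglongrightarrow> f x) \<longrightarrow> (\<lambda>k. T (fk k)) \<longlonglongrightarrow> u))"


section \<open>\<open>L\<^sup>1\<^sub>l\<^sub>o\<^sub>c(\<real>, L\<^sup>\<infinity>(Q))\<close>\<close>

definition Linf :: "'a::euclidean_space set \<Rightarrow> ('a \<Rightarrow> real) set"
  where "Linf Q = {f \<in> borel_measurable (lebesgue_on Q).
    esssup (lebesgue_on Q) (\<lambda>x. ereal \<bar>f x\<bar>) < \<infinity>}"

definition Linf_norm :: "'a::euclidean_space set \<Rightarrow> ('a \<Rightarrow> real) \<Rightarrow> real"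
  where "Linf_norm Q f = real_of_ereal (esssup (lebesgue_on Q) (\<lambda>x. ereal \<bar>f x\<bar>))"

text \<open>Strong (Bochner) measurability of a map into the non-separable space \<open>L\<^sup>\<infinity>(Q)\<close>.\<close>

definition strongly_measurable_Linf :: "'a::euclidean_space set \<Rightarrow> (real \<Rightarrow> 'a \<Rightarrow> real) \<Rightarrow> bool"
  where "strongly_measurable_Linf Q g \<longleftrightarrow> (\<exists>G :: nat \<Rightarrow> real \<Rightarrow> 'a \<Rightarrow> real.
    (\<forall>k. simple_function lebesgue (G k) \<and> range (G k) \<subseteq> Linf Q) \<and>
    (AE s in lebesgue. (\<lambda>k. Linf_norm Q (\<lambda>x. G k s x - g s x)) \<longlonglongrightarrow> 0))"

definition L1loc_Linf :: "'a::euclidean_space set \<Rightarrow> (real \<Rightarrow> 'a \<Rightarrow> real) set"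
  where "L1loc_Linf Q = {g. range g \<subseteq> Linf Q \<and> strongly_measurable_Linf Q g \<and>
    (\<forall>a b. set_integrable lebesgue {a..b} (\<lambda>s. Linf_norm Q (g s)))}"


section \<open>The noise\<close>

definition wiener_paths :: "(real \<Rightarrow> real) set"
  where "wiener_paths = {\<omega>. continuous_on UNIV \<omega> \<and> \<omega> 0 = 0}"

definition two_sided_wiener_measure :: "(real \<Rightarrow> real) measure \<Rightarrow> bool"
  where "two_sided_wiener_measure W \<longleftrightarrow>
    prob_space W \<and> space W = wiener_paths \<and>
    sets W = sets (restrict_space (\<Pi>\<^sub>M t\<in>UNIV. (borel :: real measure)) wiener_paths) \<and>
    (\<forall>s t. s < t \<longrightarrow>
       distributed W lborel (\<lambda>\<omega>. \<omega> t - \<omega> s) (\<lambda>x. ennreal (normal_density 0 (sqrt (t - s)) x))) \<and>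
    (\<forall>n (t :: nat \<Rightarrow> real). (\<forall>i<n. t i < t (Suc i)) \<longrightarrow>
       prob_space.indep_vars W (\<lambda>_. borel) (\<lambda>i \<omega>. \<omega> (t (Suc i)) - \<omega> (t i)) {..<n})"

definition noise_paths :: "(real \<Rightarrow> real) measure \<Rightarrow> (real \<Rightarrow> real) set \<Rightarrow> bool"
  where "noise_paths W \<Omega> \<longleftrightarrow> \<Omega> \<subseteq> wiener_paths \<and> (AE \<omega> in W. \<omega> \<in> \<Omega>) \<and>
    (\<forall>t. \<forall>\<omega>\<in>\<Omega>. (\<lambda>s. \<omega> (s + t) - \<omega> t) \<in> \<Omega>) \<and>
    (\<forall>\<omega>\<in>\<Omega>. ((\<lambda>t. \<omega> t / t) \<longlongrightarrow> 0) at_top \<and> ((\<lambda>t. \<omega> t / t) \<longlongrightarrow> 0) at_bot)"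

text \<open>Used for \<open>\<omega>\<^sup>t\<close>, \<open>g\<^sup>t\<close> and \<open>h\<^sup>t\<close> alike.\<close>

definition translate :: "real \<Rightarrow> (real \<Rightarrow> 'b) \<Rightarrow> real \<Rightarrow> 'b"
  where "translate t f = (\<lambda>s. f (s + t))"

text \<open>
  The translate \<open>\<omega>\<^sup>t\<close> need not vanish at \<open>0\<close> and so need not lie in \<open>\<Omega>\<close>, while quasi-solutions are
  evaluated at translates.  They are therefore maps on the set of all translates, which
  contains \<open>\<Omega>\<close> (\<open>t = 0\<close>), and the defining equation is required for all translates.
\<close>

definition translates :: "(real \<Rightarrow> real) set \<Rightarrow> (real \<Rightarrow> real) set"
  where "translates \<Omega> = {translate t \<omega> | t \<omega>. \<omega> \<in> \<Omega>}"


section \<open>Mild solutions and tempered complete quasi-solutions\<close>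

definition zfac :: "real \<Rightarrow> real \<Rightarrow> (real \<Rightarrow> real) \<Rightarrow> real"
  where "zfac \<alpha> t \<omega> = exp (- \<alpha> * \<omega> t)"

definition mild_solution ::
    "'a::euclidean_space set \<Rightarrow> (real \<Rightarrow> 'a c0 \<Rightarrow> 'a c0) \<Rightarrow> real \<Rightarrow> real \<Rightarrow> real \<Rightarrow> (real \<Rightarrow> real) \<Rightarrow>
     (real \<Rightarrow> 'a \<Rightarrow> real) \<Rightarrow> (real \<Rightarrow> 'a \<Rightarrow> real) \<Rightarrow> 'a c0 \<Rightarrow> 'a c0"
  where "mild_solution Q S \<alpha> t \<tau> \<omega> g h v0 = S (t - \<tau>) v0 +
    (LINT s:{\<tau>..t}|lebesgue. zfac \<alpha> s \<omega> *\<^sub>R Linf_extension Q (S (t - s)) (\<lambda>x. h s x + \<bar>g s x\<bar>))"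

definition complete_quasi_solution ::
    "'a::euclidean_space set \<Rightarrow> (real \<Rightarrow> 'a c0 \<Rightarrow> 'a c0) \<Rightarrow> real \<Rightarrow> (real \<Rightarrow> real) set \<Rightarrow>
     (real \<Rightarrow> 'a \<Rightarrow> real) \<Rightarrow> (real \<Rightarrow> 'a \<Rightarrow> real) \<Rightarrow> (real \<Rightarrow> (real \<Rightarrow> real) \<Rightarrow> 'a c0) \<Rightarrow> bool"
  where "complete_quasi_solution Q S \<alpha> \<Omega> g h \<xi> \<longleftrightarrow>
    (\<forall>\<tau>. \<forall>\<omega>\<in>translates \<Omega>. \<xi> \<tau> \<omega> \<in> C0 Q) \<and>
    (\<forall>\<tau>. \<forall>t>0. \<forall>\<omega>\<in>translates \<Omega>.
       mild_solution Q S \<alpha> (t + \<tau>) \<tau> (translate (- \<tau>) \<omega>) g h (\<xi> \<tau> \<omega>) = \<xi> (\<tau> + t) (translate t \<omega>))"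

definition tempered ::
    "(real \<Rightarrow> real) set \<Rightarrow> (real \<Rightarrow> (real \<Rightarrow> real) \<Rightarrow> 'a::euclidean_space c0) \<Rightarrow> bool"
  where "tempered \<Omega> \<xi> \<longleftrightarrow> (\<forall>c>0. \<forall>\<tau>. \<forall>\<omega>\<in>\<Omega>.
    ((\<lambda>t. exp (c * t) * norm (\<xi> (\<tau> + t) (translate t \<omega>))) \<longlongrightarrow> 0) at_bot)"

end

theory Submission
  imports Defs "HOL-Library.Diagonal_Subsequence"
begin

text \<open>
  Up to the factor \<open>e\<^bsup>\<beta>t\<^esup>\<close> the semigroup is the heat semigroup \<open>T\<close> of the Dirichlet Laplacian, and all
  that is needed about it is drawn from its generator.  By mollification, elements of the domain of
  the generator are viscosity solutions, which gives a comparison principle for orbits against smooth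
  supersolutions.  Comparison with constants and with the Gaussian shows that \<open>T t\<close> is a positive
  contraction that is bounded from \<open>L\<^sup>1\<close> to \<open>L\<^sup>\<infinity>\<close> for \<open>t > 0\<close>.  Hence bounded almost everywhere
  convergent sequences are mapped to norm convergent ones, which makes the extension to \<open>L\<^sup>\<infinity>(Q)\<close>
  well defined, and \<open>T t\<close> is compact on \<open>L\<^sup>2\<close>-bounded sets.  Testing the equation with smooth truncations
  shows that \<open>T t\<close> is symmetric in \<open>L\<^sup>2\<close>, so that the \<open>L\<^sup>2\<close>-norm of \<open>T 1\<close> is attained at an eigenfunction
  of the Laplacian and is at most \<open>e\<^bsup>-\<lambda>\<^esup>\<close>; the \<open>L\<^sup>2\<close>-\<open>L\<^sup>\<infinity>\<close> bound turns this into the decay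
  \<open>M e\<^bsup>-\<lambda>t\<^esup>\<close> in the supremum norm.  Two mild solutions driven by the same path differ by the
  semigroup applied to the difference of their initial data, whence attraction and uniqueness; the
  integral defining \<open>\<xi>\<close> converges and is tempered because \<open>\<omega>\<close> grows sublinearly.
\<close>

section \<open>Smooth functions\<close>

text \<open>The exact rate e^(-\<lambda>t) forces the detour through L2. Comparison gives no decay,
  and a spectral radius only gives rates below \<lambda>; for a symmetric operator the norm itself
  comes from an eigenvalue, so every unit of time gains a full factor e^(-\<lambda>) and changing
  norms costs only the constant \<open>M\<close>. The obstacle to symmetry is that domain elements
  are described by test functions alone: no derivatives up to the boundary are at hand, hence no
  Green formula. The boundary term is replaced by the smallness of one function where the other is
  small, which needs a factor that is strictly positive in \<open>Q\<close>. This is why symmetry is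
  proved in stages. \<open>C0 Q\<close> is not complete in L2, so approximate Riesz representatives
  and weakly Cauchy sequences take the place of exact representatives and weak limits. The
  maximisation yields an eigenvector of the single operator \<open>T 2\<close>; halving the time
  carries it to the generator, whose eigenvalues define \<lambda>.\<close>

lemma has_derivative_imp_frechet:
  "(f has_derivative f') (at x) \<Longrightarrow> frechet_derivative f (at x) = f'"
  using frechet_derivative_at by metis

lemma Ck_on_SucI:
  assumes "\<And>x. (f has_derivative f' x) (at x)" "\<And>i. i \<in> Basis \<Longrightarrow> Ck_on k (\<lambda>x. f' x i) UNIV"
  shows "Ck_on (Suc k) f UNIV"
proof -
  have "frechet_derivative f (at x) = f' x" for x
    by (rule has_derivative_imp_frechet[OF assms(1)])
  then show ?thesis
    using assms by (auto simp: differentiable_def)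
qed

lemma Ck_on_SucD:
  assumes "Ck_on (Suc k) f UNIV"
  shows "(f has_derivative frechet_derivative f (at x)) (at x)"
    and "i \<in> Basis \<Longrightarrow> Ck_on k (\<lambda>x. frechet_derivative f (at x) i) UNIV"
  using assms by (auto simp: frechet_derivative_works[symmetric])

lemma Ck_on_Suc_imp: "Ck_on (Suc k) f UNIV \<Longrightarrow> Ck_on k f UNIV"
proof (induction k arbitrary: f)
  case 0
  then show ?case
    by (auto intro!: differentiable_imp_continuous_on simp: differentiable_on_def)
next
  case (Suc k)
  then show ?case
    by (metis Ck_on.simps(2))
qed

lemma Ck_on_const: "Ck_on k (\<lambda>_. c) UNIV"
proof (induction k arbitrary: c)
  case (Suc k)
  show ?case
    by (rule Ck_on_SucI[of _ "\<lambda>_ _. 0"]) (auto intro: Suc)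
qed simp

lemma Ck_on_add: "Ck_on k f UNIV \<Longrightarrow> Ck_on k g UNIV \<Longrightarrow> Ck_on k (\<lambda>x. f x + g x) UNIV"
proof (induction k arbitrary: f g)
  case (Suc k)
  show ?case
    by (rule Ck_on_SucI[OF has_derivative_add[OF Ck_on_SucD(1)[OF Suc.prems(1)] Ck_on_SucD(1)[OF Suc.prems(2)]]])
      (auto intro!: Suc.IH Ck_on_SucD(2)[OF Suc.prems(1)] Ck_on_SucD(2)[OF Suc.prems(2)])
qed (auto intro: continuous_intros)

lemma Ck_on_mult: "Ck_on k f UNIV \<Longrightarrow> Ck_on k g UNIV \<Longrightarrow> Ck_on k (\<lambda>x. f x * g x) UNIV"
proof (induction k arbitrary: f g)
  case (Suc k)
  show ?case
    by (rule Ck_on_SucI[OF has_derivative_mult[OF Ck_on_SucD(1)[OF Suc.prems(1)] Ck_on_SucD(1)[OF Suc.prems(2)]]])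
      (auto intro!: Ck_on_add Suc.IH Ck_on_Suc_imp[OF Suc.prems(1)] Ck_on_Suc_imp[OF Suc.prems(2)]
        Ck_on_SucD(2)[OF Suc.prems(1)] Ck_on_SucD(2)[OF Suc.prems(2)])
qed (auto intro: continuous_intros)

lemma Ck_on_bounded_linear: "bounded_linear f \<Longrightarrow> Ck_on k f UNIV"
proof (cases k)
  case 0
  assume "bounded_linear f"
  then show ?thesis using 0
    by (auto intro: linear_continuous_on)
next
  case (Suc m)
  assume "bounded_linear f"
  then show ?thesis
    unfolding Suc by (intro Ck_on_SucI[of _ "\<lambda>_. f"] bounded_linear_imp_has_derivative Ck_on_const)
qed

text \<open>Induction on the order: a partial derivative is the derivative of \<open>f\<close> along
  \<open>v\<close> times a partial derivative of \<open>v\<close>. The outer function changes in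
  each step while \<open>v\<close> stays, so the hypothesis is generalised over \<open>f\<close>
  only.\<close>

lemma Ck_on_compose:
  fixes f :: "real \<Rightarrow> real"
  shows "Ck_on k f UNIV \<Longrightarrow> Ck_on k v UNIV \<Longrightarrow> Ck_on k (\<lambda>x. f (v x)) UNIV"
proof (induction k arbitrary: f)
  case 0
  then show ?case
    by (auto intro: continuous_on_compose2)
next
  case (Suc k)
  have lin: "frechet_derivative f (at s) c = frechet_derivative f (at s) 1 * c" for s c
    using linear_cmul[OF has_derivative_linear[OF Ck_on_SucD(1)[OF Suc.prems(1)]], of s c 1]
    by (simp add: mult.commute)
  show ?case
  proof (rule Ck_on_SucI)
    show "((\<lambda>x. f (v x)) has_derivative (\<lambda>h. frechet_derivative f (at (v x)) 1 * frechet_derivative v (at x) h)) (at x)" for x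
      using has_derivative_compose[OF Ck_on_SucD(1)[OF Suc.prems(2)] Ck_on_SucD(1)[OF Suc.prems(1)], of x]
      by (subst (asm) lin)
    show "i \<in> Basis \<Longrightarrow> Ck_on k (\<lambda>x. frechet_derivative f (at (v x)) 1 * frechet_derivative v (at x) i) UNIV" for i
      using Ck_on_SucD(2)[OF Suc.prems(1), of 1]
      by (intro Ck_on_mult Suc.IH[of "\<lambda>s. frechet_derivative f (at s) 1"] Ck_on_SucD(2)[OF Suc.prems(2)] Ck_on_Suc_imp[OF Suc.prems(2)]) auto
  qed
qed

lemma Ck_on_real_SucI:
  fixes f :: "real \<Rightarrow> real"
  assumes "\<And>x. (f has_real_derivative f' x) (at x)" "Ck_on k f' UNIV"
  shows "Ck_on (Suc k) f UNIV"
  by (rule Ck_on_SucI[OF assms(1)[unfolded has_field_derivative_def]]) (use assms(2) in auto)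

lemma smooth_on_continuous: "smooth_on f UNIV \<Longrightarrow> continuous_on UNIV f"
  by (metis Ck_on.simps(1) smooth_on_def)

lemma smooth_on_derivative:
  assumes "smooth_on f UNIV"
  shows "(f has_derivative frechet_derivative f (at x)) (at x)"
    and "i \<in> Basis \<Longrightarrow> smooth_on (\<lambda>x. frechet_derivative f (at x) i) UNIV"
  using Ck_on_SucD[of _ f] assms unfolding smooth_on_def by blast+

lemma smooth_on_mult: "smooth_on f UNIV \<Longrightarrow> smooth_on g UNIV \<Longrightarrow> smooth_on (\<lambda>x. f x * g x) UNIV"
  unfolding smooth_on_def by (auto intro: Ck_on_mult)

lemma smooth_on_compose:
  fixes f :: "real \<Rightarrow> real"
  shows "smooth_on f UNIV \<Longrightarrow> smooth_on v UNIV \<Longrightarrow> smooth_on (\<lambda>x. f (v x)) UNIV"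
  unfolding smooth_on_def by (auto intro: Ck_on_compose)

lemma smooth_on_affine: "bounded_linear f \<Longrightarrow> smooth_on (\<lambda>x. c + f x) UNIV"
  unfolding smooth_on_def by (intro allI Ck_on_add Ck_on_const Ck_on_bounded_linear)

lemma smooth_on_real_antiderivative:
  fixes f :: "real \<Rightarrow> real"
  assumes "\<And>x. (f has_real_derivative f' x) (at x)" "smooth_on f' UNIV"
  shows "smooth_on f UNIV"
  unfolding smooth_on_def
proof
  fix k
  show "Ck_on k f UNIV"
    using Ck_on_Suc_imp[OF Ck_on_real_SucI[OF assms(1)]] assms(2) unfolding smooth_on_def by blast
qed

lemma smooth_on_inner_self: "smooth_on (\<lambda>x::'a::euclidean_space. x \<bullet> x) UNIV"
  unfolding smooth_on_def
proof
  fix k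
  have "Ck_on (Suc k) (\<lambda>x::'a::euclidean_space. x \<bullet> x) UNIV"
  proof (rule Ck_on_SucI)
    show "((\<lambda>x::'a. x \<bullet> x) has_derivative (\<lambda>h. 2 * (x \<bullet> h))) (at x)" for x
      by (auto intro!: derivative_eq_intros simp: inner_commute)
    show "Ck_on k (\<lambda>x::'a. 2 * (x \<bullet> i)) UNIV" for i
      by (intro Ck_on_bounded_linear bounded_linear_const_mult bounded_linear_inner_left)
  qed
  then show "Ck_on k (\<lambda>x::'a::euclidean_space. x \<bullet> x) UNIV"
    by (rule Ck_on_Suc_imp)
qed

section \<open>A smooth bump and a smooth convex truncation\<close>

definition flat :: "nat \<Rightarrow> real \<Rightarrow> real"
  where "flat m s = (if s \<le> 0 then 0 else exp (- (1 / s)) / s ^ m)"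

lemma flat_tendsto_0: "(flat m \<longlongrightarrow> 0) (at 0)"
proof -
  have "filterlim (\<lambda>s::real. inverse s) at_top (at_right 0)"
    by (rule filterlim_inverse_at_top_right)
  then have "((\<lambda>s::real. inverse s ^ m / exp (inverse s)) \<longlongrightarrow> 0) (at_right 0)"
    by (rule filterlim_compose[OF tendsto_power_div_exp_0])
  then have "(flat m \<longlongrightarrow> 0) (at_right 0)"
    by (rule Lim_transform_eventually)
      (auto intro!: eventually_at_rightI[of 0 1] simp: flat_def exp_minus field_simps)
  moreover have "(flat m \<longlongrightarrow> 0) (at_left 0)"
    by (rule tendsto_eventually) (auto intro!: eventually_at_leftI[of "-1" 0] simp: flat_def)
  ultimately show ?thesis
    by (simp add: filterlim_at_split)
qed

text \<open>The powers in the denominator make the family closed under differentiation, so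
  smoothness of every \<open>flat m\<close> follows by one induction on the order. For
  \<open>m = 0\<close> it is the classical flat function exp(-1/s).\<close>

lemma flat_derivative: "(flat m has_real_derivative flat (m + 2) s - m * flat (m + 1) s) (at s)"
proof (cases s "0::real" rule: linorder_cases)
  case less
  have "((\<lambda>_. 0) has_real_derivative 0) (at s)" by simp
  then have "(flat m has_real_derivative 0) (at s)"
    by (rule has_field_derivative_transform_within[of _ _ _ _ "-s"]) (use less in \<open>auto simp: flat_def dist_real_def\<close>)
  then show ?thesis using less by (simp add: flat_def)
next
  case equal
  \<comment> \<open>At 0 the difference quotient of \<open>flat m\<close> is
    \<open>flat (m + 1)\<close> itself.\<close>
  have "((\<lambda>h. (flat m (0 + h) - flat m 0) / h) \<longlongrightarrow> 0) (at 0)"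
    by (rule Lim_transform_eventually[OF flat_tendsto_0[of "m + 1"]])
      (auto simp: flat_def eventually_at_filter)
  then show ?thesis using equal by (simp add: DERIV_def) (simp add: flat_def)
next
  case greater
  have "((\<lambda>s. exp (- (1 / s)) / s ^ m) has_real_derivative
      (exp (- (1 / s)) * (1 / s ^ 2) * s ^ m - exp (- (1 / s)) * (m * s ^ (m - 1))) / (s ^ m * s ^ m)) (at s)"
    using greater by (auto intro!: derivative_eq_intros simp: power2_eq_square)
  also have "(exp (- (1 / s)) * (1 / s ^ 2) * s ^ m - exp (- (1 / s)) * (m * s ^ (m - 1))) / (s ^ m * s ^ m)
      = flat (m + 2) s - m * flat (m + 1) s"
    using greater by (cases m) (auto simp: flat_def field_simps power2_eq_square)
  finally have "((\<lambda>s. exp (- (1 / s)) / s ^ m) has_real_derivative flat (m + 2) s - m * flat (m + 1) s) (at s)" .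
  then show ?thesis
    by (rule has_field_derivative_transform_within[of _ _ _ _ s]) (use greater in \<open>auto simp: flat_def dist_real_def\<close>)
qed

lemma smooth_on_flat: "smooth_on (flat m) UNIV"
  unfolding smooth_on_def
proof
  fix k
  show "Ck_on k (flat m) UNIV"
  proof (induction k arbitrary: m)
    case 0
    show ?case
      using flat_derivative by (auto intro!: DERIV_isCont simp: continuous_on_eq_continuous_at)
  next
    case (Suc k)
    have "Ck_on k (\<lambda>s. flat (m + 2) s + (- real m) * flat (m + 1) s) UNIV"
      by (intro Ck_on_add Ck_on_mult Ck_on_const Suc)
    then show ?case
      by (intro Ck_on_real_SucI[OF flat_derivative]) simp
  qed
qed

lemma flat_pos: "0 < s \<Longrightarrow> 0 < flat m s" and flat_zero: "s \<le> 0 \<Longrightarrow> flat m s = 0" and flat_nonneg: "0 \<le> flat m s"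
  by (auto simp: flat_def)

lemma real_antiderivative:
  fixes f :: "real \<Rightarrow> real"
  assumes "continuous_on UNIV f"
  obtains F where "\<And>x. (F has_real_derivative f x) (at x)"
  using einterval_antiderivative[of "-\<infinity>" "\<infinity>" f] assms
  by (auto simp: has_real_derivative_iff_has_vector_derivative continuous_on_eq_continuous_at)

lemma real_DERIV_nonneg_le:
  fixes f :: "real \<Rightarrow> real"
  assumes "\<And>x. (f has_real_derivative f' x) (at x)" "\<And>x. a \<le> x \<Longrightarrow> x \<le> b \<Longrightarrow> 0 \<le> f' x" "a \<le> b"
  shows "f a \<le> f b"
  by (rule DERIV_nonneg_imp_nondecreasing[OF assms(3)]) (use assms in blast)

text \<open>\<open>j\<close> is a second antiderivative of a bump on (1, 2) of mass 1, a smooth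
  convex substitute for the positive part. Vanishing up to 1 gives compositions compact support,
  convexity gives the gradient term of the Laplacian a sign, and slope 1 from 2 on lets rescaled
  truncations recover the function.\<close>

lemma smooth_truncation:
  obtains j j1 j2 :: "real \<Rightarrow> real" where
    "\<And>s. (j has_real_derivative j1 s) (at s)" "\<And>s. (j1 has_real_derivative j2 s) (at s)"
    "smooth_on j UNIV" "continuous_on UNIV j1" "continuous_on UNIV j2"
    "\<And>s. 0 \<le> j2 s" "\<And>s. s \<le> 1 \<or> 2 \<le> s \<Longrightarrow> j2 s = 0"
    "\<And>s. 0 \<le> j1 s" "\<And>s. j1 s \<le> 1" "\<And>s. s \<le> 1 \<Longrightarrow> j1 s = 0" "\<And>s. 2 \<le> s \<Longrightarrow> j1 s = 1"
    "\<And>s. s \<le> 1 \<Longrightarrow> j s = 0" "\<And>s. 0 \<le> s \<Longrightarrow> \<bar>j s - s\<bar> \<le> 2"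
proof -
  define \<theta> where "\<theta> s = flat 0 (s - 1) * flat 0 (2 - s)" for s
  have "smooth_on (\<lambda>s. flat 0 ((- 1) + s) * flat 0 (2 + (- s))) UNIV"
    by (intro smooth_on_mult smooth_on_compose[OF smooth_on_flat] smooth_on_affine
        bounded_linear_ident bounded_linear_minus)
  then have \<theta>: "smooth_on \<theta> UNIV"
    by (simp add: \<theta>_def[abs_def])
  have \<theta>0: "0 \<le> \<theta> s" "s \<le> 1 \<or> 2 \<le> s \<Longrightarrow> \<theta> s = 0" "1 < s \<Longrightarrow> s < 2 \<Longrightarrow> 0 < \<theta> s" for s
    by (auto simp: \<theta>_def flat_nonneg flat_zero intro!: mult_pos_pos flat_pos)
  obtain F where F: "\<And>s. (F has_real_derivative \<theta> s) (at s)"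
    using real_antiderivative[OF smooth_on_continuous[OF \<theta>]] by metis
  have F_le: "F a \<le> F b" if "a \<le> b" for a b
    by (rule real_DERIV_nonneg_le[OF F \<theta>0(1) that])
  have F_const: "F a = F b" if "a \<le> b" "b \<le> 1 \<or> 2 \<le> a" for a b
  proof (rule order_antisym)
    have "- F a \<le> - F b"
      by (rule real_DERIV_nonneg_le[OF DERIV_minus[OF F] _ that(1)]) (use that(2) in \<open>auto simp: \<theta>0(2)\<close>)
    then show "F b \<le> F a" by simp
  qed (rule F_le[OF that(1)])
  have "F 1 < F 2"
  proof -
    obtain z where "1 < z" "z < 2" "F 2 - F 1 = (2 - 1) * \<theta> z"
      using MVT2[of 1 2 F \<theta>] F by auto
    then show ?thesis using \<theta>0(3) by force
  qed
  define c where "c = F 2 - F 1"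
  have c: "c > 0" using \<open>F 1 < F 2\<close> by (simp add: c_def)
  define j1 where "j1 s = (F s - F 1) / c" for s
  define j2 where "j2 s = \<theta> s / c" for s
  have j1: "(j1 has_real_derivative j2 s) (at s)" for s
    unfolding j1_def j2_def using c by (auto intro!: derivative_eq_intros F)
  have "smooth_on (\<lambda>s. inverse c * \<theta> s) UNIV"
    by (intro smooth_on_mult[OF _ \<theta>]) (simp add: smooth_on_def Ck_on_const)
  then have sj2: "smooth_on j2 UNIV" by (simp add: j2_def[abs_def] field_simps)
  have sj1: "smooth_on j1 UNIV" by (rule smooth_on_real_antiderivative[OF j1 sj2])
  have j1_0: "s \<le> 1 \<Longrightarrow> j1 s = 0" for s
    using F_const[of s 1] by (simp add: j1_def)
  have j1_1: "2 \<le> s \<Longrightarrow> j1 s = 1" for s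
    using F_const[of 2 s] c by (simp add: j1_def c_def)
  have j1_mono: "a \<le> b \<Longrightarrow> j1 a \<le> j1 b" for a b
    using F_le[of a b] c by (simp add: j1_def divide_right_mono)
  have j1_nonneg: "0 \<le> j1 s" for s
    using j1_0[of s] j1_0[of 1] j1_mono[of 1 s] by (cases "s \<le> 1") auto
  have j1_le: "j1 s \<le> 1" for s
    using j1_1[of s] j1_1[of 2] j1_mono[of s 2] by (cases "s \<le> 2") auto
  obtain J where J: "\<And>s. (J has_real_derivative j1 s) (at s)"
    using real_antiderivative[OF smooth_on_continuous[OF sj1]] by metis
  define j where "j s = J s - J 1" for s
  have j: "(j has_real_derivative j1 s) (at s)" for s
    unfolding j_def by (auto intro!: derivative_eq_intros J)
  have j_0: "j s = 0" if "s \<le> 1" for s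
  proof -
    have "J s \<le> J 1" by (rule real_DERIV_nonneg_le[OF J j1_nonneg that])
    moreover have "- J s \<le> - J 1"
      by (rule real_DERIV_nonneg_le[OF DERIV_minus[OF J] _ that]) (simp add: j1_0)
    ultimately show ?thesis by (simp add: j_def)
  qed
  \<comment> \<open>The function s - j s is nondecreasing, equals 1 at 1, is at most 2 at 2 and
    constant from there on.\<close>
  have "\<bar>j s - s\<bar> \<le> 2" if "0 \<le> s" for s
  proof (cases "s \<le> 1")
    case True
    then show ?thesis using that by (simp add: j_0)
  next
    case False
    then have "j 1 \<le> j s" by (intro real_DERIV_nonneg_le[OF j j1_nonneg]) auto
    moreover have "1 - j 1 \<le> s - j s"
      by (rule real_DERIV_nonneg_le[where f = "\<lambda>s. s - j s" and f' = "\<lambda>s. 1 - j1 s"])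
        (use False in \<open>auto intro!: derivative_eq_intros j simp: j1_le\<close>)
    moreover have "s - j s \<le> 2 - j 2"
    proof (cases "s \<le> 2")
      case True
      show ?thesis
        by (rule real_DERIV_nonneg_le[where f = "\<lambda>s. s - j s" and f' = "\<lambda>s. 1 - j1 s"])
          (use True in \<open>auto intro!: derivative_eq_intros j simp: j1_le\<close>)
    next
      case False
      have "j 2 - 2 \<le> j s - s"
        by (rule real_DERIV_nonneg_le[where f = "\<lambda>s. j s - s" and f' = "\<lambda>s. j1 s - 1"])
          (use False in \<open>auto intro!: derivative_eq_intros j simp: j1_1\<close>)
      then show ?thesis by simp
    qed
    moreover have "j 1 \<le> j 2" by (intro real_DERIV_nonneg_le[OF j j1_nonneg]) auto
    ultimately show ?thesis using j_0[of 1] by linarith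
  qed
  then show thesis
    using that[of j j1 j2] j j1 smooth_on_real_antiderivative[OF j sj1] smooth_on_continuous[OF sj1]
      smooth_on_continuous[OF sj2] \<theta>0 c j1_nonneg j1_le j1_0 j1_1 j_0
    by (auto simp: j2_def)
qed

subsection \<open>Integrals of continuous functions with bounded support\<close>

lemma integrable_bounded_support:
  fixes f :: "'a::euclidean_space \<Rightarrow> real"
  assumes "continuous_on UNIV f" "bounded K" "\<And>x. x \<notin> K \<Longrightarrow> f x = 0"
  shows "integrable lborel f"
proof -
  obtain a b where ab: "K \<subseteq> cbox a b"
    using bounded_subset_cbox_symmetric[OF assms(2)] by blast
  have "integrable lborel (\<lambda>x. indicator (cbox a b) x *\<^sub>R f x)"
    by (intro borel_integrable_compact continuous_on_subset[OF assms(1)]) auto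
  also have "(\<lambda>x. indicator (cbox a b) x *\<^sub>R f x) = f"
    by (rule ext) (use assms(3) ab in \<open>auto simp: indicator_def\<close>)
  finally show ?thesis .
qed

lemma uniformly_continuous_bounded_support:
  fixes f :: "'a::euclidean_space \<Rightarrow> real"
  assumes "continuous_on UNIV f" "bounded K" "\<And>x. x \<notin> K \<Longrightarrow> f x = 0" "0 < e"
  obtains d where "0 < d" "\<And>x y. dist x y < d \<Longrightarrow> \<bar>f x - f y\<bar> < e"
proof -
  obtain r where r: "\<And>x. x \<in> K \<Longrightarrow> norm x \<le> r"
    using assms(2) unfolding bounded_iff by blast
  have "uniformly_continuous_on (cball 0 (r + 1)) f"
    by (intro compact_uniformly_continuous continuous_on_subset[OF assms(1)]) auto
  then obtain d where d: "0 < d" "\<And>x y. x \<in> cball 0 (r + 1) \<Longrightarrow> y \<in> cball 0 (r + 1) \<Longrightarrow> dist x y < d \<Longrightarrow> dist (f x) (f y) < e"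
    unfolding uniformly_continuous_on_def using assms(4) by metis
  show thesis
  proof
    \<comment> \<open>Capping at 1 leaves two cases: both points lie in the enlarged ball, or both
      lie outside \<open>K\<close>.\<close>
    show "0 < min d 1" using d by simp
    fix x y :: 'a assume xy: "dist x y < min d 1"
    show "\<bar>f x - f y\<bar> < e"
    proof (cases "norm x \<le> r + 1 \<and> norm y \<le> r + 1")
      case True
      then show ?thesis using d(2)[of x y] xy by (simp add: dist_real_def)
    next
      case False
      moreover have "norm x \<le> norm y + dist x y" "norm y \<le> norm x + dist x y"
        using norm_triangle_sub[of x y] norm_triangle_sub[of y x] by (auto simp: dist_norm norm_minus_commute)
      ultimately have "norm x > r" "norm y > r" using xy by auto
      then show ?thesis using assms(3,4) r by (metis abs_zero diff_zero leD)
    qed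
  qed
qed

text \<open>The set where \<open>f\<close> is nonzero is open and negligible, hence empty.\<close>

lemma continuous_nonneg_integral_zero:
  fixes f :: "'a::euclidean_space \<Rightarrow> real"
  assumes "continuous_on UNIV f" "integrable lborel f" "\<And>x. 0 \<le> f x" "(LINT x|lborel. f x) = 0"
  shows "f x = 0"
proof -
  have "AE x in lborel. f x = 0"
    using integral_nonneg_eq_0_iff_AE[OF assms(2)] assms by auto
  then obtain N where N: "{x. f x \<noteq> 0} \<subseteq> N" "N \<in> null_sets lborel"
    by (auto simp: eventually_ae_filter)
  then have "negligible {x. f x \<noteq> 0}"
    by (metis negligible_iff_null_sets negligible_subset null_sets_completionI)
  moreover have "open {x. f x \<noteq> 0}"
    using open_Collect_neq[OF assms(1), of "\<lambda>_. 0"] by simp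
  ultimately show ?thesis
    using open_not_negligible by blast
qed

lemma integral_reflect_lborel:
  fixes f :: "'a::euclidean_space \<Rightarrow> real"
  assumes "f \<in> borel_measurable borel"
  shows "(LINT y|lborel. f (x - y)) = (LINT y|lborel. f y)"
    and "integrable lborel f \<Longrightarrow> integrable lborel (\<lambda>y. f (x - y))"
proof -
  have eq: "(lborel :: 'a measure) = distr lborel borel (\<lambda>y. x - y)"
    using lborel_affine[of "-1" x] by (simp add: density_1)
  show "(LINT y|lborel. f (x - y)) = (LINT y|lborel. f y)"
    by (subst (2) eq, subst integral_distr) (use assms in auto)
  show "integrable lborel f \<Longrightarrow> integrable lborel (\<lambda>y. f (x - y))"
    by (subst (asm) eq, subst (asm) integrable_distr_eq) (use assms in auto)
qed

subsection \<open>Convolution with a smooth kernel\<close>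

text \<open>Derivatives always fall on the second factor; the first is continuous with bounded
  support. As no decay of the second is asked for, the same lemmas serve mollifiers, Gaussians and,
  with a cutoff as first factor, integrals of test functions.\<close>

definition conv :: "('a::euclidean_space \<Rightarrow> real) \<Rightarrow> ('a \<Rightarrow> real) \<Rightarrow> 'a \<Rightarrow> real"
  where "conv f \<kappa> x = (LINT y|lborel. f y * \<kappa> (x - y))"

lemma integrable_conv:
  fixes f :: "'a::euclidean_space \<Rightarrow> real"
  assumes "continuous_on UNIV f" "bounded K" "\<And>x. x \<notin> K \<Longrightarrow> f x = 0" "continuous_on UNIV \<kappa>"
  shows "integrable lborel (\<lambda>y. f y * \<kappa> (x - y))"
  by (rule integrable_bounded_support[OF _ assms(2)])
    (use assms in \<open>auto intro!: continuous_intros continuous_on_compose2[OF assms(4)]\<close>)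

text \<open>As an integral over a fixed box the convolution is open to the theorems on parameter
  integrals, in particular to the Leibniz rule.\<close>

lemma conv_eq_integral:
  fixes f :: "'a::euclidean_space \<Rightarrow> real"
  assumes "continuous_on UNIV f" "\<And>x. x \<notin> cbox a b \<Longrightarrow> f x = 0" "continuous_on UNIV \<kappa>"
  shows "conv f \<kappa> x = integral (cbox a b) (\<lambda>y. f y * \<kappa> (x - y))"
proof -
  have "integrable lborel (\<lambda>y. f y * \<kappa> (x - y))"
    by (rule integrable_conv[OF assms(1) bounded_cbox assms(2,3)])
  then have i: "set_integrable lborel (cbox a b) (\<lambda>y. f y * \<kappa> (x - y))"
    unfolding set_integrable_def by (intro integrable_mult_indicator) auto
  have "conv f \<kappa> x = (LINT y:cbox a b|lborel. f y * \<kappa> (x - y))"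
    unfolding conv_def set_lebesgue_integral_def
    by (rule Bochner_Integration.integral_cong) (use assms(2) in \<open>auto simp: indicator_def\<close>)
  then show ?thesis
    using set_borel_integral_eq_integral(2)[OF i] by simp
qed

lemma continuous_on_conv:
  fixes f :: "'a::euclidean_space \<Rightarrow> real"
  assumes "continuous_on UNIV f" "bounded K" "\<And>x. x \<notin> K \<Longrightarrow> f x = 0" "continuous_on UNIV \<kappa>"
  shows "continuous_on UNIV (conv f \<kappa>)"
proof -
  obtain a b where ab: "K \<subseteq> cbox a b"
    using bounded_subset_cbox_symmetric[OF assms(2)] by blast
  have "continuous_on UNIV (\<lambda>x. integral (cbox a b) (\<lambda>y. f y * \<kappa> (x - y)))"
    by (rule integral_continuous_on_param)
      (auto simp: split_beta intro!: continuous_intros continuous_on_compose2[OF assms(1)] continuous_on_compose2[OF assms(4)])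
  also have "(\<lambda>x. integral (cbox a b) (\<lambda>y. f y * \<kappa> (x - y))) = conv f \<kappa>"
    by (rule ext, rule conv_eq_integral[symmetric]) (use assms ab in auto)
  finally show ?thesis .
qed

text \<open>The Leibniz rule asks for a derivative that is continuous in operator norm; in finite
  dimension continuity of the partial derivatives provides it.\<close>

lemma conv_has_derivative:
  fixes f :: "'a::euclidean_space \<Rightarrow> real"
  assumes f: "continuous_on UNIV f" "bounded K" "\<And>x. x \<notin> K \<Longrightarrow> f x = 0"
    and d: "\<And>z. (\<kappa> has_derivative \<kappa>' z) (at z)"
    and c: "\<And>i. i \<in> Basis \<Longrightarrow> continuous_on UNIV (\<lambda>z. \<kappa>' z i)"
  shows "(conv f \<kappa> has_derivative (\<lambda>h. conv f (\<lambda>z. \<kappa>' z h) x)) (at x)"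
proof -
  obtain a b where ab: "K \<subseteq> cbox a b"
    using bounded_subset_cbox_symmetric[OF f(2)] by blast
  then have f0: "\<And>x. x \<notin> cbox a b \<Longrightarrow> f x = 0" using f(3) by blast
  define B where "B z = Blinfun (\<kappa>' z)" for z
  have B: "blinfun_apply (B z) = \<kappa>' z" for z
    unfolding B_def by (rule bounded_linear_Blinfun_apply) (rule has_derivative_bounded_linear[OF d])
  have cB: "continuous_on UNIV B"
    by (rule continuous_on_blinfun_componentwise) (use c B in auto)
  have ck: "continuous_on UNIV \<kappa>"
    by (metis d differentiable_def differentiable_imp_continuous_on differentiable_on_def)
  have c\<kappa>h: "continuous_on UNIV (\<lambda>z. \<kappa>' z h)" for h
    unfolding B[symmetric] by (intro continuous_intros cB)
  have "((\<lambda>x. integral (cbox a b) (\<lambda>y. f y * \<kappa> (x - y))) has_derivative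
      blinfun_apply (integral (cbox a b) (\<lambda>y. f y *\<^sub>R B (x - y)))) (at x within UNIV)"
  proof (rule leibniz_rule)
    fix x y :: 'a
    have "((\<lambda>x. x - y) has_derivative (\<lambda>h. h)) (at x)"
      by (auto intro!: derivative_eq_intros)
    from has_derivative_compose[OF this d]
    have "((\<lambda>x. \<kappa> (x - y)) has_derivative \<kappa>' (x - y)) (at x)" by simp
    then show "((\<lambda>x. f y * \<kappa> (x - y)) has_derivative blinfun_apply (f y *\<^sub>R B (x - y))) (at x within UNIV)"
      by (auto simp: B scaleR_blinfun.rep_eq intro!: derivative_eq_intros)
    show "(\<lambda>y. f y * \<kappa> (x - y)) integrable_on cbox a b"
      by (intro integrable_continuous continuous_intros continuous_on_subset[OF f(1)] continuous_on_compose2[OF ck]) auto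
  qed (auto simp: split_beta intro!: continuous_intros continuous_on_compose2[OF f(1)] continuous_on_compose2[OF cB])
  also have "(\<lambda>x. integral (cbox a b) (\<lambda>y. f y * \<kappa> (x - y))) = conv f \<kappa>"
    by (rule ext, rule conv_eq_integral[symmetric, OF f(1) f0 ck])
  also have "blinfun_apply (integral (cbox a b) (\<lambda>y. f y *\<^sub>R B (x - y))) = (\<lambda>h. conv f (\<lambda>z. \<kappa>' z h) x)"
  proof
    fix h
    have "(\<lambda>y. f y *\<^sub>R B (x - y)) integrable_on cbox a b"
      by (intro integrable_continuous continuous_intros continuous_on_subset[OF f(1)] continuous_on_compose2[OF cB]) auto
    then have "blinfun_apply (integral (cbox a b) (\<lambda>y. f y *\<^sub>R B (x - y))) h = integral (cbox a b) (\<lambda>y. f y * \<kappa>' (x - y) h)"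
      by (subst blinfun_apply_integral) (auto simp: scaleR_blinfun.rep_eq B)
    then show "blinfun_apply (integral (cbox a b) (\<lambda>y. f y *\<^sub>R B (x - y))) h = conv f (\<lambda>z. \<kappa>' z h) x"
      using conv_eq_integral[OF f(1) f0 c\<kappa>h] by simp
  qed
  finally show ?thesis .
qed

abbreviation pd :: "'a \<Rightarrow> ('a::euclidean_space \<Rightarrow> real) \<Rightarrow> 'a \<Rightarrow> real"
  where "pd i f \<equiv> (\<lambda>x. frechet_derivative f (at x) i)"

lemma laplacian_pd: "laplacian f x = (\<Sum>i\<in>Basis. pd i (pd i f) x)"
  by (simp add: laplacian_def)

lemma smooth_on_conv:
  fixes f :: "'a::euclidean_space \<Rightarrow> real"
  assumes f: "continuous_on UNIV f" "bounded K" "\<And>x. x \<notin> K \<Longrightarrow> f x = 0" and k: "smooth_on \<kappa> UNIV"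
  shows "smooth_on (conv f \<kappa>) UNIV"
proof -
  have "Ck_on k \<kappa> UNIV \<Longrightarrow> Ck_on k (conv f \<kappa>) UNIV" for k \<kappa>
  proof (induction k arbitrary: \<kappa>)
    case 0
    then show ?case using continuous_on_conv[OF f] by simp
  next
    case (Suc k)
    show ?case
    proof (rule Ck_on_SucI[OF conv_has_derivative[OF f Ck_on_SucD(1)[OF Suc.prems]]])
      fix i :: 'a assume "i \<in> Basis"
      then show "Ck_on k (conv f (pd i \<kappa>)) UNIV" by (intro Suc.IH Ck_on_SucD(2)[OF Suc.prems])
      have "Ck_on 0 (pd i \<kappa>) UNIV"
        using Ck_on_SucD(2)[OF Suc.prems \<open>i \<in> Basis\<close>] by (induction k) (auto dest: Ck_on_Suc_imp simp del: Ck_on.simps)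
      then show "continuous_on UNIV (pd i \<kappa>)" by simp
    qed
  qed
  then show ?thesis using k by (simp add: smooth_on_def)
qed

lemma pd_conv:
  fixes f :: "'a::euclidean_space \<Rightarrow> real"
  assumes f: "continuous_on UNIV f" "bounded K" "\<And>x. x \<notin> K \<Longrightarrow> f x = 0" and k: "smooth_on \<kappa> UNIV"
  shows "pd i (conv f \<kappa>) x = conv f (pd i \<kappa>) x"
  using has_derivative_imp_frechet[OF conv_has_derivative[OF f smooth_on_derivative(1)[OF k]
      smooth_on_continuous[OF smooth_on_derivative(2)[OF k]]]] by simp

lemma continuous_laplacian: "smooth_on f UNIV \<Longrightarrow> continuous_on UNIV (laplacian f)"
  unfolding laplacian_def
  by (intro continuous_on_sum smooth_on_continuous smooth_on_derivative)

lemma laplacian_conv: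
  fixes f :: "'a::euclidean_space \<Rightarrow> real"
  assumes f: "continuous_on UNIV f" "bounded K" "\<And>x. x \<notin> K \<Longrightarrow> f x = 0" and k: "smooth_on \<kappa> UNIV"
  shows "laplacian (conv f \<kappa>) x = conv f (laplacian \<kappa>) x"
proof -
  have "laplacian (conv f \<kappa>) x = (\<Sum>i\<in>Basis. conv f (pd i (pd i \<kappa>)) x)"
    unfolding laplacian_pd
    by (intro sum.cong refl) (simp add: pd_conv[OF f] smooth_on_derivative k)
  also have "\<dots> = conv f (laplacian \<kappa>) x"
    unfolding conv_def laplacian_pd sum_distrib_left
    by (subst Bochner_Integration.integral_sum)
      (auto intro!: integrable_conv[OF f] smooth_on_continuous smooth_on_derivative k)
  finally show ?thesis .
qed

lemma has_derivative_reflect: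
  assumes "\<And>z. (\<kappa> has_derivative \<kappa>' z) (at z)"
  shows "((\<lambda>y. \<kappa> (x - y)) has_derivative (\<lambda>h. \<kappa>' (x - y) (- h))) (at y)"
proof -
  have "((\<lambda>y. x - y) has_derivative (\<lambda>h. - h)) (at y)"
    by (auto intro!: derivative_eq_intros)
  from has_derivative_compose[OF this assms] show ?thesis by simp
qed

lemma frechet_derivative_reflect:
  assumes "\<And>z. (\<kappa> has_derivative \<kappa>' z) (at z)"
  shows "frechet_derivative (\<lambda>y. \<kappa> (x - y)) (at y) i = - \<kappa>' (x - y) i"
  using has_derivative_imp_frechet[OF has_derivative_reflect[OF assms]]
    linear_neg[OF has_derivative_linear[OF assms]] by simp

lemma smooth_on_reflect:
  assumes "smooth_on \<kappa> UNIV"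
  shows "smooth_on (\<lambda>y. \<kappa> (x - y)) UNIV"
proof -
  have "Ck_on k \<kappa> UNIV \<Longrightarrow> Ck_on k (\<lambda>y. \<kappa> (x - y)) UNIV" for k
  proof (induction k arbitrary: \<kappa>)
    case 0
    then show ?case by (auto intro!: continuous_intros continuous_on_compose2[of UNIV \<kappa>])
  next
    case (Suc k)
    show ?case
    proof (rule Ck_on_SucI[OF has_derivative_reflect[OF Ck_on_SucD(1)[OF Suc.prems]]])
      fix i :: 'a assume i: "i \<in> Basis"
      have "Ck_on k (\<lambda>y. (- 1) * pd i \<kappa> (x - y)) UNIV"
        by (intro Ck_on_mult Ck_on_const Suc.IH[of "pd i \<kappa>"] Ck_on_SucD(2)[OF Suc.prems] i)
      then show "Ck_on k (\<lambda>y. frechet_derivative \<kappa> (at (x - y)) (- i)) UNIV"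
        using linear_neg[OF has_derivative_linear[OF Ck_on_SucD(1)[OF Suc.prems]]] by simp
    qed
  qed
  then show ?thesis using assms by (simp add: smooth_on_def)
qed

lemma laplacian_reflect:
  assumes "smooth_on \<kappa> UNIV"
  shows "laplacian (\<lambda>y. \<kappa> (x - y)) y = laplacian \<kappa> (x - y)"
proof -
  have "pd i (pd i (\<lambda>y. \<kappa> (x - y))) y = pd i (pd i \<kappa>) (x - y)" if i: "i \<in> Basis" for i
  proof -
    have "pd i (\<lambda>y. \<kappa> (x - y)) = (\<lambda>y. - pd i \<kappa> (x - y))"
      by (intro ext frechet_derivative_reflect smooth_on_derivative(1)[OF assms])
    moreover have "((\<lambda>y. - pd i \<kappa> (x - y)) has_derivative (\<lambda>h. - frechet_derivative (pd i \<kappa>) (at (x - y)) (- h))) (at y)"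
      by (intro has_derivative_minus has_derivative_reflect smooth_on_derivative(1)[OF smooth_on_derivative(2)[OF assms i]])
    moreover have "frechet_derivative (pd i \<kappa>) (at (x - y)) (- i) = - pd i (pd i \<kappa>) (x - y)"
      by (rule linear_neg[OF has_derivative_linear[OF smooth_on_derivative(1)[OF smooth_on_derivative(2)[OF assms i]]]])
    ultimately show ?thesis
      by (simp add: has_derivative_imp_frechet)
  qed
  then show ?thesis unfolding laplacian_pd by simp
qed

lemma mollifier_exists:
  assumes "0 < e"
  obtains \<kappa> :: "'a::euclidean_space \<Rightarrow> real" where
    "smooth_on \<kappa> UNIV" "\<And>z. 0 \<le> \<kappa> z" "\<And>z. e \<le> norm z \<Longrightarrow> \<kappa> z = 0" "integrable lborel \<kappa>" "(LINT z|lborel. \<kappa> z) = 1"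
proof -
  define \<kappa>0 where "\<kappa>0 z = flat 0 (e\<^sup>2 + (- 1) * (z \<bullet> z))" for z :: 'a
  have s0: "smooth_on \<kappa>0 UNIV"
    unfolding \<kappa>0_def
  proof (rule smooth_on_compose[OF smooth_on_flat])
    show "smooth_on (\<lambda>z::'a. e\<^sup>2 + (- 1) * (z \<bullet> z)) UNIV"
      unfolding smooth_on_def
      by (intro allI Ck_on_add Ck_on_const Ck_on_mult) (rule smooth_on_inner_self[unfolded smooth_on_def, rule_format])
  qed
  have z0: "\<kappa>0 z = 0" if "e \<le> norm z" for z
    using power_mono[OF that, of 2] assms by (auto simp: \<kappa>0_def power2_norm_eq_inner intro!: flat_zero)
  have nn: "0 \<le> \<kappa>0 z" for z by (simp add: \<kappa>0_def flat_nonneg)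
  have i0: "integrable lborel \<kappa>0"
    by (rule integrable_bounded_support[OF smooth_on_continuous[OF s0] bounded_ball[of 0 e]]) (auto intro: z0)
  define I where "I = (LINT z|lborel. \<kappa>0 z)"
  have "\<kappa>0 0 > 0" using assms by (auto simp: \<kappa>0_def intro!: flat_pos)
  then have "I \<noteq> 0"
    using continuous_nonneg_integral_zero[OF smooth_on_continuous[OF s0] i0 nn, of 0] by (auto simp: I_def)
  moreover have "I \<ge> 0" unfolding I_def by (intro integral_nonneg_AE AE_I2 nn)
  ultimately have I: "I > 0" by simp
  show thesis
  proof (rule that[of "\<lambda>z. inverse I * \<kappa>0 z"])
    show "smooth_on (\<lambda>z. inverse I * \<kappa>0 z) UNIV"
      by (intro smooth_on_mult s0) (simp add: smooth_on_def Ck_on_const)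
  qed (use I nn z0 i0 in \<open>auto simp: I_def[symmetric]\<close>)
qed

text \<open>\<open>\<kappa>\<close> is a probability density carried by the ball of radius
  \<open>d\<close>, so the convolution at \<open>x\<close> averages the values of \<open>f\<close>
  within distance \<open>d\<close> of \<open>x\<close>.\<close>

lemma conv_close:
  fixes f :: "'a::euclidean_space \<Rightarrow> real"
  assumes f: "continuous_on UNIV f" "bounded K" "\<And>x. x \<notin> K \<Longrightarrow> f x = 0"
    and k: "continuous_on UNIV \<kappa>" "\<And>z. 0 \<le> \<kappa> z" "\<And>z. d \<le> norm z \<Longrightarrow> \<kappa> z = 0" "integrable lborel \<kappa>" "(LINT z|lborel. \<kappa> z) = 1"
    and e: "\<And>y. dist x y < d \<Longrightarrow> a \<le> f y \<and> f y \<le> b"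
  shows "a \<le> conv f \<kappa> x" "conv f \<kappa> x \<le> b"
proof -
  have i: "integrable lborel (\<lambda>y. f y * \<kappa> (x - y))" by (rule integrable_conv[OF f k(1)])
  have m: "\<kappa> \<in> borel_measurable borel" using k(1) by (rule borel_measurable_continuous_onI)
  have j: "integrable lborel (\<lambda>y. \<kappa> (x - y))" "(LINT y|lborel. \<kappa> (x - y)) = 1"
    using integral_reflect_lborel[OF m] k(4,5) by auto
  have *: "a * \<kappa> (x - y) \<le> f y * \<kappa> (x - y)" "f y * \<kappa> (x - y) \<le> b * \<kappa> (x - y)" for y
    using k(2)[of "x - y"] k(3)[of "x - y"] e[of y] by (cases "dist x y < d"; auto simp: dist_norm intro!: mult_right_mono)+
  have "(LINT y|lborel. a * \<kappa> (x - y)) \<le> conv f \<kappa> x" "conv f \<kappa> x \<le> (LINT y|lborel. b * \<kappa> (x - y))"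
    unfolding conv_def by (intro integral_mono i j * integrable_mult_right)+
  then show "a \<le> conv f \<kappa> x" "conv f \<kappa> x \<le> b" using j by auto
qed

subsection \<open>Functions in the domain of the Dirichlet Laplacian\<close>

lemma continuous_apply_c0: "continuous_on S (apply_c0 u)"
  by (rule continuous_on_subset[of UNIV]) auto

lemma C0_zero: "u \<in> C0 Q \<Longrightarrow> x \<notin> Q \<Longrightarrow> apply_c0 u x = 0"
  by (simp add: C0_def)

text \<open>The reflected and translated kernel is an admissible test function as long as its ball
  stays in \<open>Q\<close>; tested with it, the distributional equation becomes the pointwise
  equation of the mollification.\<close>

lemma laplacian_conv_dirichlet:
  fixes Q :: "'a::euclidean_space set"
  assumes uf: "(u, f) \<in> dirichlet_neg_laplacian Q" and Q: "bounded Q"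
    and k: "smooth_on \<kappa> UNIV" "\<And>z. e \<le> norm z \<Longrightarrow> \<kappa> z = 0" and x: "cball x e \<subseteq> Q"
  shows "laplacian (conv (apply_c0 u) \<kappa>) x = - conv (apply_c0 f) \<kappa> x"
proof -
  have u: "u \<in> C0 Q" and f: "f \<in> C0 Q"
    and eq: "\<And>\<phi>. test_function Q \<phi> \<Longrightarrow>
      (LINT x|lborel. apply_c0 u x * (- laplacian \<phi> x)) = (LINT x|lborel. apply_c0 f x * \<phi> x)"
    using uf by (auto simp: dirichlet_neg_laplacian_def)
  have "test_function Q (\<lambda>y. \<kappa> (x - y))"
    unfolding test_function_def
  proof (intro conjI smooth_on_reflect k(1) exI[of _ "cball x e"] x allI impI)
    fix y assume "y \<notin> cball x e"
    then show "\<kappa> (x - y) = 0" by (intro k) (auto simp: dist_norm)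
  qed simp
  note e = eq[OF this]
  have "laplacian (conv (apply_c0 u) \<kappa>) x = conv (apply_c0 u) (laplacian \<kappa>) x"
    by (rule laplacian_conv[OF continuous_apply_c0 Q C0_zero[OF u] k(1)])
  also have "\<dots> = - (LINT y|lborel. apply_c0 u y * (- laplacian (\<lambda>y. \<kappa> (x - y)) y))"
    by (simp add: laplacian_reflect[OF k(1)] conv_def)
  also have "\<dots> = - conv (apply_c0 f) \<kappa> x"
    by (simp only: e conv_def)
  finally show ?thesis .
qed

lemma second_derivative_test:
  fixes \<phi> :: "real \<Rightarrow> real"
  assumes d: "0 < d" and 1: "\<And>s. \<bar>s\<bar> < d \<Longrightarrow> (\<phi> has_real_derivative \<phi>1 s) (at s)"
    and 2: "(\<phi>1 has_real_derivative c) (at 0)" and m: "\<And>s. \<bar>s\<bar> < d \<Longrightarrow> \<phi> s \<le> \<phi> 0"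
  shows "c \<le> 0"
proof (rule ccontr)
  assume "\<not> c \<le> 0"
  then have c: "0 < c" by simp
  have "\<phi>1 0 = 0"
    by (rule DERIV_local_max[OF 1 d]) (use d m in auto)
  moreover obtain r where r: "r > 0" "\<And>h. 0 < h \<Longrightarrow> h < r \<Longrightarrow> \<phi>1 0 < \<phi>1 (0 + h)"
    using DERIV_pos_inc_right[OF 2 c] by blast
  ultimately have pos: "0 < \<phi>1 h" if "0 < h" "h < r" for h using that by auto
  define t where "t = min r d / 2"
  have t: "0 < t" "t < r" "t < d" using r d by (auto simp: t_def)
  then obtain z where z: "0 < z" "z < t" "\<phi> t - \<phi> 0 = (t - 0) * \<phi>1 z"
    using MVT2[of 0 t \<phi> \<phi>1] 1 by auto
  then have "\<phi> t > \<phi> 0" using pos[of z] t by (simp add: algebra_simps)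
  then show False using m[of t] t by auto
qed

lemma DERIV_line:
  fixes f :: "'a::euclidean_space \<Rightarrow> real"
  assumes "smooth_on f UNIV"
  shows "((\<lambda>s. f (x + s *\<^sub>R i)) has_real_derivative pd i f (x + s *\<^sub>R i)) (at s)"
proof -
  have "((\<lambda>s. f (x + s *\<^sub>R i)) has_derivative (\<lambda>h. frechet_derivative f (at (x + s *\<^sub>R i)) (h *\<^sub>R i))) (at s)"
  proof -
    have "((\<lambda>s. x + s *\<^sub>R i) has_derivative (\<lambda>h. h *\<^sub>R i)) (at s)"
      by (auto intro!: derivative_eq_intros)
    from has_derivative_compose[OF this smooth_on_derivative(1)[OF assms]] show ?thesis by simp
  qed
  then show ?thesis
    using linear_cmul[OF has_derivative_linear[OF smooth_on_derivative(1)[OF assms]]]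
    by (simp add: has_field_derivative_def mult_commute_abs)
qed

text \<open>
  Mollify \<open>u\<close> and apply the second derivative test; a small quadratic makes the maximum strict, so that
  it survives the mollification.
\<close>

lemma viscosity:
  fixes Q :: "'a::euclidean_space set"
  assumes uf: "(u, f) \<in> dirichlet_neg_laplacian Q" and Q: "open Q" "bounded Q"
    and V: "smooth_on V UNIV" and x0: "x0 \<in> Q"
    and max: "\<And>x. x \<in> Q \<Longrightarrow> apply_c0 u x - V x \<le> apply_c0 u x0 - V x0"
  shows "- apply_c0 f x0 \<le> laplacian V x0"
proof (rule ccontr)
  assume "\<not> - apply_c0 f x0 \<le> laplacian V x0"
  define \<delta> where "\<delta> = - apply_c0 f x0 - laplacian V x0"
  have \<delta>: "\<delta> > 0" using \<open>\<not> _\<close> by (simp add: \<delta>_def)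
  have u: "u \<in> C0 Q" and f: "f \<in> C0 Q"
    using uf by (auto simp: dirichlet_neg_laplacian_def)
  note cu = continuous_apply_c0[of UNIV u] Q(2) C0_zero[OF u]
  note cf = continuous_apply_c0[of UNIV f] Q(2) C0_zero[OF f]
  obtain r1 where r1: "0 < r1" "cball x0 r1 \<subseteq> Q"
    using Q(1) x0 open_contains_cball by blast
  obtain r2 where r2: "0 < r2" "\<And>y. dist y x0 < r2 \<Longrightarrow> dist (apply_c0 f y) (apply_c0 f x0) < \<delta> / 4"
    using continuous_apply_c0[of UNIV f] \<delta> unfolding continuous_on_iff
    by (metis UNIV_I divide_pos_pos zero_less_numeral)
  obtain r3 where r3: "0 < r3" "\<And>y. dist y x0 < r3 \<Longrightarrow> dist (laplacian V y) (laplacian V x0) < \<delta> / 4"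
    using continuous_laplacian[OF V] \<delta> unfolding continuous_on_iff
    by (metis UNIV_I divide_pos_pos zero_less_numeral)
  \<comment> \<open>Points within \<open>e \<le> r\<close> of the ball of radius \<open>r\<close>
    are within \<open>2 * r\<close> of \<open>x0\<close>, where all three conditions still
    hold.\<close>
  define r where "r = Min {r1, r2, r3} / 3"
  have r: "0 < r" "2 * r < r1" "2 * r < r2" "2 * r < r3" using r1 r2 r3 by (auto simp: r_def)
  \<comment> \<open>The added quadratic then has Laplacian \<delta>/4. The oscillations of
    \<open>f\<close> and of \<open>laplacian V\<close> cost \<delta>/4 each, and three quarters of
    \<delta> are still too little.\<close>
  define c where "c = \<delta> / (8 * DIM('a))"
  have c: "c > 0" using \<delta> by (simp add: c_def)
  obtain d where d: "0 < d" "\<And>x y. dist x y < d \<Longrightarrow> \<bar>apply_c0 u x - apply_c0 u y\<bar> < c * r\<^sup>2 / 4"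
    using uniformly_continuous_bounded_support[OF cu, of "c * r\<^sup>2 / 4"] c r by auto
  define e where "e = min r d"
  have e: "0 < e" "e \<le> r" "e \<le> d" using r d by (auto simp: e_def)
  obtain \<kappa> :: "'a \<Rightarrow> real" where k: "smooth_on \<kappa> UNIV" "\<And>z. 0 \<le> \<kappa> z" "\<And>z. e \<le> norm z \<Longrightarrow> \<kappa> z = 0"
    "integrable lborel \<kappa>" "(LINT z|lborel. \<kappa> z) = 1"
    using mollifier_exists[OF e(1)] by metis
  define U where "U = conv (apply_c0 u) \<kappa>"
  have sU: "smooth_on U UNIV" unfolding U_def by (rule smooth_on_conv[OF cu k(1)])
  have near: "apply_c0 u x - c * r\<^sup>2 / 4 \<le> apply_c0 u y \<and> apply_c0 u y \<le> apply_c0 u x + c * r\<^sup>2 / 4"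
    if "dist x y < e" for x y
    using d(2)[of x y] e that by linarith
  have U_close: "apply_c0 u x - c * r\<^sup>2 / 4 \<le> U x" "U x \<le> apply_c0 u x + c * r\<^sup>2 / 4" for x
    unfolding U_def
    by (rule conv_close[OF cu smooth_on_continuous[OF k(1)] k(2-5) near], assumption+)+
  define w where "w x = U x - V x - c * ((x - x0) \<bullet> (x - x0))" for x
  have cw: "continuous_on (cball x0 r) w"
    unfolding w_def by (intro continuous_intros continuous_on_subset[OF smooth_on_continuous[OF sU]]
        continuous_on_subset[OF smooth_on_continuous[OF V]]) auto
  obtain x1 where x1: "x1 \<in> cball x0 r" "\<And>x. x \<in> cball x0 r \<Longrightarrow> w x \<le> w x1"
    using continuous_attains_sup[OF compact_cball _ cw] r by auto
  \<comment> \<open>On the sphere the quadratic lowers \<open>w\<close> by c r^2, while the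
    mollification errors there and at the centre add up to half of that, so the maximum is
    interior.\<close>
  have "dist x0 x1 \<noteq> r"
  proof
    assume *: "dist x0 x1 = r"
    then have "(x1 - x0) \<bullet> (x1 - x0) = r\<^sup>2" by (simp add: dist_norm power2_norm_eq_inner[symmetric] norm_minus_commute)
    moreover have "x1 \<in> Q" using x1 r r1 by auto
    ultimately have "w x1 \<le> apply_c0 u x0 - V x0 - 3 / 4 * (c * r\<^sup>2)"
      using U_close(2)[of x1] max[of x1] by (simp add: w_def)
    moreover have "apply_c0 u x0 - V x0 - c * r\<^sup>2 / 4 \<le> w x0"
      using U_close(1)[of x0] by (simp add: w_def)
    moreover have "w x0 \<le> w x1" using x1(2)[of x0] r by simp
    moreover have "0 < c * r\<^sup>2" using c r by simp
    ultimately show False by linarith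
  qed
  then have x1r: "dist x0 x1 < r" using x1 by simp
  have D2: "pd i (pd i U) x1 - pd i (pd i V) x1 - 2 * c \<le> 0" if i: "i \<in> Basis" for i
  proof (rule second_derivative_test[where d = "r - dist x0 x1"])
    show "0 < r - dist x0 x1" using x1r by simp
    show "((\<lambda>s. w (x1 + s *\<^sub>R i)) has_real_derivative
        pd i U (x1 + s *\<^sub>R i) - pd i V (x1 + s *\<^sub>R i) - 2 * c * ((x1 + s *\<^sub>R i - x0) \<bullet> i)) (at s)" for s
      unfolding w_def
      using DERIV_line[OF sU, of x1 i s] DERIV_line[OF V, of x1 i s]
      by (auto intro!: derivative_eq_intros simp: inner_simps algebra_simps inner_commute)
    show "((\<lambda>s. pd i U (x1 + s *\<^sub>R i) - pd i V (x1 + s *\<^sub>R i) - 2 * c * ((x1 + s *\<^sub>R i - x0) \<bullet> i))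
        has_real_derivative pd i (pd i U) x1 - pd i (pd i V) x1 - 2 * c) (at 0)"
      using DERIV_line[OF smooth_on_derivative(2)[OF sU i], of x1 i 0]
        DERIV_line[OF smooth_on_derivative(2)[OF V i], of x1 i 0] i
      by (auto intro!: derivative_eq_intros simp: inner_simps)
    fix s assume s: "\<bar>s\<bar> < r - dist x0 x1"
    have "dist x0 (x1 + s *\<^sub>R i) \<le> dist x0 x1 + dist x1 (x1 + s *\<^sub>R i)" by (rule dist_triangle)
    also have "dist x1 (x1 + s *\<^sub>R i) = \<bar>s\<bar>" using i by (simp add: dist_norm)
    finally show "w (x1 + s *\<^sub>R i) \<le> w (x1 + 0 *\<^sub>R i)" using x1(2)[of "x1 + s *\<^sub>R i"] s by simp
  qed
  have "(\<Sum>i\<in>Basis. pd i (pd i U) x1 - pd i (pd i V) x1 - 2 * c) \<le> 0"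
    by (intro sum_nonpos D2)
  then have "laplacian U x1 - laplacian V x1 - 2 * c * DIM('a) \<le> 0"
    by (simp add: laplacian_pd sum_subtractf mult.commute)
  moreover have "2 * c * DIM('a) = \<delta> / 4" by (simp add: c_def)
  ultimately have "laplacian U x1 - laplacian V x1 - \<delta> / 4 \<le> 0" by (simp only:)
  moreover have "laplacian U x1 = - conv (apply_c0 f) \<kappa> x1"
    unfolding U_def
  proof (rule laplacian_conv_dirichlet[OF uf Q(2) k(1) k(3)])
    show "cball x1 e \<subseteq> Q"
    proof
      fix y assume "y \<in> cball x1 e"
      then have "dist x0 y \<le> r1" using dist_triangle[of x0 y x1] x1r e r by auto
      then show "y \<in> Q" using r1 by auto
    qed
  qed
  moreover have "conv (apply_c0 f) \<kappa> x1 \<le> apply_c0 f x0 + \<delta> / 4"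
  proof (rule conv_close(2)[OF cf smooth_on_continuous[OF k(1)] k(2-5)])
    fix y assume "dist x1 y < e"
    then have "dist y x0 < r2" using dist_triangle[of x0 y x1] x1r e r by (auto simp: dist_commute)
    from r2(2)[OF this] show "apply_c0 f x0 - \<delta> / 4 \<le> apply_c0 f y \<and> apply_c0 f y \<le> apply_c0 f x0 + \<delta> / 4"
      unfolding dist_real_def by linarith
  qed
  moreover have "laplacian V x1 \<le> laplacian V x0 + \<delta> / 4"
    using r3(2)[of x1] x1r r unfolding dist_real_def dist_commute[of x0 x1] by linarith
  ultimately show False using \<delta> \<delta>_def by linarith
qed

section \<open>Strongly continuous semigroups on a closed subspace\<close>

text \<open>The generator is defined by difference quotients; this is the bridge to the calculus of
  vector derivatives.\<close>

lemma has_vector_derivative_iff_quotient: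
  "(f has_vector_derivative D) (at t within S) \<longleftrightarrow> ((\<lambda>s. (f s - f t) /\<^sub>R (s - t)) \<longlongrightarrow> D) (at t within S)"
proof -
  have "((\<lambda>s. (f s - f t) /\<^sub>R (s - t)) \<longlongrightarrow> D) (at t within S) \<longleftrightarrow>
      ((\<lambda>s. norm ((f s - f t) /\<^sub>R (s - t) - D)) \<longlongrightarrow> 0) (at t within S)"
    by (simp add: LIM_zero_iff tendsto_norm_zero_iff)
  also have "\<dots> \<longleftrightarrow> ((\<lambda>s. norm ((f s - f t - (s - t) *\<^sub>R D) /\<^sub>R norm (s - t))) \<longlongrightarrow> 0) (at t within S)"
  proof (intro filterlim_cong refl)
    have "norm ((f s - f t) /\<^sub>R (s - t) - D) = norm ((f s - f t - (s - t) *\<^sub>R D) /\<^sub>R norm (s - t))" if "s \<noteq> t" for s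
    proof -
      have "(f s - f t) /\<^sub>R (s - t) - D = (f s - f t - (s - t) *\<^sub>R D) /\<^sub>R (s - t)"
        using that by (simp add: scaleR_diff_right)
      then show ?thesis by simp
    qed
    then show "\<forall>\<^sub>F s in at t within S. norm ((f s - f t) /\<^sub>R (s - t) - D) = norm ((f s - f t - (s - t) *\<^sub>R D) /\<^sub>R norm (s - t))"
      by (auto simp: eventually_at_filter)
  qed
  also have "\<dots> \<longleftrightarrow> (f has_vector_derivative D) (at t within S)"
    unfolding has_vector_derivative_def has_derivative_at_within tendsto_norm_zero_iff
    by (simp add: bounded_linear_scaleR_left)
  finally show ?thesis by simp
qed

text \<open>The laws of the semigroup are given on a subspace only; off it the operators are
  arbitrary functions and so not bounded linear maps on the type.\<close>

locale linear_on_subspace =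
  fixes X :: "'b::real_normed_vector set" and T :: "'b \<Rightarrow> 'c::real_normed_vector"
  assumes sub: "subspace X"
    and add: "u \<in> X \<Longrightarrow> v \<in> X \<Longrightarrow> T (u + v) = T u + T v"
    and scale: "u \<in> X \<Longrightarrow> T (a *\<^sub>R u) = a *\<^sub>R T u"
begin

lemma zero: "T 0 = 0"
  using scale[of 0 0] subspace_0[OF sub] by simp

lemma minus: "u \<in> X \<Longrightarrow> T (- u) = - T u"
  using scale[of u "-1"] by simp

lemma diff: "u \<in> X \<Longrightarrow> v \<in> X \<Longrightarrow> T (u - v) = T u - T v"
  using add[of u "- v"] minus[of v] subspace_neg[OF sub, of v] by simp

lemma sum: "(\<And>i. i \<in> I \<Longrightarrow> f i \<in> X) \<Longrightarrow> T (sum f I) = (\<Sum>i\<in>I. T (f i))"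
proof (induction I rule: infinite_finite_induct)
  case (insert i I)
  then show ?case using add[of "f i" "sum f I"] subspace_sum[OF sub, of I f] by simp
qed (simp_all add: zero)

end

text \<open>Gliding hump: the steps \<open>3\<^sup>-\<^sup>k\<close> are so small that later ones cannot undo the growth gained at step \<open>k\<close>.\<close>

lemma uniform_boundedness:
  fixes T :: "nat \<Rightarrow> 'b::banach \<Rightarrow> 'c::real_normed_vector"
  assumes X: "closed X" and lin: "\<And>n. linear_on_subspace X (T n)"
    and bdd: "\<And>n. \<exists>K. \<forall>u\<in>X. norm (T n u) \<le> K * norm u"
    and pw: "\<And>u. u \<in> X \<Longrightarrow> \<exists>B. \<forall>n. norm (T n u) \<le> B"
  shows "\<exists>C. \<forall>n. \<forall>u\<in>X. norm (T n u) \<le> C * norm u"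
proof (rule ccontr)
  assume neg: "\<not> ?thesis"
  have sub: "subspace X" using lin linear_on_subspace.sub by blast
  have "\<exists>n w K. w \<in> X \<and> norm w = 1 \<and> 4 ^ k \<le> norm (T n w) \<and> (\<forall>u\<in>X. norm (T n u) \<le> K * norm u) \<and> 3 / 4 * K \<le> norm (T n w)" for k :: nat
  proof -
    obtain n u where u: "u \<in> X" "4 ^ k * 2 * norm u < norm (T n u)"
      using neg by (metis not_le)
    interpret linear_on_subspace X "T n" by (rule lin)
    have "u \<noteq> 0" using u(2) zero by auto
    obtain K0 where K0: "\<And>u. u \<in> X \<Longrightarrow> norm (T n u) \<le> K0 * norm u" using bdd by blast
    define E where "E = {norm (T n w) | w. w \<in> X \<and> norm w = 1}"
    define K where "K = Sup E"
    have norm1: "norm (u /\<^sub>R norm u) = 1" "u /\<^sub>R norm u \<in> X" if "u \<noteq> 0" "u \<in> X" for u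
      using that by (auto intro: subspace_scale[OF sub])
    have bE: "bdd_above E" using K0 by (force simp: E_def bdd_above_def)
    have Ts: "norm (T n (u /\<^sub>R norm u)) = norm (T n u) / norm u" if "u \<in> X" for u
      using scale[OF that] by (simp add: divide_inverse mult.commute)
    have KE: "norm (T n u) / norm u \<le> K" if "u \<noteq> 0" "u \<in> X" for u
      unfolding K_def using norm1[OF that] Ts[OF that(2)]
      by (intro cSup_upper bE) (auto simp: E_def intro!: exI[of _ "u /\<^sub>R norm u"])
    have K: "norm (T n u) \<le> K * norm u" if "u \<in> X" for u
      using KE[OF _ that] zero by (cases "u = 0") (auto simp: field_simps)
    have "4 ^ k * 2 < norm (T n u) / norm u" using u(2) \<open>u \<noteq> 0\<close> by (simp add: field_simps)
    then have K4: "4 ^ k * 2 < K" using KE[OF \<open>u \<noteq> 0\<close> u(1)] by linarith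
    then have "K > 0" by (smt (verit) zero_less_power mult_pos_pos)
    then have "3 / 4 * K < K" by simp
    moreover have "E \<noteq> {}" using norm1[OF \<open>u \<noteq> 0\<close> u(1)] by (auto simp: E_def)
    ultimately obtain w where w: "w \<in> X" "norm w = 1" "3 / 4 * K < norm (T n w)"
      using less_cSup_iff[OF _ bE] unfolding K_def E_def by blast
    have "4 ^ k \<le> norm (T n w)" using w(3) K4 \<open>K > 0\<close> by linarith
    then show ?thesis using w K by (intro exI[of _ n] exI[of _ w] exI[of _ K]) auto
  qed
  then obtain N w K where w: "\<And>k. w k \<in> X" "\<And>k. norm (w k) = 1" "\<And>k. 4 ^ k \<le> norm (T (N k) (w k))"
    and K: "\<And>k u. u \<in> X \<Longrightarrow> norm (T (N k) u) \<le> K k * norm u" "\<And>k. 3 / 4 * K k \<le> norm (T (N k) (w k))"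
    by metis
  define q :: real where "q = 1 / 3"
  have "\<exists>x. \<forall>k. x k \<in> X \<and> (norm (x (Suc k) - x k) \<le> q ^ k \<and> q ^ k * norm (T (N k) (w k)) \<le> norm (T (N k) (x (Suc k))))"
  proof (rule dependent_nat_choice)
    show "\<exists>x. x \<in> X" using subspace_0[OF sub] by blast
    fix x k assume x: "x \<in> X"
    interpret linear_on_subspace X "T (N k)" by (rule lin)
    define h where "h = q ^ k *\<^sub>R w k"
    have h: "h \<in> X" "norm h = q ^ k" "norm (T (N k) h) = q ^ k * norm (T (N k) (w k))"
      using w scale[OF w(1)] by (auto simp: h_def q_def intro!: subspace_scale[OF sub])
    \<comment> \<open>Twice the image of \<open>h\<close> is the difference of the images of
      \<open>x + h\<close> and \<open>x - h\<close>, so one of these two is at least as large as the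
      image of \<open>h\<close>, whatever \<open>x\<close> is.\<close>
    have "2 * norm (T (N k) h) \<le> norm (T (N k) (x + h)) + norm (T (N k) (x - h))"
    proof -
      have "2 *\<^sub>R T (N k) h = T (N k) (x + h) - T (N k) (x - h)"
        using add[OF x h(1)] diff[OF x h(1)] by (simp add: scaleR_2)
      then show ?thesis
        by (metis norm_scaleR norm_triangle_ineq4 abs_numeral)
    qed
    then consider "norm (T (N k) h) \<le> norm (T (N k) (x + h))" | "norm (T (N k) h) \<le> norm (T (N k) (x - h))"
      by linarith
    then show "\<exists>y. y \<in> X \<and> norm (y - x) \<le> q ^ k \<and> q ^ k * norm (T (N k) (w k)) \<le> norm (T (N k) y)"
    proof cases
      case 1
      then show ?thesis using h x by (intro exI[of _ "x + h"]) (auto intro: subspace_add[OF sub])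
    next
      case 2
      then show ?thesis using h x by (intro exI[of _ "x - h"]) (auto intro: subspace_diff[OF sub])
    qed
  qed
  then obtain x where x: "\<And>k. x k \<in> X" "\<And>k. norm (x (Suc k) - x k) \<le> q ^ k"
    "\<And>k. q ^ k * norm (T (N k) (w k)) \<le> norm (T (N k) (x (Suc k)))" by blast
  have tail: "norm (x (n + m) - x n) \<le> 3 / 2 * (q ^ n - q ^ (n + m))" for n m
  proof (induction m)
    case (Suc m)
    have "norm (x (n + Suc m) - x n) \<le> norm (x (Suc (n + m)) - x (n + m)) + norm (x (n + m) - x n)"
      using norm_triangle_ineq[of "x (Suc (n + m)) - x (n + m)" "x (n + m) - x n"] by simp
    also have "\<dots> \<le> q ^ (n + m) + 3 / 2 * (q ^ n - q ^ (n + m))"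
      using x(2)[of "n + m"] Suc by linarith
    also have "\<dots> = 3 / 2 * (q ^ n - q ^ (n + Suc m))"
      by (simp add: q_def field_simps)
    finally show ?case .
  qed simp
  have tail': "norm (x m - x n) \<le> 3 / 2 * q ^ n" if "n \<le> m" for m n
  proof -
    have "0 \<le> q ^ m" by (simp add: q_def)
    then show ?thesis using tail[of n "m - n"] that by (simp add: algebra_simps)
  qed
  have q0: "(\<lambda>n. 3 / 2 * q ^ n) \<longlonglongrightarrow> 0"
    by (intro tendsto_mult_right_zero LIMSEQ_power_zero) (simp add: q_def)
  have "Cauchy x"
  proof (rule CauchyI')
    fix e :: real assume "0 < e"
    then obtain M where "\<And>n. n \<ge> M \<Longrightarrow> 3 / 2 * q ^ n < e"
      using order_tendstoD(2)[OF q0] by (auto simp: eventually_sequentially)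
    then show "\<exists>M. \<forall>m\<ge>M. \<forall>n>m. dist (x m) (x n) < e"
      using tail' by (intro exI[of _ M]) (metis dist_norm norm_minus_commute le_less_trans less_imp_le)
  qed
  then obtain y where y: "x \<longlonglongrightarrow> y" using Cauchy_convergent convergent_def by blast
  have yX: "y \<in> X" using closed_sequentially[OF X _ y] x(1) by blast
  obtain B where B: "\<And>n. norm (T n y) \<le> B" using pw[OF yX] by blast
  have "(4 / 3) ^ k / 3 \<le> B" for k
  proof -
    interpret linear_on_subspace X "T (N k)" by (rule lin)
    have "norm (y - x (Suc k)) \<le> 3 / 2 * q ^ Suc k"
    proof (rule tendsto_upperbound[of "\<lambda>m. norm (x m - x (Suc k))" _ sequentially])
      show "\<forall>\<^sub>F m in sequentially. norm (x m - x (Suc k)) \<le> 3 / 2 * q ^ Suc k"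
        by (rule eventually_sequentiallyI[of "Suc k"]) (rule tail')
    qed (auto intro!: tendsto_intros y)
    then have dy: "norm (y - x (Suc k)) \<le> q ^ k / 2" by (simp add: q_def)
    have K0: "0 \<le> K k" using K(1)[OF w(1), of k k] w(2)[of k] norm_ge_zero order_trans by (metis mult.right_neutral)
    have "norm (T (N k) (x (Suc k))) \<le> norm (T (N k) y) + norm (T (N k) (y - x (Suc k)))"
      using diff[OF yX x(1)] norm_triangle_ineq4[of "T (N k) y" "T (N k) y - T (N k) (x (Suc k))"] by simp
    also have "\<dots> \<le> B + K k * (q ^ k / 2)"
      using B K(1)[OF subspace_diff[OF sub yX x(1)], of k "Suc k"] mult_left_mono[OF dy K0] by (meson add_mono order_trans)
    finally have "q ^ k * norm (T (N k) (w k)) \<le> B + K k * (q ^ k / 2)" using x(3) order_trans by blast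
    \<comment> \<open>The distance to the limit is at most half of \<open>q ^ k\<close>, and
      \<open>K k\<close> is at most 4/3 of the norm attained at \<open>w k\<close>. So at most 2/3
      of the gain is lost again, and the remaining third is at least (4/3)^k / 3.\<close>
    moreover have "K k * (q ^ k / 2) \<le> q ^ k * norm (T (N k) (w k)) * (2 / 3)"
      using mult_right_mono[OF K(2)[of k], of "q ^ k"] by (simp add: q_def)
    ultimately have "q ^ k * norm (T (N k) (w k)) / 3 \<le> B" by linarith
    moreover have "(4 / 3) ^ k = q ^ k * 4 ^ k" by (simp add: q_def power_divide)
    moreover have "q ^ k * 4 ^ k \<le> q ^ k * norm (T (N k) (w k))"
      using w(3) by (intro mult_left_mono) (auto simp: q_def)
    ultimately show ?thesis by linarith
  qed
  moreover obtain k where "B * 3 < (4 / 3 :: real) ^ k"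
    using real_arch_pow[of "4/3"] by auto
  ultimately show False by (metis less_divide_eq not_le zero_less_numeral)
qed

text \<open>Since \<open>T\<close> is linear on \<open>X\<close> only, the exchange is made on
  Riemann sums, which stay in \<open>X\<close>. Intersecting two gauges makes one and the same sum
  approximate both integrals; closedness of \<open>X\<close> and the bound on \<open>T\<close> carry
  the identity to the limit.\<close>

lemma integral_linear_on_subspace:
  fixes f :: "real \<Rightarrow> 'b::banach" and T :: "'b \<Rightarrow> 'c::banach"
  assumes X: "closed X" and lin: "linear_on_subspace X T"
    and K: "\<And>u. u \<in> X \<Longrightarrow> norm (T u) \<le> K * norm u"
    and f: "continuous_on {a..b} f" "\<And>r. r \<in> {a..b} \<Longrightarrow> f r \<in> X" and Tf: "continuous_on {a..b} (\<lambda>r. T (f r))"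
  shows "integral {a..b} f \<in> X" "T (integral {a..b} f) = integral {a..b} (\<lambda>r. T (f r))"
proof -
  interpret linear_on_subspace X T by (rule lin)
  define I where "I = integral {a..b} f"
  define J where "J = integral {a..b} (\<lambda>r. T (f r))"
  have I: "(f has_integral I) {a..b}" unfolding I_def
    by (intro integrable_integral integrable_continuous_real f)
  have J: "((\<lambda>r. T (f r)) has_integral J) {a..b}" unfolding J_def
    by (intro integrable_integral integrable_continuous_real Tf)
  have appr: "\<exists>s\<in>X. norm (s - I) < e \<and> norm (T s - J) < e" if e: "e > 0" for e
  proof -
    obtain g1 where g1: "gauge g1" "\<And>p. p tagged_division_of {a..b} \<Longrightarrow> g1 fine p \<Longrightarrow>
        norm ((\<Sum>(x,k)\<in>p. measure lborel k *\<^sub>R f x) - I) < e"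
      using I e unfolding has_integral_real by metis
    obtain g2 where g2: "gauge g2" "\<And>p. p tagged_division_of {a..b} \<Longrightarrow> g2 fine p \<Longrightarrow>
        norm ((\<Sum>(x,k)\<in>p. measure lborel k *\<^sub>R T (f x)) - J) < e"
      using J e unfolding has_integral_real by metis
    obtain p where p: "p tagged_division_of {a..b}" "(\<lambda>x. g1 x \<inter> g2 x) fine p"
      using fine_division_exists_real[OF gauge_Int[OF g1(1) g2(1)]] by metis
    then have fine: "g1 fine p" "g2 fine p" by (auto simp: fine_Int)
    have tag: "x \<in> {a..b}" if "(x, k) \<in> p" for x k
      using tag_in_interval[OF p(1) that] .
    define s where "s = (\<Sum>(x,k)\<in>p. measure lborel k *\<^sub>R f x)"
    have mem: "(case z of (x, k) \<Rightarrow> measure lborel k *\<^sub>R f x) \<in> X" if "z \<in> p" for z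
      using that tag f(2) by (cases z) (auto intro!: subspace_scale[OF sub])
    have "s \<in> X" unfolding s_def by (intro subspace_sum[OF sub] mem)
    moreover have "T s = (\<Sum>(x,k)\<in>p. measure lborel k *\<^sub>R T (f x))"
      unfolding s_def by (subst sum[OF mem]) (auto intro!: sum.cong scale f(2) dest: tag)
    ultimately show ?thesis using g1(2)[OF p(1) fine(1)] g2(2)[OF p(1) fine(2)] by (auto simp: s_def[symmetric])
  qed
  have "I \<in> closure X"
    using appr unfolding closure_approachable dist_norm by blast
  then show IX: "integral {a..b} f \<in> X" using X by (simp add: I_def)
  have "norm (T I - J) \<le> 0"
  proof (rule field_le_epsilon)
    fix e :: real assume "e > 0"
    then obtain s where s: "s \<in> X" "norm (s - I) < e / (2 * (\<bar>K\<bar> + 1))" "norm (T s - J) < e / 2"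
      using appr[of "min (e / (2 * (\<bar>K\<bar> + 1))) (e / 2)"] by auto
    have "norm (T I - J) \<le> norm (T (s - I)) + norm (T s - J)"
      using diff[OF s(1) IX[folded I_def]] norm_triangle_ineq4[of "T s - J" "T s - T I"] by simp
    also have "norm (T (s - I)) \<le> (\<bar>K\<bar> + 1) * norm (s - I)"
      using K[OF subspace_diff[OF sub s(1) IX[folded I_def]]]
      by (rule order_trans) (intro mult_right_mono, auto)
    also have "\<dots> \<le> e / 2" using s(2) by (simp add: field_simps)
    finally show "norm (T I - J) \<le> 0 + e" using s(3) by simp
  qed
  then show "T (integral {a..b} f) = integral {a..b} (\<lambda>r. T (f r))" by (simp add: I_def J_def)
qed

section \<open>Local bounds, continuity and differentiability of orbits\<close>

locale semigroup_on =
  fixes X :: "'b::banach set" and S :: "real \<Rightarrow> 'b \<Rightarrow> 'b"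
  assumes closed_X: "closed X" and subspace_X: "subspace X" and C0: "C0_semigroup_on X S"
begin

lemma in_X: "0 \<le> t \<Longrightarrow> u \<in> X \<Longrightarrow> S t u \<in> X"
  using C0 by (simp add: C0_semigroup_on_def)

lemma linear_on: "0 \<le> t \<Longrightarrow> linear_on_subspace X (S t)"
  using C0 subspace_X by (simp add: C0_semigroup_on_def linear_on_subspace_def)

lemmas S_add = linear_on_subspace.add[OF linear_on]
  and S_scale = linear_on_subspace.scale[OF linear_on]
  and S_diff = linear_on_subspace.diff[OF linear_on]
  and S_minus = linear_on_subspace.minus[OF linear_on]
  and S_zero = linear_on_subspace.zero[OF linear_on]

lemma S_0: "u \<in> X \<Longrightarrow> S 0 u = u"
  using C0 by (simp add: C0_semigroup_on_def)

lemma S_plus: "0 \<le> s \<Longrightarrow> 0 \<le> t \<Longrightarrow> u \<in> X \<Longrightarrow> S (s + t) u = S s (S t u)"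
  using C0 by (simp add: C0_semigroup_on_def)

lemma right_continuous_0: "u \<in> X \<Longrightarrow> ((\<lambda>t. S t u) \<longlongrightarrow> u) (at_right 0)"
  using C0 by (simp add: C0_semigroup_on_def)

text \<open>If it failed, it would fail with constants \<open>Suc n\<close> at times tending to 0.
  Every orbit converges along these times and is thus bounded, so uniform boundedness yields one
  constant for all of them.\<close>

lemma bounded_near_0: "\<exists>d>0. \<exists>K\<ge>1. \<forall>t\<in>{0..d}. \<forall>u\<in>X. norm (S t u) \<le> K * norm u"
proof (rule ccontr)
  assume neg: "\<not> ?thesis"
  have "\<exists>t. 0 \<le> t \<and> t \<le> inverse (Suc n) \<and> (\<exists>u\<in>X. \<not> norm (S t u) \<le> real (Suc n) * norm u)" for n
  proof (rule ccontr)
    assume "\<not> ?thesis"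
    then have "\<exists>d>0. \<exists>K\<ge>1. \<forall>t\<in>{0..d}. \<forall>u\<in>X. norm (S t u) \<le> K * norm u"
      by (intro exI[of _ "inverse (real (Suc n))"] conjI exI[of _ "real (Suc n)"]) auto
    then show False using neg by blast
  qed
  then obtain t where t: "\<And>n. 0 \<le> t n" "\<And>n. t n \<le> inverse (Suc n)"
    "\<And>n. \<exists>u\<in>X. \<not> norm (S (t n) u) \<le> real (Suc n) * norm u" by metis
  have t0: "t \<longlonglongrightarrow> 0"
    by (rule tendsto_sandwich[OF _ _ tendsto_const LIMSEQ_inverse_real_of_nat]) (use t in \<open>auto simp del: of_nat_Suc\<close>)
  have "\<exists>C. \<forall>n. \<forall>u\<in>X. norm (S (t n) u) \<le> C * norm u"
  proof (rule uniform_boundedness[OF closed_X linear_on[OF t(1)]])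
    show "\<exists>K. \<forall>u\<in>X. norm (S (t n) u) \<le> K * norm u" for n
      using C0 t(1) by (simp add: C0_semigroup_on_def)
    fix u assume u: "u \<in> X"
    have "((\<lambda>t. S t u) \<longlongrightarrow> S 0 u) (at 0 within {0..})"
      using right_continuous_0[OF u] S_0[OF u] by (simp add: at_within_Ici_at_right)
    then have "continuous (at 0 within {0..}) (\<lambda>t. S t u)" by (simp add: continuous_within)
    then have "(\<lambda>n. S (t n) u) \<longlonglongrightarrow> S 0 u"
      using t0 t(1) continuous_within_sequentially[of 0 "{0..}" "\<lambda>t. S t u"] by (auto simp: o_def)
    then have "Bseq (\<lambda>n. S (t n) u)" by (intro convergent_imp_Bseq convergentI)
    then show "\<exists>B. \<forall>n. norm (S (t n) u) \<le> B" by (auto simp: Bseq_def)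
  qed
  then obtain C where C: "\<And>n u. u \<in> X \<Longrightarrow> norm (S (t n) u) \<le> C * norm u" by blast
  obtain n where "C \<le> real (Suc n)" using real_arch_simple[of C] by (metis le_Suc_eq of_nat_le_iff order_trans le_refl)
  then have "norm (S (t n) u) \<le> real (Suc n) * norm u" if "u \<in> X" for u
    using C[OF that, of n] by (meson mult_right_mono norm_ge_zero order_trans)
  then show False using t(3)[of n] by blast
qed

lemma locally_bounded: "\<exists>K\<ge>1. \<forall>t\<in>{0..a}. \<forall>u\<in>X. norm (S t u) \<le> K * norm u"
proof -
  obtain d K where d: "d > 0" and K: "K \<ge> 1" "\<And>t u. 0 \<le> t \<Longrightarrow> t \<le> d \<Longrightarrow> u \<in> X \<Longrightarrow> norm (S t u) \<le> K * norm u"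
    using bounded_near_0 by auto
  have *: "\<forall>t\<in>{0..real n * d}. \<forall>u\<in>X. norm (S t u) \<le> K ^ n * norm u" for n
  proof (induction n)
    case 0
    then show ?case by (auto simp: S_0)
  next
    case (Suc n)
    show ?case
    proof (intro ballI)
      fix t u assume t: "t \<in> {0..real (Suc n) * d}" and u: "u \<in> X"
      define r where "r = max 0 (t - d)"
      have r: "0 \<le> r" "r \<le> real n * d" "0 \<le> t - r" "t - r \<le> d"
        using t d by (auto simp: r_def algebra_simps)
      have "norm (S t u) = norm (S (t - r) (S r u))"
        using S_plus[OF r(3,1) u] by simp
      also have "\<dots> \<le> K * norm (S r u)" by (intro K(2) r in_X u)
      also have "\<dots> \<le> K * (K ^ n * norm u)" using Suc r u K(1) by (intro mult_left_mono) auto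
      finally show "norm (S t u) \<le> K ^ Suc n * norm u" by simp
    qed
  qed
  obtain n where "a \<le> real n * d" using d real_arch_simple[of "a / d"] by (auto simp: field_simps)
  then show ?thesis using *[of n] K(1) by (intro exI[of _ "K ^ n"]) (auto simp: one_le_power)
qed

text \<open>The difference factors through \<open>S\<close> at the smaller of the two times; in this
  way right continuity at 0 becomes continuity from both sides.\<close>

lemma diff_bound:
  obtains K where "K \<ge> 1" "\<And>t u. t \<in> {0..a} \<Longrightarrow> u \<in> X \<Longrightarrow> norm (S t u) \<le> K * norm u"
    "\<And>s t u. s \<in> {0..a} \<Longrightarrow> t \<in> {0..a} \<Longrightarrow> u \<in> X \<Longrightarrow> norm (S t u - S s u) \<le> K * norm (S \<bar>t - s\<bar> u - u)"
proof -
  obtain K where K: "K \<ge> 1" "\<And>t u. t \<in> {0..a} \<Longrightarrow> u \<in> X \<Longrightarrow> norm (S t u) \<le> K * norm u"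
    using locally_bounded by meson
  have 1: "norm (S t u - S s u) \<le> K * norm (S \<bar>t - s\<bar> u - u)" if "s \<in> {0..a}" "t \<in> {0..a}" "s \<le> t" "u \<in> X" for s t u
  proof -
    have "S t u - S s u = S s (S (t - s) u - u)"
      using that S_plus[of s "t - s" u] S_diff[of s "S (t - s) u" u] in_X[of "t - s" u] by simp
    then show ?thesis
      using that K(2)[of s "S (t - s) u - u"] subspace_diff[OF subspace_X in_X] by simp
  qed
  have "norm (S t u - S s u) \<le> K * norm (S \<bar>t - s\<bar> u - u)" if "s \<in> {0..a}" "t \<in> {0..a}" "u \<in> X" for s t u
    using 1[of s t u] 1[of t s u] that by (cases "s \<le> t") (auto simp: norm_minus_commute abs_minus_commute)
  then show thesis using that K by blast
qed

lemma continuous_at_0: "u \<in> X \<Longrightarrow> e > 0 \<Longrightarrow> \<exists>d>0. \<forall>t. 0 \<le> t \<longrightarrow> t < d \<longrightarrow> norm (S t u - u) < e"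
  using tendstoD[OF right_continuous_0, of u e] S_0[of u]
  unfolding eventually_at_right_field dist_norm by (metis diff_self norm_zero less_eq_real_def)

lemma continuous_on_orbit: "u \<in> X \<Longrightarrow> continuous_on {0..} (\<lambda>t. S t u)"
  unfolding continuous_on_iff
proof (intro ballI allI impI)
  fix t e :: real assume u: "u \<in> X" and t: "t \<in> {0..}" and e: "0 < e"
  obtain K where K: "K \<ge> 1" "\<And>s t' u. s \<in> {0..t+1} \<Longrightarrow> t' \<in> {0..t+1} \<Longrightarrow> u \<in> X \<Longrightarrow> norm (S t' u - S s u) \<le> K * norm (S \<bar>t' - s\<bar> u - u)"
    using diff_bound[of "t + 1"] by metis
  obtain d where d: "d > 0" "\<And>t. 0 \<le> t \<Longrightarrow> t < d \<Longrightarrow> norm (S t u - u) < e / K"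
    using continuous_at_0[OF u, of "e / K"] e K(1) by auto
  show "\<exists>d>0. \<forall>s\<in>{0..}. dist s t < d \<longrightarrow> dist (S s u) (S t u) < e"
  proof (intro exI[of _ "min d 1"] conjI ballI impI)
    fix s assume s: "s \<in> {0..}" "dist s t < min d 1"
    have "norm (S s u - S t u) \<le> K * norm (S \<bar>s - t\<bar> u - u)"
      using s t by (intro K(2) u) (auto simp: dist_real_def)
    also have "\<dots> < K * (e / K)" using d(2)[of "\<bar>s - t\<bar>"] s K(1) by (intro mult_strict_left_mono) (auto simp: dist_real_def)
    finally show "dist (S s u) (S t u) < e" using K(1) by (simp add: dist_norm)
  qed (use d in auto)
qed

lemma orbit_derivative:
  assumes "(u, f) \<in> generator_on X S" "0 \<le> t"
  shows "((\<lambda>t. S t u) has_vector_derivative S t f) (at t within {0..})"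
  unfolding has_vector_derivative_iff_quotient
proof (rule tendstoI)
  fix e :: real assume e: "0 < e"
  have u: "u \<in> X" and f: "f \<in> X" and gen: "((\<lambda>t. (S t u - u) /\<^sub>R t) \<longlongrightarrow> f) (at_right 0)"
    using assms(1) by (auto simp: generator_on_def)
  obtain K where K: "K \<ge> 1" "\<And>s u. s \<in> {0..t+1} \<Longrightarrow> u \<in> X \<Longrightarrow> norm (S s u) \<le> K * norm u"
    using locally_bounded by meson
  obtain d1 where d1: "d1 > 0" "\<And>h. 0 < h \<Longrightarrow> h < d1 \<Longrightarrow> norm ((S h u - u) /\<^sub>R h - f) < e / (2 * K)"
    using tendstoD[OF gen, of "e / (2 * K)"] e K(1) unfolding eventually_at_right_field dist_norm by auto
  obtain d2 where d2: "d2 > 0" "\<And>s. s \<in> {0..} \<Longrightarrow> dist s t < d2 \<Longrightarrow> dist (S s f) (S t f) < e / 2"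
    using continuous_on_orbit[OF f] assms(2) e unfolding continuous_on_iff by (metis half_gt_zero atLeast_iff)
  have "dist ((S s u - S t u) /\<^sub>R (s - t)) (S t f) < e" if s: "s \<in> {0..}" "s \<noteq> t" "dist s t < Min {d1, d2, 1}" for s
  proof -
    \<comment> \<open>Right and left quotients alike are \<open>S m\<close> applied to the quotient
      of \<open>u\<close> at 0. For left quotients \<open>m\<close> moves with \<open>s\<close>,
      which continuity of the orbit of \<open>f\<close> takes care of.\<close>
    define m h where "m = min s t" and "h = \<bar>s - t\<bar>"
    have mh: "0 \<le> m" "m \<le> t + 1" "0 < h" "h < d1" "dist m t < d2"
      using s assms(2) by (auto simp: m_def h_def dist_real_def)
    have D: "(S h u - u) /\<^sub>R h \<in> X" using mh u by (intro subspace_scale[OF subspace_X] subspace_diff[OF subspace_X] in_X) auto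
    have "(S s u - S t u) /\<^sub>R (s - t) = (S (m + h) u - S m u) /\<^sub>R h"
    proof (cases "t \<le> s")
      case True
      then show ?thesis by (simp add: m_def h_def)
    next
      case False
      then have "m = s" "h = t - s" by (auto simp: m_def h_def)
      moreover have "s - t = - (t - s)" by simp
      ultimately show ?thesis
        by (simp only: inverse_minus_eq scaleR_minus_left) (simp add: scaleR_diff_right)
    qed
    also have "\<dots> = S m ((S h u - u) /\<^sub>R h)"
      using mh u S_plus[of m h u] S_scale[of m "S h u - u"] S_diff[of m "S h u" u] in_X[of h u]
        subspace_diff[OF subspace_X, of "S h u" u] by simp
    finally have eq: "(S s u - S t u) /\<^sub>R (s - t) - S t f = S m ((S h u - u) /\<^sub>R h - f) + (S m f - S t f)"
      using S_diff[OF mh(1) D f] by simp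
    have "norm (S m ((S h u - u) /\<^sub>R h - f)) \<le> K * norm ((S h u - u) /\<^sub>R h - f)"
      using mh by (intro K(2) subspace_diff[OF subspace_X D f]) auto
    also have "\<dots> < K * (e / (2 * K))" using d1(2)[of h] mh K(1) by (intro mult_strict_left_mono) auto
    also have "\<dots> = e / 2" using K(1) by simp
    finally have "norm (S m ((S h u - u) /\<^sub>R h - f)) < e / 2" .
    moreover have "norm (S m f - S t f) < e / 2" using d2(2)[of m] mh by (simp add: dist_norm)
    ultimately show ?thesis unfolding dist_norm eq
      by (intro order_le_less_trans[OF norm_triangle_ineq]) simp
  qed
  then show "\<forall>\<^sub>F s in at t within {0..}. dist ((S s u - S t u) /\<^sub>R (s - t)) (S t f) < e"
    unfolding eventually_at using d1(1) d2(1) by (intro exI[of _ "Min {d1, d2, 1}"]) auto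
qed

lemma generator_invariant:
  assumes "(u, f) \<in> generator_on X S" "0 \<le> t"
  shows "(S t u, S t f) \<in> generator_on X S"
proof -
  have u: "u \<in> X" and f: "f \<in> X" using assms(1) by (auto simp: generator_on_def)
  have "((\<lambda>s. (S s u - S t u) /\<^sub>R (s - t)) \<longlongrightarrow> S t f) (at t within {0..})"
    using orbit_derivative[OF assms] unfolding has_vector_derivative_iff_quotient .
  then have "((\<lambda>s. (S s u - S t u) /\<^sub>R (s - t)) \<longlongrightarrow> S t f) (at_right t)"
    by (rule tendsto_within_subset) (use assms in auto)
  then have "((\<lambda>h. (S (h + t) u - S t u) /\<^sub>R h) \<longlongrightarrow> S t f) (at_right 0)"
    by (subst (asm) filterlim_at_right_to_0) simp
  then have "((\<lambda>h. (S h (S t u) - S t u) /\<^sub>R h) \<longlongrightarrow> S t f) (at_right 0)"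
    by (rule Lim_transform_eventually)
      (use assms(2) u in \<open>auto intro!: eventually_at_rightI[of 0 1] simp: S_plus\<close>)
  then show ?thesis
    using assms(2) u f by (auto simp: generator_on_def in_X)
qed

section \<open>Time averages and the density of the domain\<close>

definition time_average :: "real \<Rightarrow> 'b \<Rightarrow> 'b"
  where "time_average a u = integral {0..a} (\<lambda>r. S r u)"

lemma continuous_on_orbit': "u \<in> X \<Longrightarrow> 0 \<le> a \<Longrightarrow> continuous_on {a..b} (\<lambda>t. S t u)"
  by (rule continuous_on_subset[OF continuous_on_orbit]) auto

lemma time_average_in_X: "u \<in> X \<Longrightarrow> 0 \<le> a \<Longrightarrow> time_average a u \<in> X"
  unfolding time_average_def
  by (rule integral_linear_on_subspace(1)[OF closed_X linear_on[of 0], of 1])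
    (auto simp: S_0 in_X intro: continuous_on_orbit' continuous_on_eq[OF continuous_on_orbit'])

lemma time_average_derivative:
  assumes "u \<in> X" "0 \<le> t"
  shows "((\<lambda>a. time_average a u) has_vector_derivative S t u) (at_right t)"
proof -
  have "((\<lambda>a. integral {0..a} (\<lambda>r. S r u)) has_vector_derivative S t u) (at t within {0..t + 1})"
    using assms by (intro integral_has_vector_derivative continuous_on_orbit') auto
  then have "((\<lambda>a. integral {0..a} (\<lambda>r. S r u)) has_vector_derivative S t u) (at t within {t..t + 1})"
    by (rule has_vector_derivative_within_subset) (use assms in auto)
  then show ?thesis
    unfolding time_average_def
    by (simp add: has_vector_derivative_iff_quotient at_within_Icc_at_right)
qed

text \<open>\<open>S h\<close> shifts the window from [0, a] to [h, a + h], so only the two end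
  pieces of length \<open>h\<close> survive in the difference, and their quotients tend to
  \<open>S a u\<close> and \<open>u\<close>. It puts averages of arbitrary elements into the
  domain.\<close>

lemma time_average_generator:
  assumes u: "u \<in> X" and a: "0 \<le> a"
  shows "(time_average a u, S a u - u) \<in> generator_on X S"
proof -
  have eq: "S h (time_average a u) - time_average a u =
      (time_average (a + h) u - time_average a u) - (time_average h u - time_average 0 u)" if h: "0 < h" for h
  proof -
    obtain K where K: "\<And>u. u \<in> X \<Longrightarrow> norm (S h u) \<le> K * norm u"
      using locally_bounded[of h] h by (metis atLeastAtMost_iff less_imp_le order_refl)
    have Sh: "S h (S r u) = S (h + r) u" if "0 \<le> r" for r using S_plus[of h r u] h u that by simp
    have "continuous_on {0..a} (\<lambda>r. S (h + r) u)"
      by (rule continuous_on_compose2[OF continuous_on_orbit[OF u]]) (use h in \<open>auto intro!: continuous_intros\<close>)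
    then have c: "continuous_on {0..a} (\<lambda>r. S h (S r u))"
      by (rule continuous_on_eq) (simp add: Sh)
    have "S h (time_average a u) = integral {0..a} (\<lambda>r. S h (S r u))"
      unfolding time_average_def using h a u
      by (intro integral_linear_on_subspace(2)[OF closed_X linear_on K] c continuous_on_orbit' in_X) auto
    also have "\<dots> = integral {0..a} (\<lambda>r. S (r + h) u)"
      by (intro integral_cong) (simp add: Sh add.commute)
    also have "\<dots> = integral {h..a + h} (\<lambda>r. S r u)"
      using integral_shift_Icc_real[of 0 a "\<lambda>r. S r u" h] by (simp add: o_def add.commute)
    also have "\<dots> = time_average (a + h) u - time_average h u"
      unfolding time_average_def using h a u
      by (simp add: eq_diff_eq add.commute Henstock_Kurzweil_Integration.integral_combine integrable_continuous_real continuous_on_orbit')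
    finally show ?thesis by (simp add: time_average_def)
  qed
  have "((\<lambda>s. (time_average s u - time_average a u) /\<^sub>R (s - a)) \<longlongrightarrow> S a u) (at_right a)"
    "((\<lambda>s. (time_average s u - time_average 0 u) /\<^sub>R (s - 0)) \<longlongrightarrow> S 0 u) (at_right 0)"
    using time_average_derivative[OF u a] time_average_derivative[OF u, of 0]
    unfolding has_vector_derivative_iff_quotient by auto
  then have "((\<lambda>h. (time_average (h + a) u - time_average a u) /\<^sub>R h - (time_average h u - time_average 0 u) /\<^sub>R h) \<longlongrightarrow> S a u - u) (at_right 0)"
    by (subst (asm) filterlim_at_right_to_0) (auto intro!: tendsto_diff simp: S_0[OF u])
  then have "((\<lambda>h. (S h (time_average a u) - time_average a u) /\<^sub>R h) \<longlongrightarrow> S a u - u) (at_right 0)"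
  proof (rule Lim_transform_eventually)
    show "\<forall>\<^sub>F h in at_right 0. (time_average (h + a) u - time_average a u) /\<^sub>R h - (time_average h u - time_average 0 u) /\<^sub>R h
        = (S h (time_average a u) - time_average a u) /\<^sub>R h"
    proof (rule eventually_at_rightI[of 0 1])
      fix h :: real assume "h \<in> {0<..<1}"
      then show "(time_average (h + a) u - time_average a u) /\<^sub>R h - (time_average h u - time_average 0 u) /\<^sub>R h
        = (S h (time_average a u) - time_average a u) /\<^sub>R h"
        by (subst eq) (auto simp: scaleR_diff_right add.commute)
    qed simp
  qed
  then show ?thesis
    using u a by (auto simp: generator_on_def time_average_in_X intro!: subspace_diff[OF subspace_X] in_X)
qed

lemma time_average_tendsto:
  assumes u: "u \<in> X"
  shows "((\<lambda>a. time_average a u /\<^sub>R a) \<longlongrightarrow> u) (at_right 0)"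
  using time_average_derivative[OF u, of 0]
  unfolding has_vector_derivative_iff_quotient by (simp add: time_average_def S_0[OF u])

lemma generator_scale: "(u, f) \<in> generator_on X S \<Longrightarrow> (c *\<^sub>R u, c *\<^sub>R f) \<in> generator_on X S"
  unfolding generator_on_def
proof clarsimp
  assume u: "u \<in> X" "f \<in> X" and l: "((\<lambda>t. (S t u - u) /\<^sub>R t) \<longlongrightarrow> f) (at_right 0)"
  have "((\<lambda>t. c *\<^sub>R ((S t u - u) /\<^sub>R t)) \<longlongrightarrow> c *\<^sub>R f) (at_right 0)" by (intro tendsto_intros l)
  then have "((\<lambda>t. (S t (c *\<^sub>R u) - c *\<^sub>R u) /\<^sub>R t) \<longlongrightarrow> c *\<^sub>R f) (at_right 0)"
    by (rule Lim_transform_eventually)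
      (use u in \<open>auto intro!: eventually_at_rightI[of 0 1] simp: S_scale scaleR_diff_right mult.commute\<close>)
  then show "c *\<^sub>R u \<in> X \<and> c *\<^sub>R f \<in> X \<and> ((\<lambda>t. (S t (c *\<^sub>R u) - c *\<^sub>R u) /\<^sub>R t) \<longlongrightarrow> c *\<^sub>R f) (at_right 0)"
    using u by (auto intro: subspace_scale[OF subspace_X])
qed

lemma generator_in_X: "(u, f) \<in> generator_on X S \<Longrightarrow> u \<in> X \<and> f \<in> X"
  by (simp add: generator_on_def)

end

section \<open>Exponential rescaling of a semigroup\<close>

lemma semigroup_on_rescale:
  fixes S :: "real \<Rightarrow> 'b::banach \<Rightarrow> 'b" and c :: real
  assumes "semigroup_on X S"
  defines "T \<equiv> \<lambda>t u. exp (c * t) *\<^sub>R S t u"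
  shows "semigroup_on X T" "generator_on X T = {(u, f + c *\<^sub>R u) | u f. (u, f) \<in> generator_on X S}"
proof -
  interpret semigroup_on X S by fact
  have "C0_semigroup_on X T"
    unfolding C0_semigroup_on_def
  proof (intro conjI allI ballI impI)
    fix t :: real and u assume t: "0 \<le> t"
    show "\<exists>K. \<forall>u\<in>X. norm (T t u) \<le> K * norm u"
    proof -
      obtain K where "\<And>u. u \<in> X \<Longrightarrow> norm (S t u) \<le> K * norm u"
        using locally_bounded[of t] t by (metis atLeastAtMost_iff order_refl)
      then show ?thesis
        by (intro exI[of _ "exp (c * t) * K"]) (auto simp: T_def mult.assoc)
    qed
    show "u \<in> X \<Longrightarrow> v \<in> X \<Longrightarrow> T t (u + v) = T t u + T t v" for v
      using t by (simp add: T_def S_add scaleR_add_right)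
    show "u \<in> X \<Longrightarrow> T t (a *\<^sub>R u) = a *\<^sub>R T t u" for a
      using t by (simp add: T_def S_scale)
    show "u \<in> X \<Longrightarrow> T t u \<in> X"
      using t by (simp add: T_def in_X subspace_scale[OF subspace_X])
    show "u \<in> X \<Longrightarrow> 0 \<le> s \<Longrightarrow> T (s + t) u = T s (T t u)" for s
      using t by (simp add: T_def S_plus S_scale in_X distrib_left exp_add)
  next
    fix u assume u: "u \<in> X"
    show "T 0 u = u" by (simp add: T_def S_0[OF u])
    have "((\<lambda>t. exp (c * t) *\<^sub>R S t u) \<longlongrightarrow> exp (c * 0) *\<^sub>R u) (at_right 0)"
      by (intro tendsto_intros right_continuous_0[OF u])
    then show "((\<lambda>t. T t u) \<longlongrightarrow> u) (at_right 0)" by (simp add: T_def)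
  qed
  then show T: "semigroup_on X T"
    by (simp add: semigroup_on_def closed_X subspace_X)
  have ec: "((\<lambda>t. (exp (c * t) - 1) / t) \<longlongrightarrow> c) (at_right 0)" for c :: real
  proof -
    have "((\<lambda>t. exp (c * t)) has_real_derivative c) (at 0)"
      by (auto intro!: derivative_eq_intros)
    then have "((\<lambda>t. (exp (c * t) - 1) / t) \<longlongrightarrow> c) (at 0)" by (simp add: DERIV_def)
    then show ?thesis by (rule filterlim_mono) (auto simp: at_le)
  qed
  \<comment> \<open>Stated for every rate and every family, as it is used with c for
    \<open>S\<close> and, to undo the rescaling, with -c for \<open>T\<close>.\<close>
  have key: "((\<lambda>t. ((exp (c * t) *\<^sub>R S t u) - u) /\<^sub>R t) \<longlongrightarrow> f + c *\<^sub>R u) (at_right 0)"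
    if f: "((\<lambda>t. (S t u - u) /\<^sub>R t) \<longlongrightarrow> f) (at_right 0)" and u: "u \<in> X" for c u f and S :: "real \<Rightarrow> 'b \<Rightarrow> 'b"
  proof -
    have "((\<lambda>t. exp (c * t) *\<^sub>R ((S t u - u) /\<^sub>R t) + ((exp (c * t) - 1) / t) *\<^sub>R u) \<longlongrightarrow> exp (c * 0) *\<^sub>R f + c *\<^sub>R u) (at_right 0)"
      by (intro tendsto_intros f ec)
    then have "((\<lambda>t. exp (c * t) *\<^sub>R ((S t u - u) /\<^sub>R t) + ((exp (c * t) - 1) / t) *\<^sub>R u) \<longlongrightarrow> f + c *\<^sub>R u) (at_right 0)" by simp
    then show ?thesis
      by (rule Lim_transform_eventually)
        (auto intro!: eventually_at_rightI[of 0 1] simp: algebra_simps divide_inverse)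
  qed
  show "generator_on X T = {(u, f + c *\<^sub>R u) | u f. (u, f) \<in> generator_on X S}"
  proof (intro set_eqI iffI)
    fix p assume "p \<in> {(u, f + c *\<^sub>R u) | u f. (u, f) \<in> generator_on X S}"
    then show "p \<in> generator_on X T"
      unfolding generator_on_def T_def
      using key by (auto intro!: subspace_add[OF subspace_X] subspace_scale[OF subspace_X])
  next
    fix p assume "p \<in> generator_on X T"
    then obtain u f where p: "p = (u, f)" and u: "u \<in> X" "f \<in> X" and l: "((\<lambda>t. (T t u - u) /\<^sub>R t) \<longlongrightarrow> f) (at_right 0)"
      by (auto simp: generator_on_def)
    have "((\<lambda>t. ((exp ((- c) * t) *\<^sub>R T t u) - u) /\<^sub>R t) \<longlongrightarrow> f + (- c) *\<^sub>R u) (at_right 0)"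
      by (rule key[where S = T, OF l u(1)])
    then have "((\<lambda>t. (S t u - u) /\<^sub>R t) \<longlongrightarrow> f - c *\<^sub>R u) (at_right 0)"
      by (simp add: T_def mult_exp_exp)
    then have "(u, f - c *\<^sub>R u) \<in> generator_on X S"
      using u by (auto simp: generator_on_def intro!: subspace_diff[OF subspace_X] subspace_scale[OF subspace_X])
    then show "p \<in> {(u, f + c *\<^sub>R u) | u f. (u, f) \<in> generator_on X S}"
      unfolding p by (auto intro!: exI[of _ "f - c *\<^sub>R u"])
  qed
qed

section \<open>Comparison with classical supersolutions\<close>

lemma bounded_linear_apply_c0: "bounded_linear (\<lambda>u. apply_c0 u x)"
  by (rule bounded_linear_intro[where K = 1]) (use norm_c0_bounded in auto)

lemma subspace_C0: "subspace (C0 Q)"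
  by (auto simp: subspace_def C0_def)

lemma closed_C0: "closed (C0 Q)"
proof -
  have "C0 Q = (\<Inter>x\<in>- Q. {u. apply_c0 u x = 0})"
    by (auto simp: C0_def)
  then show ?thesis
    by (auto intro!: closed_INT closed_Collect_eq linear_continuous_on bounded_linear_apply_c0 continuous_on_const)
qed

lemma smooth_on_const: "smooth_on (\<lambda>_. c) UNIV"
  by (simp add: smooth_on_def Ck_on_const)

lemma smooth_on_add: "smooth_on f UNIV \<Longrightarrow> smooth_on g UNIV \<Longrightarrow> smooth_on (\<lambda>x. f x + g x) UNIV"
  unfolding smooth_on_def by (auto intro: Ck_on_add)

lemma pd_const_add_scale:
  assumes "smooth_on f UNIV"
  shows "pd i (\<lambda>x. c + a * f x) x = a * pd i f x"
proof -
  have "((\<lambda>x. c + a * f x) has_derivative (\<lambda>h. a * frechet_derivative f (at x) h)) (at x)"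
    by (auto intro!: derivative_eq_intros smooth_on_derivative(1)[OF assms])
  then show ?thesis by (simp add: has_derivative_imp_frechet)
qed

lemma laplacian_const_add_scale:
  assumes f: "smooth_on f UNIV"
  shows "laplacian (\<lambda>x. c + a * f x) x = a * laplacian f x"
  unfolding laplacian_pd pd_const_add_scale[OF f] sum_distrib_left
proof (intro sum.cong refl)
  fix i :: 'a assume "i \<in> Basis"
  from pd_const_add_scale[where i = i and c = 0 and a = a and x = x, OF smooth_on_derivative(2)[OF f this]]
  show "pd i (\<lambda>x. a * pd i f x) x = a * pd i (pd i f) x" by simp
qed

text \<open>The analysis is carried out for the heat semigroup, without the shift by \<beta>,
  because nonnegative constants are supersolutions of its equation.\<close>

locale dirichlet_semigroup = semigroup_on "C0 Q" T
  for Q :: "'a::euclidean_space set" and T :: "real \<Rightarrow> 'a c0 \<Rightarrow> 'a c0" +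
  assumes open_Q: "open Q" and bounded_Q: "bounded Q"
    and generator: "generator_on (C0 Q) T = {(u, - f) | u f. (u, f) \<in> dirichlet_neg_laplacian Q}"
begin

lemma generatorD: "(u, f) \<in> generator_on (C0 Q) T \<Longrightarrow> (u, - f) \<in> dirichlet_neg_laplacian Q"
  unfolding generator by force

text \<open>Parabolic maximum principle. At a positive maximum of \<open>w\<close> over the closed
  cylinder, maximality in space gives the viscosity inequality, so the difference of orbit and
  barrier does not grow there. The factor exp(-t) then makes the time derivative of \<open>w\<close>
  strictly negative, and \<open>w\<close> would be larger slightly earlier.\<close>

lemma comparison_generator:
  fixes V V' :: "real \<Rightarrow> 'a \<Rightarrow> real"
  assumes f: "(f, Bf) \<in> generator_on (C0 Q) T"
    and smooth: "\<And>t. t \<in> {0..\<tau>} \<Longrightarrow> smooth_on (V t) UNIV"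
    and cont: "continuous_on ({0..\<tau>} \<times> UNIV) (\<lambda>(t, x). V t x)"
    and deriv: "\<And>t x. t \<in> {0..\<tau>} \<Longrightarrow> ((\<lambda>s. V s x) has_real_derivative V' t x) (at t)"
    and super: "\<And>t x. t \<in> {0..\<tau>} \<Longrightarrow> laplacian (V t) x \<le> V' t x"
    and bdry: "\<And>t x. t \<in> {0..\<tau>} \<Longrightarrow> x \<notin> Q \<Longrightarrow> 0 \<le> V t x"
    and init: "\<And>x. apply_c0 f x \<le> V 0 x" and t: "t \<in> {0..\<tau>}"
  shows "apply_c0 (T t f) x \<le> V t x"
proof (rule ccontr)
  assume neg: "\<not> ?thesis"
  have fC0: "f \<in> C0 Q" using f generator_in_X by blast
  have xQ: "x \<in> Q"
    using neg bdry[OF t] C0_zero[OF in_X[OF _ fC0], of t x] t by force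
  define K where "K = {0..\<tau>} \<times> closure Q"
  have K: "compact K" unfolding K_def using bounded_Q by (intro compact_Times) auto
  define w where "w = (\<lambda>(t, x). exp (- t) * (apply_c0 (T t f) x - V t x))"
  have cT: "continuous_on ({0..\<tau>} \<times> UNIV) (\<lambda>(t, x). apply_c0 (T t f) x)"
    unfolding continuous_on_iff
  proof (intro ballI allI impI)
    fix p :: "real \<times> 'a" and e :: real assume p: "p \<in> {0..\<tau>} \<times> UNIV" and e: "0 < e"
    obtain s y where p': "p = (s, y)" by (cases p)
    then have s: "s \<in> {0..\<tau>}" using p by auto
    obtain d1 where d1: "d1 > 0" "\<And>r. r \<in> {0..} \<Longrightarrow> dist r s < d1 \<Longrightarrow> dist (T r f) (T s f) < e / 2"
      using continuous_on_orbit[OF fC0] s e unfolding continuous_on_iff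
      by (metis atLeastAtMost_iff atLeast_iff half_gt_zero)
    obtain d2 where d2: "d2 > 0" "\<And>z. dist z y < d2 \<Longrightarrow> dist (apply_c0 (T s f) z) (apply_c0 (T s f) y) < e / 2"
      using continuous_apply_c0[of UNIV "T s f"] e unfolding continuous_on_iff by (metis UNIV_I half_gt_zero)
    show "\<exists>d>0. \<forall>q\<in>{0..\<tau>} \<times> UNIV. dist q p < d \<longrightarrow>
        dist (case q of (t, x) \<Rightarrow> apply_c0 (T t f) x) (case p of (t, x) \<Rightarrow> apply_c0 (T t f) x) < e"
    proof (intro exI[of _ "min d1 d2"] conjI ballI impI)
      fix q :: "real \<times> 'a" assume q: "q \<in> {0..\<tau>} \<times> UNIV" "dist q p < min d1 d2"
      obtain r z where q': "q = (r, z)" by (cases q)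
      have "dist r s < d1" "dist z y < d2" "r \<in> {0..}"
        using q dist_fst_le[of q p] dist_snd_le[of q p] by (auto simp: q' p')
      then have "dist (T r f) (T s f) < e / 2" "dist (apply_c0 (T s f) z) (apply_c0 (T s f) y) < e / 2"
        using d1(2) d2(2) by auto
      moreover have "\<bar>apply_c0 (T r f) z - apply_c0 (T s f) z\<bar> \<le> dist (T r f) (T s f)"
        using norm_c0_bounded[of "T r f - T s f" z] by (simp add: dist_norm)
      ultimately show "dist (case q of (t, x) \<Rightarrow> apply_c0 (T t f) x) (case p of (t, x) \<Rightarrow> apply_c0 (T t f) x) < e"
        unfolding q' p' dist_real_def prod.case by linarith
    qed (use d1 d2 in auto)
  qed
  have "continuous_on K w"
    unfolding w_def case_prod_beta
    by (intro continuous_intros continuous_on_subset[OF cT[unfolded case_prod_beta]]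
        continuous_on_subset[OF cont[unfolded case_prod_beta]]) (auto simp: K_def)
  moreover have txK: "(t, x) \<in> K" using t xQ closure_subset by (auto simp: K_def)
  ultimately obtain p where p: "p \<in> K" "\<And>q. q \<in> K \<Longrightarrow> w q \<le> w p"
    using continuous_attains_sup[OF K, of w] by blast
  obtain t0 x0 where p0: "p = (t0, x0)" by (cases p)
  have t0: "t0 \<in> {0..\<tau>}" using p(1) by (auto simp: p0 K_def)
  have "0 < w (t, x)" using neg by (auto simp: w_def)
  also have "w (t, x) \<le> w p" by (rule p(2)[OF txK])
  finally have pos: "V t0 x0 < apply_c0 (T t0 f) x0"
    by (simp add: p0 w_def zero_less_mult_iff)
  have x0: "x0 \<in> Q"
    using pos bdry[OF t0] C0_zero[OF in_X[OF _ fC0], of t0 x0] t0 by force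
  have "t0 \<noteq> 0" using pos init[of x0] S_0[OF fC0] by auto
  then have t0': "0 < t0" using t0 by auto
  have "apply_c0 (T t0 Bf) x0 \<le> laplacian (V t0) x0"
  proof -
    have "(T t0 f, - T t0 Bf) \<in> dirichlet_neg_laplacian Q"
      using generator_invariant[OF f, of t0] t0 by (intro generatorD) auto
    then have "- apply_c0 (- T t0 Bf) x0 \<le> laplacian (V t0) x0"
    proof (rule viscosity[OF _ open_Q bounded_Q smooth[OF t0] x0])
      fix y assume "y \<in> Q"
      then have "(t0, y) \<in> K" using t0 closure_subset by (auto simp: K_def)
      from p(2)[OF this] show "apply_c0 (T t0 f) y - V t0 y \<le> apply_c0 (T t0 f) x0 - V t0 x0"
        by (simp add: w_def p0)
    qed
    then show ?thesis by simp
  qed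
  then have B: "apply_c0 (T t0 Bf) x0 \<le> V' t0 x0" using super[OF t0, of x0] by linarith
  define D where "D = exp (- t0) * (apply_c0 (T t0 Bf) x0 - V' t0 x0) - exp (- t0) * (apply_c0 (T t0 f) x0 - V t0 x0)"
  have "((\<lambda>t. apply_c0 (T t f) x0) has_real_derivative apply_c0 (T t0 Bf) x0) (at t0 within {0..})"
    unfolding has_real_derivative_iff_has_vector_derivative
    by (rule bounded_linear.has_vector_derivative[OF bounded_linear_apply_c0 orbit_derivative[OF f]]) (use t0 in auto)
  moreover have "((\<lambda>t. V t x0) has_real_derivative V' t0 x0) (at t0 within {0..})"
    using deriv[OF t0] by (rule has_field_derivative_at_within)
  ultimately have "((\<lambda>t. w (t, x0)) has_real_derivative D) (at t0 within {0..})"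
    unfolding w_def prod.case D_def by (auto intro!: derivative_eq_intros)
  moreover have "D < 0"
  proof -
    have "0 < exp (- t0) * (apply_c0 (T t0 f) x0 - V t0 x0)" using pos by simp
    moreover have "exp (- t0) * (apply_c0 (T t0 Bf) x0 - V' t0 x0) \<le> 0" using B by (simp add: mult_le_0_iff)
    ultimately show ?thesis unfolding D_def by linarith
  qed
  ultimately obtain d where d: "d > 0" "\<And>h. 0 < h \<Longrightarrow> t0 - h \<in> {0..} \<Longrightarrow> h < d \<Longrightarrow> w (t0, x0) < w (t0 - h, x0)"
    using has_real_derivative_neg_dec_left by metis
  define h where "h = min t0 (d / 2)"
  have "w (t0, x0) < w (t0 - h, x0)" using d(1) t0' by (intro d(2)) (auto simp: h_def)
  moreover have "w (t0 - h, x0) \<le> w (t0, x0)"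
    using p(2)[of "(t0 - h, x0)"] t0 t0' d(1) p(1) by (auto simp: p0 K_def h_def)
  ultimately show False by simp
qed

lemma generator_dense:
  assumes "u \<in> C0 Q" "0 < e"
  obtains v Bv where "(v, Bv) \<in> generator_on (C0 Q) T" "norm (v - u) < e"
proof -
  obtain a where a: "a > 0" "dist (time_average a u /\<^sub>R a) u < e"
    using tendstoD[OF time_average_tendsto[OF assms(1)] assms(2)] unfolding eventually_at_right_field
    by (metis dense)
  show thesis
    using that[OF generator_scale[OF time_average_generator[OF assms(1) less_imp_le[OF a(1)]]]] a(2) by (simp add: dist_norm)
qed

lemma continuous_S: "0 \<le> t \<Longrightarrow> \<exists>K>0. \<forall>u\<in>C0 Q. norm (T t u) \<le> K * norm u"
  using locally_bounded[of t] by (metis atLeastAtMost_iff order_refl less_le_trans zero_less_one)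

text \<open>An approximation of \<open>f\<close> from the domain may exceed \<open>V\<close>
  initially, but by less than a small constant; raising \<open>V\<close> by that constant leaves it
  a supersolution.\<close>

lemma comparison:
  fixes V V' :: "real \<Rightarrow> 'a \<Rightarrow> real"
  assumes f: "f \<in> C0 Q"
    and smooth: "\<And>t. t \<in> {0..\<tau>} \<Longrightarrow> smooth_on (V t) UNIV"
    and cont: "continuous_on ({0..\<tau>} \<times> UNIV) (\<lambda>(t, x). V t x)"
    and deriv: "\<And>t x. t \<in> {0..\<tau>} \<Longrightarrow> ((\<lambda>s. V s x) has_real_derivative V' t x) (at t)"
    and super: "\<And>t x. t \<in> {0..\<tau>} \<Longrightarrow> laplacian (V t) x \<le> V' t x"
    and bdry: "\<And>t x. t \<in> {0..\<tau>} \<Longrightarrow> x \<notin> Q \<Longrightarrow> 0 \<le> V t x"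
    and init: "\<And>x. apply_c0 f x \<le> V 0 x" and t: "t \<in> {0..\<tau>}"
  shows "apply_c0 (T t f) x \<le> V t x"
proof (rule field_le_epsilon)
  fix e :: real assume e: "0 < e"
  obtain K where K: "K > 0" "\<And>u. u \<in> C0 Q \<Longrightarrow> norm (T t u) \<le> K * norm u"
    using continuous_S[of t] t by auto
  \<comment> \<open>One \<epsilon> pays for the raised barrier and \<open>K * \<epsilon>\<close> for
    the approximation of \<open>f\<close>.\<close>
  define \<epsilon> where "\<epsilon> = e / (K + 1)"
  have \<epsilon>: "\<epsilon> > 0" "\<epsilon> + K * \<epsilon> = e" using e K(1) by (auto simp: \<epsilon>_def field_simps add_divide_distrib[symmetric])
  obtain v Bv where v: "(v, Bv) \<in> generator_on (C0 Q) T" "norm (v - f) < \<epsilon>"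
    using generator_dense[OF f \<epsilon>(1)] by metis
  have vC0: "v \<in> C0 Q" using v(1) generator_in_X by blast
  have "apply_c0 (T t v) x \<le> \<epsilon> + 1 * V t x"
  proof (rule comparison_generator[OF v(1), where V = "\<lambda>t x. \<epsilon> + 1 * V t x" and V' = V' and \<tau> = \<tau>])
    fix s y assume s: "s \<in> {0..\<tau>}"
    show "smooth_on (\<lambda>x. \<epsilon> + 1 * V s x) UNIV"
      by (intro smooth_on_add smooth_on_mult smooth_on_const smooth[OF s])
    show "laplacian (\<lambda>x. \<epsilon> + 1 * V s x) y \<le> V' s y"
      unfolding laplacian_const_add_scale[OF smooth[OF s]] using super[OF s] by simp
    show "((\<lambda>s. \<epsilon> + 1 * V s y) has_real_derivative V' s y) (at s)"
      using deriv[OF s] by (auto intro!: derivative_eq_intros)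
    show "y \<notin> Q \<Longrightarrow> 0 \<le> \<epsilon> + 1 * V s y" using bdry[OF s, of y] \<epsilon> by simp
  next
    show "continuous_on ({0..\<tau>} \<times> UNIV) (\<lambda>(t, x). \<epsilon> + 1 * V t x)"
      using cont unfolding case_prod_beta by (intro continuous_intros)
    show "apply_c0 v y \<le> \<epsilon> + 1 * V 0 y" for y
      using norm_c0_bounded[of "v - f" y] v(2) init[of y] by (simp add: abs_le_iff)
  qed (rule t)
  moreover have "apply_c0 (T t f) x - apply_c0 (T t v) x \<le> K * \<epsilon>"
  proof -
    have "apply_c0 (T t f) x - apply_c0 (T t v) x \<le> norm (T t (f - v))"
      using norm_c0_bounded[of "T t f - T t v" x] S_diff[of t f v] t f vC0 by (simp add: abs_le_iff)
    also have "\<dots> \<le> K * norm (f - v)" by (intro K subspace_diff subspace_C0 f vC0)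
    also have "\<dots> \<le> K * \<epsilon>" using v(2) K(1) by (simp add: norm_minus_commute)
    finally show ?thesis .
  qed
  ultimately show "apply_c0 (T t f) x \<le> V t x + e" using \<epsilon>(2) by linarith
qed

lemma comparison_const:
  assumes f: "f \<in> C0 Q" and c: "0 \<le> c" "\<And>x. apply_c0 f x \<le> c" and t: "0 \<le> t"
  shows "apply_c0 (T t f) x \<le> c"
proof (rule comparison[OF f, where V = "\<lambda>_ _. c" and V' = "\<lambda>_ _. 0" and \<tau> = t])
  fix y
  show "laplacian (\<lambda>_. c) y \<le> 0"
    using laplacian_const_add_scale[OF smooth_on_const, of c 0 0 y] by simp
qed (use c t in \<open>auto intro: smooth_on_const simp: case_prod_beta\<close>)

lemma contraction:
  assumes f: "f \<in> C0 Q" and t: "0 \<le> t"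
  shows "norm (T t f) \<le> norm f"
proof (rule norm_c0_bound)
  fix x
  have "apply_c0 (T t f) x \<le> norm f"
    by (rule comparison_const[OF f _ _ t]) (use norm_c0_bounded abs_le_D1 in auto)
  moreover have "apply_c0 (T t (- f)) x \<le> norm f"
    by (rule comparison_const[OF subspace_neg[OF subspace_C0 f] _ _ t])
      (use norm_c0_bounded[of "- f"] in \<open>auto simp: abs_le_iff\<close>)
  ultimately show "\<bar>apply_c0 (T t f) x\<bar> \<le> norm f"
    using S_minus[OF t f] by (simp add: abs_le_iff)
qed

lemma positivity:
  assumes f: "f \<in> C0 Q" and t: "0 \<le> t" and nn: "\<And>x. 0 \<le> apply_c0 f x"
  shows "0 \<le> apply_c0 (T t f) x"
  using comparison_const[OF subspace_neg[OF subspace_C0 f], of 0 t x] nn t S_minus[OF t f] by simp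

end

subsection \<open>The Gaussian supersolution\<close>

text \<open>The heat kernel at time \<open>t\<close>, up to the factor \<open>(4 \<pi>)\<^bsup>-n/2\<^esup>\<close>.\<close>

definition gauss :: "real \<Rightarrow> 'a::euclidean_space \<Rightarrow> real"
  where "gauss t z = t powr (- (DIM('a) / 2)) * exp (- (z \<bullet> z) / (4 * t))"

lemma gauss_pos: "0 < t \<Longrightarrow> 0 < gauss t z"
  by (simp add: gauss_def)

lemma gauss_le: "0 < t \<Longrightarrow> gauss t (z::'a::euclidean_space) \<le> t powr (- (DIM('a) / 2))"
  by (simp add: gauss_def mult_le_cancel_left1)

lemma smooth_on_exp: "smooth_on (exp :: real \<Rightarrow> real) UNIV"
  unfolding smooth_on_def
proof
  fix k show "Ck_on k (exp :: real \<Rightarrow> real) UNIV"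
    by (induction k) (auto intro!: Ck_on_real_SucI[of exp exp] continuous_intros simp del: Ck_on.simps(2))
qed

lemma smooth_on_gauss: "smooth_on (gauss t) UNIV"
proof -
  have "smooth_on (\<lambda>z::'a. t powr (- (DIM('a) / 2)) * exp ((- 1 / (4 * t)) * (z \<bullet> z))) UNIV"
    by (intro smooth_on_mult smooth_on_const smooth_on_compose[OF smooth_on_exp] smooth_on_inner_self)
  then show ?thesis by (simp add: gauss_def[abs_def])
qed

lemma pd_gauss: "pd i (gauss t) (z::'a::euclidean_space) = - (z \<bullet> i) / (2 * t) * gauss t z"
proof -
  define C where "C = t powr (- (DIM('a) / 2))"
  have g: "gauss t = (\<lambda>z::'a. C * exp ((- 1 / (4 * t)) * (z \<bullet> z)))"
    by (simp add: gauss_def[abs_def] C_def)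
  have "((\<lambda>z. z \<bullet> z) has_derivative (\<lambda>h. 2 * (z \<bullet> h))) (at z)"
    by (auto intro!: derivative_eq_intros simp: inner_commute)
  from has_derivative_mult_right[OF has_derivative_exp[OF has_derivative_mult_right[OF this]]]
  have "(gauss t has_derivative (\<lambda>h. C * ((- 1 / (4 * t)) * (2 * (z \<bullet> h)) * exp ((- 1 / (4 * t)) * (z \<bullet> z))))) (at z)"
    unfolding g .
  then have "pd i (gauss t) z = C * ((- 1 / (4 * t)) * (2 * (z \<bullet> i)) * exp ((- 1 / (4 * t)) * (z \<bullet> z)))"
    by (simp only: has_derivative_imp_frechet)
  then show ?thesis by (simp add: g)
qed

lemma laplacian_gauss:
  "laplacian (gauss t) (z::'a::euclidean_space) = (- (DIM('a) / (2 * t)) + (z \<bullet> z) / (4 * t\<^sup>2)) * gauss t z"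
proof -
  have "pd i (pd i (gauss t)) z = (- 1 / (2 * t) + (z \<bullet> i)\<^sup>2 / (4 * t\<^sup>2)) * gauss t z" if i: "i \<in> Basis" for i :: 'a
  proof -
    have "((\<lambda>z. - (z \<bullet> i) / (2 * t) * gauss t z) has_derivative
        (\<lambda>h. (- (h \<bullet> i) / (2 * t)) * gauss t z + - (z \<bullet> i) / (2 * t) * frechet_derivative (gauss t) (at z) h)) (at z)"
    proof -
      have "((\<lambda>z. - (z \<bullet> i) / (2 * t)) has_derivative (\<lambda>h. - (h \<bullet> i) / (2 * t))) (at z)"
        unfolding divide_inverse by (auto intro!: derivative_eq_intros)
      from has_derivative_mult[OF this smooth_on_derivative(1)[OF smooth_on_gauss]]
      show ?thesis by (simp add: add.commute)
    qed
    then have "frechet_derivative (\<lambda>z. - (z \<bullet> i) / (2 * t) * gauss t z) (at z) i =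
        (- (i \<bullet> i) / (2 * t)) * gauss t z + - (z \<bullet> i) / (2 * t) * pd i (gauss t) z"
      by (simp add: has_derivative_imp_frechet)
    then show ?thesis
      unfolding pd_gauss using i by (simp add: field_simps power2_eq_square)
  qed
  then have "laplacian (gauss t) z = (\<Sum>i\<in>Basis. (- 1 / (2 * t) + (z \<bullet> i)\<^sup>2 / (4 * t\<^sup>2)) * gauss t z)"
    by (simp add: laplacian_pd)
  also have "\<dots> = (\<Sum>i\<in>Basis. - 1 / (2 * t) + (z \<bullet> i)\<^sup>2 / (4 * t\<^sup>2)) * gauss t z"
    by (simp add: sum_distrib_right)
  also have "(\<Sum>i\<in>(Basis::'a set). - 1 / (2 * t) + (z \<bullet> i)\<^sup>2 / (4 * t\<^sup>2)) = - (DIM('a) / (2 * t)) + (z \<bullet> z) / (4 * t\<^sup>2)"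
    by (simp add: sum.distrib sum_divide_distrib[symmetric] euclidean_inner[of z z] power2_eq_square sum_negf sum_subtractf)
  finally show ?thesis .
qed

lemma gauss_time_derivative:
  assumes "0 < t"
  shows "((\<lambda>t. gauss t z) has_real_derivative laplacian (gauss t) (z::'a::euclidean_space)) (at t)"
proof -
  define d where "d = - (real DIM('a) / 2)"
  have "((\<lambda>t. t powr d * exp (- (z \<bullet> z) / (4 * t))) has_real_derivative
      d * t powr (d - 1) * exp (- (z \<bullet> z) / (4 * t)) + t powr d * (exp (- (z \<bullet> z) / (4 * t)) * ((z \<bullet> z) / (4 * t\<^sup>2)))) (at t)"
    using assms by (auto intro!: derivative_eq_intros simp: power2_eq_square)
  moreover have "t powr (d - 1) = t powr d / t"
    using assms by (simp add: powr_diff)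
  ultimately have "((\<lambda>t. gauss t z) has_real_derivative
      d * (t powr d / t) * exp (- (z \<bullet> z) / (4 * t)) + t powr d * (exp (- (z \<bullet> z) / (4 * t)) * ((z \<bullet> z) / (4 * t\<^sup>2)))) (at t)"
    unfolding gauss_def d_def by simp
  moreover have "laplacian (gauss t) z = d * (t powr d / t) * exp (- (z \<bullet> z) / (4 * t)) + t powr d * (exp (- (z \<bullet> z) / (4 * t)) * ((z \<bullet> z) / (4 * t\<^sup>2)))"
    unfolding laplacian_gauss gauss_def d_def[symmetric] using assms
    by (simp add: d_def field_simps)
  ultimately show ?thesis by simp
qed

lemma continuous_on_gauss [continuous_intros]:
  "continuous_on A a \<Longrightarrow> continuous_on A b \<Longrightarrow> (\<And>p. p \<in> A \<Longrightarrow> 0 < a p) \<Longrightarrow> continuous_on A (\<lambda>p. gauss (a p) (b p))"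
  unfolding gauss_def by (intro continuous_intros) fastforce+

lemma continuous_on_laplacian_gauss [continuous_intros]:
  "continuous_on A a \<Longrightarrow> continuous_on A b \<Longrightarrow> (\<And>p. p \<in> A \<Longrightarrow> 0 < a p) \<Longrightarrow>
    continuous_on A (\<lambda>p. laplacian (gauss (a p)) (b p))"
  unfolding laplacian_gauss by (intro continuous_intros) fastforce+

lemma conv_gauss_time_derivative:
  fixes f :: "'a::euclidean_space \<Rightarrow> real"
  assumes f: "continuous_on UNIV f" "bounded K" "\<And>x. x \<notin> K \<Longrightarrow> f x = 0" and t: "0 < t"
  shows "((\<lambda>t. conv f (gauss t) x) has_real_derivative conv f (laplacian (gauss t)) x) (at t)"
proof -
  obtain a b where ab: "K \<subseteq> cbox a b"
    using bounded_subset_cbox_symmetric[OF f(2)] by blast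
  then have f0: "\<And>x. x \<notin> cbox a b \<Longrightarrow> f x = 0" using f(3) by blast
  have "((\<lambda>t. integral (cbox a b) (\<lambda>y. f y * gauss t (x - y))) has_real_derivative
      integral (cbox a b) (\<lambda>y. f y * laplacian (gauss t) (x - y))) (at t within {0<..})"
  proof (rule leibniz_rule_field_derivative)
    fix s :: real and y assume s: "s \<in> {0<..}"
    show "((\<lambda>s. f y * gauss s (x - y)) has_real_derivative f y * laplacian (gauss s) (x - y)) (at s within {0<..})"
      by (intro DERIV_cmult has_field_derivative_at_within[OF gauss_time_derivative]) (use s in auto)
    show "(\<lambda>y. f y * gauss s (x - y)) integrable_on cbox a b"
      using s by (intro integrable_continuous continuous_intros continuous_on_subset[OF f(1)]) auto
  next
    show "continuous_on ({0<..} \<times> cbox a b) (\<lambda>(t, y). f y * laplacian (gauss t) (x - y))"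
      unfolding case_prod_beta
      by (intro continuous_intros continuous_on_compose2[OF f(1) continuous_on_snd[OF continuous_on_id]]) auto
  qed (use t in auto)
  then have "((\<lambda>t. integral (cbox a b) (\<lambda>y. f y * gauss t (x - y))) has_real_derivative
      integral (cbox a b) (\<lambda>y. f y * laplacian (gauss t) (x - y))) (at t)"
    using t by (simp add: at_within_open[of t "{0<..}"])
  then show ?thesis
    by (simp add: conv_eq_integral[OF f(1) f0] smooth_on_continuous smooth_on_gauss continuous_laplacian)
qed

lemma continuous_on_conv_gauss:
  fixes f :: "'a::euclidean_space \<Rightarrow> real"
  assumes f: "continuous_on UNIV f" "bounded K" "\<And>x. x \<notin> K \<Longrightarrow> f x = 0"
  shows "continuous_on ({0<..} \<times> UNIV) (\<lambda>(t, x). conv f (gauss t) x)"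
proof -
  obtain a b where ab: "K \<subseteq> cbox a b"
    using bounded_subset_cbox_symmetric[OF f(2)] by blast
  then have f0: "\<And>x. x \<notin> cbox a b \<Longrightarrow> f x = 0" using f(3) by blast
  have "continuous_on ({0<..} \<times> UNIV) (\<lambda>p. integral (cbox a b) (\<lambda>y. f y * gauss (fst p) (snd p - y)))"
    by (rule integral_continuous_on_param)
      (unfold case_prod_beta, (intro continuous_intros continuous_on_compose2[OF f(1) continuous_on_snd[OF continuous_on_id]]; auto))
  then show ?thesis
    by (simp add: conv_eq_integral[OF f(1) f0] smooth_on_continuous smooth_on_gauss case_prod_beta)
qed

text \<open>The mass of the kernel in the ball of radius \<open>sqrt s\<close> does not depend on \<open>s\<close>.\<close>

lemma conv_gauss_lower:
  fixes f :: "'a::euclidean_space \<Rightarrow> real"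
  assumes f: "continuous_on UNIV f" "bounded K" "\<And>x. x \<notin> K \<Longrightarrow> f x = 0" "\<And>x. 0 \<le> f x"
    and s: "0 < s" and m: "0 \<le> m" "\<And>y. dist x y < sqrt s \<Longrightarrow> m \<le> f y"
  shows "exp (- (1 / 4)) * unit_ball_vol (real DIM('a)) * m \<le> conv f (gauss s) x"
proof -
  \<comment> \<open>A lower bound for the kernel on the ball of radius \<open>sqrt s\<close>, where
    the exponent is at least -1/4.\<close>
  define a where "a = s powr (- (DIM('a) / 2)) * exp (- (1 / 4))"
  have "sqrt s ^ DIM('a) = s powr (DIM('a) / 2)"
    using s by (simp add: powr_half_sqrt[symmetric] powr_powr powr_realpow[symmetric])
  then have "a * (unit_ball_vol (real DIM('a)) * sqrt s ^ DIM('a)) = exp (- (1 / 4)) * unit_ball_vol (real DIM('a))"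
    using s by (simp add: a_def powr_minus)
  then have "exp (- (1 / 4)) * unit_ball_vol (real DIM('a)) * m = (a * (unit_ball_vol (real DIM('a)) * sqrt s ^ DIM('a))) * m"
    by (simp only:)
  also have "\<dots> = m * a * measure lborel (ball x (sqrt s))"
    using s content_ball[of "sqrt s" x] by simp
  also have "\<dots> = (LINT y|lborel. m * a * indicator (ball x (sqrt s)) y)"
    by simp
  also have "\<dots> \<le> (LINT y|lborel. f y * gauss s (x - y))"
  proof (rule integral_mono)
    show "integrable lborel (\<lambda>y. m * a * indicator (ball x (sqrt s)) y)"
      by (intro integrable_mult_right integrable_real_indicator) (use emeasure_lborel_ball_finite[of x "sqrt s"] in auto)
    show "integrable lborel (\<lambda>y. f y * gauss s (x - y))"
      by (rule integrable_conv[OF f(1-3) smooth_on_continuous[OF smooth_on_gauss]])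
    fix y
    show "m * a * indicator (ball x (sqrt s)) y \<le> f y * gauss s (x - y)"
    proof (cases "y \<in> ball x (sqrt s)")
      case True
      then have "norm (x - y) \<le> sqrt s" by (simp add: dist_norm)
      then have "(x - y) \<bullet> (x - y) \<le> s"
        using power_mono[OF _ norm_ge_zero, of "x - y" "sqrt s" 2] s by (simp add: power2_norm_eq_inner)
      then have "a \<le> gauss s (x - y)"
        using s by (simp add: a_def gauss_def field_simps)
      then show ?thesis
        using True m s f(4) by (auto simp: a_def intro!: mult_mono)
    next
      case False
      then show ?thesis using f(4)[of y] gauss_pos[OF s, of "x - y"] by simp
    qed
  qed
  finally show ?thesis by (simp add: conv_def)
qed

lemma conv_gauss_upper:
  fixes f :: "'a::euclidean_space \<Rightarrow> real"
  assumes f: "continuous_on UNIV f" "bounded K" "\<And>x. x \<notin> K \<Longrightarrow> f x = 0" "\<And>x. 0 \<le> f x" and s: "0 < s"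
  shows "conv f (gauss s) x \<le> s powr (- (DIM('a) / 2)) * (LINT y|lborel. f y)"
proof -
  have "conv f (gauss s) x \<le> (LINT y|lborel. s powr (- (DIM('a) / 2)) * f y)"
    unfolding conv_def
  proof (rule integral_mono)
    show "integrable lborel (\<lambda>y. f y * gauss s (x - y))"
      by (rule integrable_conv[OF f(1-3) smooth_on_continuous[OF smooth_on_gauss]])
    show "integrable lborel (\<lambda>y. s powr (- (DIM('a) / 2)) * f y)"
      by (intro integrable_mult_right integrable_bounded_support[OF f(1-3)])
    show "f y * gauss s (x - y) \<le> s powr (- (DIM('a) / 2)) * f y" for y
      using mult_left_mono[OF gauss_le[OF s, of "x - y"] f(4)[of y]] by (simp add: mult.commute)
  qed
  then show ?thesis by simp
qed

section \<open>The bound from L1 to the supremum norm\<close>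

context dirichlet_semigroup
begin

lemma integrable_C0: "u \<in> C0 Q \<Longrightarrow> integrable lborel (apply_c0 u)"
  by (rule integrable_bounded_support[OF continuous_apply_c0 bounded_Q C0_zero])

lemma integrable_abs_C0: "u \<in> C0 Q \<Longrightarrow> integrable lborel (\<lambda>x. \<bar>apply_c0 u x\<bar>)"
  using integrable_C0 by (rule integrable_abs)

text \<open>The barrier is the free heat flow of the positive part of \<open>u\<close>, started at a
  time \<open>s > 0\<close> at which the kernel is smooth. It dominates \<open>u\<close> initially
  after division by \<open>c\<close>, a lower bound for the mass of the kernel in the ball of radius
  \<open>sqrt s\<close>, and addition of \<open>e\<close>.\<close>

lemma ultracontractive_upper:
  assumes u: "u \<in> C0 Q" and t: "0 < t"
  defines "c \<equiv> exp (- (1 / 4)) * unit_ball_vol (real DIM('a))"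
  shows "apply_c0 (T t u) x \<le> t powr (- (DIM('a) / 2)) / c * (LINT y|lborel. \<bar>apply_c0 u y\<bar>)"
proof (rule field_le_epsilon)
  fix e :: real assume e: "0 < e"
  have c: "c > 0" by (simp add: c_def)
  have div: "m \<le> 1 / c * r" if "c * m \<le> r" for m r using c that by (simp add: field_simps)
  define F where "F y = max 0 (apply_c0 u y)" for y
  have F: "continuous_on UNIV F" "\<And>y. y \<notin> Q \<Longrightarrow> F y = 0" "\<And>y. 0 \<le> F y"
    unfolding F_def[abs_def] using C0_zero[OF u] by (simp_all add: continuous_on_max continuous_apply_c0)
  note F' = F(1) bounded_Q F(2)
  obtain d where d: "0 < d" "\<And>x y. dist x y < d \<Longrightarrow> \<bar>F x - F y\<bar> < e"
    using uniformly_continuous_bounded_support[OF F' e] by metis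
  \<comment> \<open>With this choice \<open>F\<close> differs by less than \<open>e\<close> from its
    value at the centre on a ball of radius \<open>sqrt s\<close>.\<close>
  define s where "s = d\<^sup>2"
  have s: "0 < s" "sqrt s = d" using d by (auto simp: s_def)
  have ge0: "0 \<le> conv F (gauss r) y" if "0 < r" for r y
    unfolding conv_def using F(3) gauss_pos[OF that]
    by (intro integral_nonneg_AE AE_I2 mult_nonneg_nonneg) (auto intro: less_imp_le)
  have "apply_c0 (T t u) x \<le> e + 1 / c * conv F (gauss (t + s)) x"
  proof (rule comparison[OF u, where V = "\<lambda>t x. e + 1 / c * conv F (gauss (t + s)) x"
        and V' = "\<lambda>t x. 1 / c * conv F (laplacian (gauss (t + s))) x" and \<tau> = t])
    fix r y assume r: "r \<in> {0..t}"
    have sm: "smooth_on (conv F (gauss (r + s))) UNIV"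
      by (rule smooth_on_conv[OF F' smooth_on_gauss])
    then show "smooth_on (\<lambda>x. e + 1 / c * conv F (gauss (r + s)) x) UNIV"
      by (intro smooth_on_add smooth_on_mult smooth_on_const)
    show "laplacian (\<lambda>x. e + 1 / c * conv F (gauss (r + s)) x) y \<le> 1 / c * conv F (laplacian (gauss (r + s))) y"
      using laplacian_const_add_scale[OF sm, where c = e and a = "1 / c" and x = y]
        laplacian_conv[OF F' smooth_on_gauss[of "r + s"], where x = y] by simp
    have "((\<lambda>t. conv F (gauss (t + s)) y) has_real_derivative conv F (laplacian (gauss (r + s))) y) (at r)"
      using conv_gauss_time_derivative[OF F', of "r + s" y] r s by (simp add: DERIV_shift)
    then show "((\<lambda>t. e + 1 / c * conv F (gauss (t + s)) y) has_real_derivative 1 / c * conv F (laplacian (gauss (r + s))) y) (at r)"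
      using c by (auto intro!: derivative_eq_intros)
    show "y \<notin> Q \<Longrightarrow> 0 \<le> e + 1 / c * conv F (gauss (r + s)) y"
      using ge0[of "r + s" y] r s e c by simp
  next
    show "continuous_on ({0..t} \<times> UNIV) (\<lambda>(t, x). e + 1 / c * conv F (gauss (t + s)) x)"
      unfolding case_prod_beta
      by (intro continuous_intros
          continuous_on_compose2[OF continuous_on_conv_gauss[OF F'], of _ "\<lambda>p. (fst p + s, snd p)", unfolded case_prod_beta fst_conv snd_conv])
        (use s in auto)
    fix y
    have "c * max 0 (F y - e) \<le> conv F (gauss s) y"
      unfolding c_def
    proof (rule conv_gauss_lower[OF F' F(3) s(1)])
      show "max 0 (F y - e) \<le> F z" if "dist y z < sqrt s" for z
        using d(2)[of y z] that F(3)[of z] s by auto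
    qed (simp_all add: max.cobounded1)
    then have "max 0 (F y - e) \<le> 1 / c * conv F (gauss s) y" by (rule div)
    moreover have "apply_c0 u y \<le> F y" by (simp add: F_def)
    ultimately show "apply_c0 u y \<le> e + 1 / c * conv F (gauss (0 + s)) y" by simp
  qed (use t in auto)
  also have "1 / c * conv F (gauss (t + s)) x \<le> 1 / c * (t powr (- (DIM('a) / 2)) * (LINT y|lborel. \<bar>apply_c0 u y\<bar>))"
  proof (intro mult_left_mono)
    have "conv F (gauss (t + s)) x \<le> (t + s) powr (- (DIM('a) / 2)) * (LINT y|lborel. F y)"
      using conv_gauss_upper[OF F' F(3)] t s by auto
    also have "\<dots> \<le> t powr (- (DIM('a) / 2)) * (LINT y|lborel. \<bar>apply_c0 u y\<bar>)"
    proof (intro mult_mono)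
      show "(t + s) powr (- (DIM('a) / 2)) \<le> t powr (- (DIM('a) / 2))"
        using t s by (intro powr_mono2') auto
      show "(LINT y|lborel. F y) \<le> (LINT y|lborel. \<bar>apply_c0 u y\<bar>)"
        by (intro integral_mono integrable_abs_C0 u integrable_bounded_support[OF F']) (auto simp: F_def)
      show "0 \<le> (LINT y|lborel. F y)" by (intro integral_nonneg_AE AE_I2 F(3))
    qed simp
    finally show "conv F (gauss (t + s)) x \<le> t powr (- (DIM('a) / 2)) * (LINT y|lborel. \<bar>apply_c0 u y\<bar>)" .
  qed (use c in auto)
  finally show "apply_c0 (T t u) x \<le> t powr (- (DIM('a) / 2)) / c * (LINT y|lborel. \<bar>apply_c0 u y\<bar>) + e"
    by simp
qed

lemma ultracontractive:
  assumes t: "0 < t"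
  obtains C where "0 < C" "\<And>u. u \<in> C0 Q \<Longrightarrow> norm (T t u) \<le> C * (LINT y|lborel. \<bar>apply_c0 u y\<bar>)"
proof
  define c where "c = exp (- (1 / 4)) * unit_ball_vol (real DIM('a))"
  define C where "C = t powr (- (DIM('a) / 2)) / c"
  show "0 < C" using t by (simp add: C_def c_def)
  fix u assume u: "u \<in> C0 Q"
  show "norm (T t u) \<le> C * (LINT y|lborel. \<bar>apply_c0 u y\<bar>)"
  proof (rule norm_c0_bound)
    fix x
    show "\<bar>apply_c0 (T t u) x\<bar> \<le> C * (LINT y|lborel. \<bar>apply_c0 u y\<bar>)"
      using ultracontractive_upper[OF u t, of x] ultracontractive_upper[OF subspace_neg[OF subspace_C0 u] t, of x]
        S_minus[of t u] t u by (simp add: C_def c_def abs_le_iff)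
  qed
qed

end

section \<open>Symmetry\<close>

lemma frechet_derivative_zero_outside:
  assumes "closed K" "\<And>x. x \<notin> K \<Longrightarrow> f x = 0" "x \<notin> K"
  shows "frechet_derivative f (at x) = (\<lambda>_. 0)"
proof -
  obtain d where d: "d > 0" "ball x d \<subseteq> - K"
    using assms(1,3) openE[of "- K" x] by auto
  have "(f has_derivative (\<lambda>_. 0)) (at x)"
    by (rule has_derivative_transform_within[OF has_derivative_const[of 0] d(1)])
      (use d(2) assms(2) in \<open>auto simp: subset_iff dist_commute\<close>)
  then show ?thesis by (rule has_derivative_imp_frechet)
qed

text \<open>Differentiate the constant function \<open>x \<mapsto> \<integral> f (x - y) dy\<close>.\<close>

lemma integral_pd_zero:
  fixes f :: "'a::euclidean_space \<Rightarrow> real"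
  assumes f: "smooth_on f UNIV" and K: "compact K" "\<And>x. x \<notin> K \<Longrightarrow> f x = 0" and i: "i \<in> Basis"
  shows "(LINT x|lborel. pd i f x) = 0"
proof -
  obtain r where r: "\<And>x. x \<in> K \<Longrightarrow> norm x \<le> r"
    using compact_imp_bounded[OF K(1)] unfolding bounded_iff by blast
  \<comment> \<open>A cutoff replaces the constant 1, as \<open>conv\<close> asks for bounded
    support. It is 1 wherever the integrand is nonzero for |x| < 1, so that \<open>conv c f\<close>
    is constant near 0.\<close>
  define c where "c y = max 0 (min 1 (r + 3 - norm y))" for y :: 'a
  have c: "continuous_on UNIV c" "\<And>y. y \<notin> cball 0 (r + 3) \<Longrightarrow> c y = 0" "\<And>y. norm y \<le> r + 2 \<Longrightarrow> c y = 1"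
    unfolding c_def[abs_def] by (auto intro!: continuous_intros)
  note c' = c(1) bounded_cball c(2)
  have conv_c: "conv c \<kappa> x = (LINT y|lborel. \<kappa> y)"
    if "norm x < 1" "continuous_on UNIV \<kappa>" "\<And>x. x \<notin> K \<Longrightarrow> \<kappa> x = 0" for x \<kappa>
  proof -
    have eq: "c y * \<kappa> (x - y) = \<kappa> (x - y)" for y
    proof (cases "x - y \<in> K")
      case True
      then have "norm y \<le> r + 2" using r[OF True] that(1) norm_triangle_ineq4[of x "x - y"] by simp
      then show ?thesis using c(3) by simp
    qed (use that(3) in auto)
    then have "conv c \<kappa> x = (LINT y|lborel. \<kappa> (x - y))" by (simp only: conv_def eq)
    then show ?thesis
      using integral_reflect_lborel(1)[OF borel_measurable_continuous_onI[OF that(2)]] by simp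
  qed
  have "((\<lambda>_. LINT y|lborel. f y) has_derivative (\<lambda>_. 0)) (at (0::'a))" by simp
  then have "(conv c f has_derivative (\<lambda>_. 0)) (at 0)"
    by (rule has_derivative_transform_within[of _ _ _ _ 1])
      (use conv_c[OF _ smooth_on_continuous[OF f] K(2)] in auto)
  then have "pd i (conv c f) 0 = 0" by (simp add: has_derivative_imp_frechet)
  moreover have "pd i (conv c f) 0 = conv c (pd i f) 0" by (rule pd_conv[OF c' f])
  moreover have "conv c (pd i f) 0 = (LINT y|lborel. pd i f y)"
    by (rule conv_c) (use frechet_derivative_zero_outside[OF compact_imp_closed[OF K(1)] K(2)]
        smooth_on_continuous[OF smooth_on_derivative(2)[OF f i]] in auto)
  ultimately show ?thesis by simp
qed

lemma integral_laplacian_zero: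
  fixes f :: "'a::euclidean_space \<Rightarrow> real"
  assumes f: "smooth_on f UNIV" and K: "compact K" "\<And>x. x \<notin> K \<Longrightarrow> f x = 0"
  shows "(LINT x|lborel. laplacian f x) = 0"
proof -
  have z: "pd i f x = 0" if "x \<notin> K" for i x
    using frechet_derivative_zero_outside[OF compact_imp_closed[OF K(1)] K(2) that] by simp
  have z2: "pd i (pd i f) x = 0" if "x \<notin> K" for i x
    using frechet_derivative_zero_outside[OF compact_imp_closed[OF K(1)] z that] by simp
  have "(LINT x|lborel. laplacian f x) = (\<Sum>i\<in>Basis. LINT x|lborel. pd i (pd i f) x)"
    unfolding laplacian_pd
    by (rule Bochner_Integration.integral_sum)
      (auto intro!: integrable_bounded_support[OF _ compact_imp_bounded[OF K(1)]] smooth_on_continuous smooth_on_derivative f z2)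
  also have "\<dots> = 0"
    by (intro sum.neutral ballI integral_pd_zero[OF smooth_on_derivative(2)[OF f] K(1) z])
  finally show ?thesis .
qed

lemma laplacian_chain:
  fixes v :: "'a::euclidean_space \<Rightarrow> real"
  assumes J: "\<And>s. (J has_real_derivative J1 s) (at s)" "\<And>s. (J1 has_real_derivative J2 s) (at s)"
    and v: "smooth_on v UNIV"
  shows "laplacian (\<lambda>x. J (v x)) x = J1 (v x) * laplacian v x + J2 (v x) * (\<Sum>i\<in>Basis. (pd i v x)\<^sup>2)"
proof -
  have chain: "((\<lambda>x. F (v x)) has_derivative (\<lambda>h. F' (v x) * frechet_derivative v (at x) h)) (at x)"
    if "\<And>s. (F has_real_derivative F' s) (at s)" for F F' :: "real \<Rightarrow> real" and x
    using has_derivative_compose[OF smooth_on_derivative(1)[OF v] that[unfolded has_field_derivative_def]] .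
  have "pd i (pd i (\<lambda>x. J (v x))) x = J1 (v x) * pd i (pd i v) x + J2 (v x) * (pd i v x)\<^sup>2" if i: "i \<in> Basis" for i
  proof -
    have "pd i (\<lambda>x. J (v x)) = (\<lambda>x. J1 (v x) * pd i v x)"
      by (rule ext) (simp add: has_derivative_imp_frechet[OF chain[OF J(1)]])
    then show ?thesis
      using has_derivative_imp_frechet[OF has_derivative_mult[OF chain[OF J(2)] smooth_on_derivative(1)[OF smooth_on_derivative(2)[OF v i]]]]
      by (simp add: power2_eq_square)
  qed
  then show ?thesis
    by (simp add: laplacian_pd sum.distrib sum_distrib_left)
qed

section \<open>The L2 inner product on Q\<close>

definition ip :: "'a::euclidean_space set \<Rightarrow> 'a c0 \<Rightarrow> 'a c0 \<Rightarrow> real"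
  where "ip Q u v = (LINT x:Q|lborel. apply_c0 u x * apply_c0 v x)"

lemma set_integrable_c0:
  assumes "open Q" "bounded Q" "continuous_on UNIV f"
  shows "set_integrable lborel Q (f :: 'a::euclidean_space \<Rightarrow> real)"
proof -
  obtain a b where ab: "Q \<subseteq> cbox a b"
    using bounded_subset_cbox_symmetric[OF assms(2)] by blast
  have "set_integrable lborel (cbox a b) f"
    unfolding set_integrable_def by (intro borel_integrable_compact continuous_on_subset[OF assms(3)]) auto
  then show ?thesis
    by (rule set_integrable_subset) (use ab assms(1) in auto)
qed

text \<open>Integrating over the bounded set \<open>Q\<close> and not over the whole space makes the
  product finite for all elements of the type, so it is bounded bilinear without reference to a
  subspace.\<close>

lemma bounded_bilinear_ip:
  assumes "open Q" "bounded (Q :: 'a::euclidean_space set)"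
  shows "bounded_bilinear (ip Q)"
proof -
  have i: "set_integrable lborel Q (\<lambda>x. apply_c0 u x * apply_c0 v x)" for u v :: "'a c0"
    by (rule set_integrable_c0[OF assms]) (intro continuous_intros continuous_apply_c0)
  have fin: "emeasure lborel Q < \<infinity>"
    using assms emeasure_bounded_finite by blast
  show ?thesis
  proof
    fix u u' v v' :: "'a c0" and r :: real
    show "ip Q (u + u') v = ip Q u v + ip Q u' v" "ip Q u (v + v') = ip Q u v + ip Q u v'"
      unfolding ip_def by (simp_all add: distrib_left distrib_right set_integral_add(2)[OF i i])
    show "ip Q (r *\<^sub>R u) v = r *\<^sub>R ip Q u v" "ip Q u (r *\<^sub>R v) = r *\<^sub>R ip Q u v"
      unfolding ip_def by (simp_all add: mult.assoc mult.left_commute)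
    have "norm (ip Q u v) \<le> norm u * norm v * measure lborel Q" for u v
    proof -
      have "norm (ip Q u v) \<le> (LINT x|lborel. norm u * norm v * indicator Q x)"
        unfolding ip_def set_lebesgue_integral_def
      proof (rule Bochner_Integration.integral_norm_bound_integral)
        show "integrable lborel (\<lambda>x. indicat_real Q x *\<^sub>R (apply_c0 u x * apply_c0 v x))"
          using i by (simp add: set_integrable_def)
        show "integrable lborel (\<lambda>x. norm u * norm v * indicat_real Q x)"
          using fin assms(1) by (intro integrable_mult_right integrable_real_indicator) auto
        show "norm (indicat_real Q x *\<^sub>R (apply_c0 u x * apply_c0 v x)) \<le> norm u * norm v * indicat_real Q x" for x
          using mult_mono[OF norm_c0_bounded[of u x] norm_c0_bounded[of v x]] by (simp add: abs_mult indicator_def)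
      qed
      then show ?thesis using assms(1) by simp
    qed
    then show "\<exists>K. \<forall>a b. norm (ip Q a b) \<le> norm a * norm b * K" by blast
  qed
qed

lemma ip_commute: "ip Q u v = ip Q v u"
  by (simp add: ip_def mult.commute)

lemma ip_C0: "u \<in> C0 Q \<Longrightarrow> ip Q u v = (LINT x|lborel. apply_c0 u x * apply_c0 v x)"
  unfolding ip_def set_lebesgue_integral_def
  by (rule Bochner_Integration.integral_cong) (auto simp: indicator_def C0_def)

lemma ip_nonneg: "0 \<le> ip Q u u"
  unfolding ip_def set_lebesgue_integral_def by (intro integral_nonneg_AE) auto

section \<open>Testing the equation with truncations\<close>

context dirichlet_semigroup
begin

lemma integrable_Q:
  fixes p :: "'a \<Rightarrow> real"
  shows "continuous_on UNIV p \<Longrightarrow> (\<And>x. x \<notin> Q \<Longrightarrow> p x = 0) \<Longrightarrow> integrable lborel p"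
  by (rule integrable_bounded_support[OF _ bounded_Q])

text \<open>
  Testing the equation for \<open>u\<close> with a smooth truncation of a mollification of \<open>v\<close>.  The gradient term
  \<open>r\<close> lives where \<open>v\<close> is small, and its total mass is controlled by \<open>q\<close> because the Laplacian of the
  test function has integral zero.
\<close>

lemma truncation_estimate:
  assumes uf: "(u, f) \<in> dirichlet_neg_laplacian Q" and vg: "(v, g) \<in> dirichlet_neg_laplacian Q"
    and e: "0 < e" and M: "\<And>x. x \<in> Q \<Longrightarrow> apply_c0 v x \<le> 3 * e \<Longrightarrow> \<bar>apply_c0 u x\<bar> \<le> M"
    and M0: "0 \<le> M" and nn: "\<And>x. 0 \<le> apply_c0 v x"
  obtains p q :: "'a \<Rightarrow> real" where "continuous_on UNIV p" "continuous_on UNIV q" "\<And>x. x \<notin> Q \<Longrightarrow> p x = 0" "\<And>x. x \<notin> Q \<Longrightarrow> q x = 0"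
    "\<And>x. \<bar>p x - apply_c0 v x\<bar> \<le> 3 * e" "\<And>x. \<bar>q x\<bar> \<le> norm g + e"
    "\<And>x. 3 * e \<le> apply_c0 v x \<Longrightarrow> \<bar>q x - apply_c0 g x\<bar> \<le> e"
    "\<bar>(LINT x|lborel. apply_c0 f x * p x) - (LINT x|lborel. apply_c0 u x * q x)\<bar> \<le> M * (LINT x|lborel. \<bar>q x\<bar>)"
proof -
  have u: "u \<in> C0 Q" and f: "f \<in> C0 Q"
    and test: "\<And>\<phi>. test_function Q \<phi> \<Longrightarrow>
      (LINT x|lborel. apply_c0 u x * (- laplacian \<phi> x)) = (LINT x|lborel. apply_c0 f x * \<phi> x)"
    using uf by (auto simp: dirichlet_neg_laplacian_def)
  have v: "v \<in> C0 Q" and g: "g \<in> C0 Q"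
    using vg by (auto simp: dirichlet_neg_laplacian_def)
  note cv = continuous_apply_c0[of UNIV v] bounded_Q C0_zero[OF v]
  note cg = continuous_apply_c0[of UNIV g] bounded_Q C0_zero[OF g]
  obtain j j1 j2 :: "real \<Rightarrow> real" where j: "\<And>s. (j has_real_derivative j1 s) (at s)" "\<And>s. (j1 has_real_derivative j2 s) (at s)"
    "smooth_on j UNIV" "continuous_on UNIV j1" "continuous_on UNIV j2"
    and j2: "\<And>s. 0 \<le> j2 s" "\<And>s. s \<le> 1 \<or> 2 \<le> s \<Longrightarrow> j2 s = 0"
    and j1: "\<And>s. 0 \<le> j1 s" "\<And>s. j1 s \<le> 1" "\<And>s. s \<le> 1 \<Longrightarrow> j1 s = 0" "\<And>s. 2 \<le> s \<Longrightarrow> j1 s = 1"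
    and j0: "\<And>s. s \<le> 1 \<Longrightarrow> j s = 0" "\<And>s. 0 \<le> s \<Longrightarrow> \<bar>j s - s\<bar> \<le> 2"
    by (rule smooth_truncation) blast
  \<comment> \<open>Off this set the mollified \<open>v\<close> is at most \<open>e\<close>, where
    the truncation vanishes; thus the test function is supported in a compact subset of
    \<open>Q\<close>.\<close>
  define K where "K = {x. e / 2 \<le> apply_c0 v x}"
  have KQ: "K \<subseteq> Q" using C0_zero[OF v] e by (force simp: K_def)
  have K: "compact K"
    unfolding compact_eq_bounded_closed
  proof
    show "bounded K" by (rule bounded_subset[OF bounded_Q KQ])
    show "closed K" unfolding K_def by (intro closed_Collect_le continuous_apply_c0 continuous_on_const)
  qed
  obtain r0 where r0: "r0 > 0" "(\<Union>x\<in>K. cball x r0) \<subseteq> Q"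
    using compact_subset_open_imp_cball_epsilon_subset[OF K open_Q KQ] by metis
  obtain d1 where d1: "0 < d1" "\<And>x y. dist x y < d1 \<Longrightarrow> \<bar>apply_c0 v x - apply_c0 v y\<bar> < e / 2"
    using uniformly_continuous_bounded_support[OF cv, of "e / 2"] e by auto
  obtain d2 where d2: "0 < d2" "\<And>x y. dist x y < d2 \<Longrightarrow> \<bar>apply_c0 g x - apply_c0 g y\<bar> < e"
    using uniformly_continuous_bounded_support[OF cg e] by metis
  \<comment> \<open>The mollification radius keeps balls about points of \<open>K\<close> inside
    \<open>Q\<close> and the errors in \<open>v\<close> and \<open>g\<close> within
    \<open>e / 2\<close> and \<open>e\<close>.\<close>
  define \<eta> where "\<eta> = Min {r0, d1, d2}"
  have \<eta>: "0 < \<eta>" "\<eta> \<le> r0" "\<eta> \<le> d1" "\<eta> \<le> d2" using r0 d1 d2 by (auto simp: \<eta>_def)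
  obtain \<kappa> :: "'a \<Rightarrow> real" where k: "smooth_on \<kappa> UNIV" "\<And>z. 0 \<le> \<kappa> z" "\<And>z. \<eta> \<le> norm z \<Longrightarrow> \<kappa> z = 0"
    "integrable lborel \<kappa>" "(LINT z|lborel. \<kappa> z) = 1"
    using mollifier_exists[OF \<eta>(1)] by metis
  note k' = smooth_on_continuous[OF k(1)] k(2-5)
  define V where "V = conv (apply_c0 v) \<kappa>"
  define G where "G = conv (apply_c0 g) \<kappa>"
  have sV: "smooth_on V UNIV" unfolding V_def by (rule smooth_on_conv[OF cv k(1)])
  have cG: "continuous_on UNIV G" unfolding G_def by (rule continuous_on_conv[OF cg k'(1)])
  have nearv: "apply_c0 v x - e / 2 \<le> apply_c0 v y \<and> apply_c0 v y \<le> apply_c0 v x + e / 2" if "dist x y < \<eta>" for x y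
    using d1(2)[of x y] \<eta> that by linarith
  have nearg: "apply_c0 g x - e \<le> apply_c0 g y \<and> apply_c0 g y \<le> apply_c0 g x + e" if "dist x y < \<eta>" for x y
    using d2(2)[of x y] \<eta> that by linarith
  have V_close: "apply_c0 v x - e / 2 \<le> V x" "V x \<le> apply_c0 v x + e / 2" for x
    unfolding V_def by (rule conv_close[OF cv k' nearv], assumption+)+
  have G_close: "apply_c0 g x - e \<le> G x" "G x \<le> apply_c0 g x + e" for x
    unfolding G_def by (rule conv_close[OF cg k' nearg], assumption+)+
  have V_K: "V x \<le> e" if "x \<notin> K" for x
    using V_close(2)[of x] that by (auto simp: K_def)
  have V0: "0 \<le> V x" for x
    unfolding V_def by (rule conv_close(1)[where x = x and a = 0 and b = "norm v", OF cv k']) (use nn norm_c0_bounded[of v] in \<open>auto simp: abs_le_iff\<close>)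
  \<comment> \<open>The rescaling moves the thresholds 1 and 2 of \<open>j\<close> to
    \<open>e\<close> and \<open>2 * e\<close> and keeps the slope.\<close>
  define J where "J s = e * j (inverse e * s)" for s
  define J1 where "J1 s = j1 (inverse e * s)" for s
  define J2 where "J2 s = j2 (inverse e * s) * inverse e" for s
  have J: "(J has_real_derivative J1 s) (at s)" "(J1 has_real_derivative J2 s) (at s)" for s
  proof -
    have m: "((\<lambda>s. inverse e * s) has_real_derivative inverse e) (at s)"
      by (auto intro!: derivative_eq_intros)
    show "(J1 has_real_derivative J2 s) (at s)"
      unfolding J1_def J2_def using DERIV_chain2[OF j(2) m] .
    show "(J has_real_derivative J1 s) (at s)"
    proof -
      have "e * (j1 (inverse e * s) * inverse e) = j1 (inverse e * s)" using e by simp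
      then show ?thesis
        using DERIV_cmult[OF DERIV_chain2[OF j(1) m], of e] unfolding J_def J1_def by (simp only:)
    qed
  qed
  have J_small: "J s = 0" "J1 s = 0" "J2 s = 0" if "s \<le> e" for s
    using that e j0(1) j1(3) j2(2) by (auto simp: J_def J1_def J2_def field_simps)
  define p where "p x = J (V x)" for x
  define q where "q x = J1 (V x) * G x" for x
  define r where "r x = J2 (V x) * (\<Sum>i\<in>Basis. (pd i V x)\<^sup>2)" for x
  have sJ: "smooth_on J UNIV"
    unfolding J_def by (intro smooth_on_mult smooth_on_const smooth_on_compose[OF j(3)]) (simp add: smooth_on_def Ck_on_bounded_linear bounded_linear_ident)
  have cJ1: "continuous_on UNIV J1" unfolding J1_def
    by (rule continuous_on_compose2[OF j(4)]) (auto intro!: continuous_intros)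
  have cJ2: "continuous_on UNIV J2" unfolding J2_def
    by (rule continuous_on_mult[OF continuous_on_compose2[OF j(5)]]) (auto intro!: continuous_intros)
  note cVV = smooth_on_continuous[OF sV]
  have sp: "smooth_on p UNIV" unfolding p_def by (rule smooth_on_compose[OF sJ sV])
  have cq: "continuous_on UNIV q" unfolding q_def
    by (intro continuous_intros cG continuous_on_compose2[OF cJ1 cVV]) auto
  have cr: "continuous_on UNIV r" unfolding r_def
    by (intro continuous_intros continuous_on_compose2[OF cJ2 cVV] smooth_on_continuous smooth_on_derivative sV) auto
  have zK: "p x = 0" "q x = 0" "r x = 0" if "x \<notin> K" for x
    using J_small[OF V_K[OF that]] by (auto simp: p_def q_def r_def)
  then have zQ: "p x = 0" "q x = 0" "r x = 0" if "x \<notin> Q" for x using that KQ by auto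
  have lap: "laplacian p x = r x - q x" for x
  proof (cases "x \<in> K")
    case True
    then have "cball x \<eta> \<subseteq> Q" using r0(2) \<eta>(2) by (fastforce simp: subset_iff)
    then have "laplacian V x = - G x"
      unfolding V_def G_def by (intro laplacian_conv_dirichlet[OF vg bounded_Q k(1)] k(3))
    then show ?thesis
      using laplacian_chain[OF J sV, of x] by (simp add: p_def[abs_def] q_def r_def)
  next
    case False
    then show ?thesis
      using laplacian_chain[OF J sV, of x] J_small[OF V_K[OF False]] by (simp add: p_def[abs_def] q_def r_def)
  qed
  have tp: "test_function Q p"
    unfolding test_function_def using sp K KQ zK by blast
  note iq = integrable_Q[OF cq zQ(2)] and ir = integrable_Q[OF cr zQ(3)]
  have r0: "0 \<le> r x" for x unfolding r_def J2_def using e j2(1) by (intro mult_nonneg_nonneg sum_nonneg) auto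
  have "(LINT x|lborel. r x - q x) = 0"
    using integral_laplacian_zero[OF sp K zK(1)] by (simp add: lap[abs_def])
  \<comment> \<open>There is no pointwise bound on the gradient term \<open>r\<close>, whereas
    \<open>q\<close> is bounded by \<open>norm g + e\<close>; equality of the integrals is what
    controls \<open>r\<close>.\<close>
  then have rq: "(LINT x|lborel. r x) = (LINT x|lborel. q x)"
    using iq ir by simp
  have iuq: "integrable lborel (\<lambda>x. apply_c0 u x * q x)" and iur: "integrable lborel (\<lambda>x. apply_c0 u x * r x)"
    using zQ by (auto intro!: integrable_Q continuous_intros continuous_apply_c0 cq cr)
  have "(LINT x|lborel. apply_c0 f x * p x) = (LINT x|lborel. apply_c0 u x * q x - apply_c0 u x * r x)"
    using test[OF tp] by (simp add: lap right_diff_distrib)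
  then have "(LINT x|lborel. apply_c0 f x * p x) - (LINT x|lborel. apply_c0 u x * q x) = - (LINT x|lborel. apply_c0 u x * r x)"
    using iuq iur by simp
  moreover have "\<bar>LINT x|lborel. apply_c0 u x * r x\<bar> \<le> (LINT x|lborel. M * r x)"
    unfolding real_norm_def[symmetric]
  proof (rule Bochner_Integration.integral_norm_bound_integral[OF iur])
    show "integrable lborel (\<lambda>x. M * r x)" using ir by simp
    fix x
    show "norm (apply_c0 u x * r x) \<le> M * r x"
    proof (cases "r x = 0")
      case False
      then have x: "x \<in> K" "J2 (V x) \<noteq> 0" using zK by (auto simp: r_def)
      \<comment> \<open>Together with the mollification error \<open>e / 2\<close> this stays below
        the \<open>3 * e\<close> in the assumption on \<open>u\<close>.\<close>
      then have "V x < 2 * e" using j2(2)[of "inverse e * V x"] e by (force simp: J2_def field_simps)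
      then have "\<bar>apply_c0 u x\<bar> \<le> M" using V_close(1)[of x] KQ x e by (intro M) auto
      then show ?thesis using r0[of x] by (auto simp: abs_mult intro: mult_right_mono)
    qed simp
  qed
  moreover have "M * (LINT x|lborel. r x) \<le> M * (LINT x|lborel. \<bar>q x\<bar>)"
    unfolding rq using iq M0 by (intro mult_left_mono integral_mono) auto
  ultimately have est: "\<bar>(LINT x|lborel. apply_c0 f x * p x) - (LINT x|lborel. apply_c0 u x * q x)\<bar> \<le> M * (LINT x|lborel. \<bar>q x\<bar>)"
    by simp
  show thesis
  proof (rule that[OF smooth_on_continuous[OF sp] cq zQ(1,2) _ _ _ est])
    fix x
    have "\<bar>J (V x) - V x\<bar> \<le> 2 * e"
    proof -
      have "J (V x) - V x = e * (j (inverse e * V x) - inverse e * V x)"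
        using e by (simp add: J_def field_simps)
      then show ?thesis using j0(2)[of "inverse e * V x"] V0[of x] e by (simp add: abs_mult)
    qed
    then show "\<bar>p x - apply_c0 v x\<bar> \<le> 3 * e" using V_close[of x] e unfolding p_def by linarith
    have "\<bar>G x\<bar> \<le> norm g + e" using G_close[of x] norm_c0_bounded[of g x] by linarith
    moreover have "\<bar>q x\<bar> \<le> 1 * \<bar>G x\<bar>"
      unfolding q_def abs_mult using j1(1,2) by (intro mult_right_mono) (auto simp: J1_def)
    ultimately show "\<bar>q x\<bar> \<le> norm g + e" by simp
    show "\<bar>q x - apply_c0 g x\<bar> \<le> e" if "3 * e \<le> apply_c0 v x"
    proof -
      have "2 \<le> inverse e * V x" using that V_close(1)[of x] e by (simp add: field_simps)
      then show ?thesis using G_close[of x] j1(4) by (simp add: q_def J1_def)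
    qed
  qed
qed

lemma finite_measure_Q: "emeasure lborel Q < \<infinity>"
  using bounded_Q emeasure_bounded_finite by blast

lemma integrable_indicator_Q: "integrable lborel (\<lambda>x. c * indicat_real Q x)"
  using finite_measure_Q open_Q by (intro integrable_mult_right integrable_real_indicator) auto

lemma integral_Q_tendsto:
  fixes s :: "nat \<Rightarrow> 'a \<Rightarrow> real"
  assumes "\<And>n. continuous_on UNIV (s n)" "continuous_on UNIV l" "\<And>x. (\<lambda>n. s n x) \<longlonglongrightarrow> l x"
    and "\<And>n x. x \<in> Q \<Longrightarrow> \<bar>s n x\<bar> \<le> c" "\<And>n x. x \<notin> Q \<Longrightarrow> s n x = 0"
  shows "(\<lambda>n. LINT x|lborel. s n x) \<longlonglongrightarrow> (LINT x|lborel. l x)"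
proof (rule integral_dominated_convergence[where w = "\<lambda>x. c * indicat_real Q x"])
  show "AE x in lborel. norm (s n x) \<le> c * indicat_real Q x" for n
    using assms(4,5) by (intro AE_I2) (auto simp: indicator_def)
  show "integrable lborel (\<lambda>x. c * indicat_real Q x)" by (rule integrable_indicator_Q)
qed (use assms in \<open>auto intro: integrable_indicator_Q borel_measurable_continuous_onI\<close>)

text \<open>Positivity of \<open>v\<close> ties its smallness to that of \<open>u\<close>: the set
  where |u| is at least \<kappa> is compact in \<open>Q\<close>, so \<open>v\<close> has a positive
  minimum on it, and |u| is at most \<kappa> wherever \<open>v\<close> lies below that minimum.
  Truncations of \<open>v\<close> at levels tending to 0 then leave an error of at most
  \<open>\<kappa> * C\<close>, with \<kappa> arbitrary.\<close>

lemma dirichlet_symmetric_pos: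
  assumes uf: "(u, f) \<in> dirichlet_neg_laplacian Q" and vg: "(v, g) \<in> dirichlet_neg_laplacian Q"
    and pos: "\<And>x. x \<in> Q \<Longrightarrow> 0 < apply_c0 v x"
  shows "ip Q f v = ip Q u g"
proof -
  have u: "u \<in> C0 Q" and f: "f \<in> C0 Q" and v: "v \<in> C0 Q" and g: "g \<in> C0 Q"
    using uf vg by (auto simp: dirichlet_neg_laplacian_def)
  have nn: "0 \<le> apply_c0 v x" for x
    using pos[of x] C0_zero[OF v, of x] by (cases "x \<in> Q") auto
  \<comment> \<open>Bounds the integrals of all |q n|, because the levels \<open>e n\<close> are at
    most 1.\<close>
  define C where "C = (norm g + 1) * measure lborel Q"
  have small: "\<exists>N. \<forall>n\<ge>N. \<forall>x\<in>Q. apply_c0 v x \<le> 3 * inverse (Suc n) \<longrightarrow> \<bar>apply_c0 u x\<bar> \<le> \<kappa>" if \<kappa>: "0 < \<kappa>" for \<kappa>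
  proof -
    define L where "L = {x. \<kappa> \<le> \<bar>apply_c0 u x\<bar>}"
    have LQ: "L \<subseteq> Q" using C0_zero[OF u] \<kappa> by (force simp: L_def)
    have L: "compact L"
      unfolding compact_eq_bounded_closed
    proof
      show "bounded L" by (rule bounded_subset[OF bounded_Q LQ])
      show "closed L" unfolding L_def by (intro closed_Collect_le continuous_apply_c0 continuous_intros)
    qed
    have "\<exists>m>0. \<forall>x\<in>L. m \<le> apply_c0 v x"
    proof (cases "L = {}")
      case False
      then obtain x where "x \<in> L" "\<And>y. y \<in> L \<Longrightarrow> apply_c0 v x \<le> apply_c0 v y"
        using continuous_attains_inf[OF L _ continuous_apply_c0] by blast
      then show ?thesis using pos LQ by (intro exI[of _ "apply_c0 v x"]) auto
    qed (auto intro: exI[of _ 1])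
    then obtain m where m: "m > 0" "\<And>x. x \<in> L \<Longrightarrow> m \<le> apply_c0 v x" by blast
    obtain N where N: "inverse (real (Suc N)) < m / 3" using m(1) reals_Archimedean[of "m / 3"] by auto
    have "\<bar>apply_c0 u x\<bar> \<le> \<kappa>" if n: "n \<ge> N" and x: "x \<in> Q" "apply_c0 v x \<le> 3 * inverse (real (Suc n))" for n x
    proof (rule ccontr)
      assume "\<not> \<bar>apply_c0 u x\<bar> \<le> \<kappa>"
      then have "m \<le> apply_c0 v x" by (intro m) (simp add: L_def)
      moreover have "inverse (real (Suc n)) \<le> inverse (real (Suc N))" using n by (intro le_imp_inverse_le) auto
      ultimately show False using x N by linarith
    qed
    then show ?thesis by blast
  qed
  have bound: "\<bar>ip Q f v - ip Q u g\<bar> \<le> \<kappa> * C" if \<kappa>: "0 < \<kappa>" for \<kappa>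
  proof -
    obtain N where N: "\<And>n x. n \<ge> N \<Longrightarrow> x \<in> Q \<Longrightarrow> apply_c0 v x \<le> 3 * inverse (real (Suc n)) \<Longrightarrow> \<bar>apply_c0 u x\<bar> \<le> \<kappa>"
      using small[OF \<kappa>] by blast
    \<comment> \<open>The shift by \<open>N\<close> makes the smallness of \<open>u\<close>
      available at every level of the sequence.\<close>
    define e where "e n = inverse (real (Suc (n + N)))" for n
    have e: "0 < e n" "e n \<le> 1" for n
      by (auto simp: e_def inverse_le_1_iff)
    have e0: "e \<longlonglongrightarrow> 0"
      unfolding e_def by (rule LIMSEQ_ignore_initial_segment[OF LIMSEQ_inverse_real_of_nat])
    define R where "R n p q \<longleftrightarrow> continuous_on UNIV p \<and> continuous_on UNIV q \<and> (\<forall>x. x \<notin> Q \<longrightarrow> p x = 0) \<and> (\<forall>x. x \<notin> Q \<longrightarrow> q x = 0) \<and>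
      (\<forall>x. \<bar>p x - apply_c0 v x\<bar> \<le> 3 * e n) \<and> (\<forall>x. \<bar>q x\<bar> \<le> norm g + e n) \<and>
      (\<forall>x. 3 * e n \<le> apply_c0 v x \<longrightarrow> \<bar>q x - apply_c0 g x\<bar> \<le> e n) \<and>
      \<bar>(LINT x|lborel. apply_c0 f x * p x) - (LINT x|lborel. apply_c0 u x * q x)\<bar> \<le> \<kappa> * (LINT x|lborel. \<bar>q x\<bar>)"
      for n and p q :: "'a \<Rightarrow> real"
    have "\<exists>p q. R n p q" for n
    proof (rule truncation_estimate[OF uf vg e(1)[of n]])
      show "\<bar>apply_c0 u x\<bar> \<le> \<kappa>" if "x \<in> Q" "apply_c0 v x \<le> 3 * e n" for x
        using N[of "n + N" x] that by (simp add: e_def)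
    qed (use \<kappa> in simp, rule nn, unfold R_def, blast)
    then obtain p q where pq: "\<And>n. R n (p n) (q n)" by metis
    have cp: "continuous_on UNIV (p n)" and cq: "continuous_on UNIV (q n)"
      and zp: "x \<notin> Q \<Longrightarrow> p n x = 0" and zq: "x \<notin> Q \<Longrightarrow> q n x = 0"
      and p: "\<bar>p n x - apply_c0 v x\<bar> \<le> 3 * e n" and q: "\<bar>q n x\<bar> \<le> norm g + e n"
      and qg: "3 * e n \<le> apply_c0 v x \<Longrightarrow> \<bar>q n x - apply_c0 g x\<bar> \<le> e n"
      and est: "\<bar>(LINT x|lborel. apply_c0 f x * p n x) - (LINT x|lborel. apply_c0 u x * q n x)\<bar> \<le> \<kappa> * (LINT x|lborel. \<bar>q n x\<bar>)"
      for n x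
      using pq[of n] unfolding R_def by blast+
    have e3: "(\<lambda>n. 3 * e n) \<longlonglongrightarrow> 0" using tendsto_mult_right_zero[OF e0] by simp
    have lp: "(\<lambda>n. p n x) \<longlonglongrightarrow> apply_c0 v x" for x
      by (rule LIM_zero_cancel, rule Lim_null_comparison[OF _ e3]) (use p in auto)
    \<comment> \<open>At a point of \<open>Q\<close> the value of \<open>v\<close> is positive, so
      the levels eventually lie below it and the truncation no longer acts there.\<close>
    have lq: "(\<lambda>n. q n x) \<longlonglongrightarrow> apply_c0 g x" for x
    proof (cases "x \<in> Q")
      case True
      have "\<forall>\<^sub>F n in sequentially. 3 * e n < apply_c0 v x"
        using order_tendstoD(2)[OF e3] pos[OF True] by blast
      then have "\<forall>\<^sub>F n in sequentially. norm (q n x - apply_c0 g x) \<le> e n"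
        by eventually_elim (use qg in auto)
      then show ?thesis by (rule LIM_zero_cancel[OF Lim_null_comparison[OF _ e0]])
    qed (simp add: zq C0_zero[OF g])
    have 1: "(\<lambda>n. LINT x|lborel. apply_c0 f x * p n x) \<longlonglongrightarrow> (LINT x|lborel. apply_c0 f x * apply_c0 v x)"
    proof (rule integral_Q_tendsto[where c = "norm f * (norm v + 3)"])
      fix n x
      have "\<bar>p n x\<bar> \<le> norm v + 3" using p[of n x] norm_c0_bounded[of v x] e(2)[of n] by linarith
      then show "\<bar>apply_c0 f x * p n x\<bar> \<le> norm f * (norm v + 3)"
        unfolding abs_mult by (intro mult_mono norm_c0_bounded) auto
    qed (auto intro!: continuous_intros continuous_apply_c0 cp tendsto_mult tendsto_const lp simp: zp)
    have 2: "(\<lambda>n. LINT x|lborel. apply_c0 u x * q n x) \<longlonglongrightarrow> (LINT x|lborel. apply_c0 u x * apply_c0 g x)"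
    proof (rule integral_Q_tendsto[where c = "norm u * (norm g + 1)"])
      fix n x
      have "\<bar>q n x\<bar> \<le> norm g + 1" using q[of n x] e(2)[of n] by linarith
      then show "\<bar>apply_c0 u x * q n x\<bar> \<le> norm u * (norm g + 1)"
        unfolding abs_mult by (intro mult_mono norm_c0_bounded) auto
    qed (auto intro!: continuous_intros continuous_apply_c0 cq tendsto_mult tendsto_const lq simp: zq)
    have "(LINT x|lborel. \<bar>q n x\<bar>) \<le> C" for n
    proof -
      have "(LINT x|lborel. \<bar>q n x\<bar>) \<le> (LINT x|lborel. (norm g + 1) * indicat_real Q x)"
      proof (rule integral_mono)
        show "integrable lborel (\<lambda>x. \<bar>q n x\<bar>)"
          using integrable_Q[OF cq zq] by (rule integrable_abs)
        show "\<bar>q n x\<bar> \<le> (norm g + 1) * indicat_real Q x" for x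
          using q[of n x] e(2)[of n] zq[of x n] by (cases "x \<in> Q") auto
      qed (rule integrable_indicator_Q)
      then show ?thesis using open_Q by (simp add: C_def)
    qed
    then have "\<bar>(LINT x|lborel. apply_c0 f x * p n x) - (LINT x|lborel. apply_c0 u x * q n x)\<bar> \<le> \<kappa> * C" for n
      using est[of n] \<kappa> by (meson less_imp_le mult_left_mono order_trans)
    then have "\<bar>(LINT x|lborel. apply_c0 f x * apply_c0 v x) - (LINT x|lborel. apply_c0 u x * apply_c0 g x)\<bar> \<le> \<kappa> * C"
      by (intro tendsto_upperbound[OF tendsto_rabs[OF tendsto_diff[OF 1 2]]]) auto
    then show ?thesis by (simp add: ip_C0[OF f] ip_C0[OF u])
  qed
  have "0 \<le> C" by (simp add: C_def)
  have "\<bar>ip Q f v - ip Q u g\<bar> \<le> 0 + \<epsilon>" if "0 < \<epsilon>" for \<epsilon>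
  proof -
    have "\<bar>ip Q f v - ip Q u g\<bar> \<le> \<epsilon> / (C + 1) * C" using that \<open>0 \<le> C\<close> by (intro bound) auto
    also have "\<dots> \<le> \<epsilon>" using that \<open>0 \<le> C\<close> by (simp add: field_simps)
    finally show ?thesis by simp
  qed
  then have "\<bar>ip Q f v - ip Q u g\<bar> \<le> 0" by (rule field_le_epsilon)
  then show ?thesis by simp
qed

section \<open>From positive elements of the domain to the whole space\<close>

lemma exists_positive:
  obtains w where "w \<in> C0 Q" "\<And>x. x \<in> Q \<Longrightarrow> 0 < apply_c0 w x" "\<And>x. 0 \<le> apply_c0 w x"
proof -
  have ne: "- Q \<noteq> {}" using bounded_Q not_bounded_UNIV by (metis compl_bot_eq double_compl)
  define d where "d x = infdist x (- Q)" for x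
  have zero: "d x = 0" if "x \<notin> Q" for x using that by (simp add: d_def)
  have cont: "continuous_on UNIV d" unfolding d_def by (intro continuous_intros)
  obtain b where b: "\<And>x. x \<in> Q \<Longrightarrow> norm x \<le> b"
    using bounded_Q unfolding bounded_iff by blast
  have "\<forall>\<^sub>F x in at_infinity. d x = 0"
    unfolding eventually_at_infinity
    by (intro exI[of _ "b + 1"] allI impI zero) (use b in force)
  then have "(d \<longlongrightarrow> 0) at_infinity" by (rule tendsto_eventually)
  then obtain w where w: "apply_c0 w = d" using c0_of_continuous[OF cont] by blast
  have "0 < d x" if "x \<in> Q" for x
  proof -
    have "closed (- Q)" using open_Q by auto
    then have "d x \<noteq> 0" unfolding d_def using in_closed_iff_infdist_zero[of "- Q" x] ne that by auto
    then show ?thesis using infdist_nonneg[of x "- Q"] by (simp add: d_def)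
  qed
  then show thesis using that[of w] zero w by (auto simp: C0_def d_def infdist_nonneg)
qed

lemma apply_time_average:
  assumes "u \<in> C0 Q" "0 \<le> a"
  shows "apply_c0 (time_average a u) x = integral {0..a} (\<lambda>r. apply_c0 (T r u) x)"
  using integral_linear[OF integrable_continuous_real[OF continuous_on_orbit'[OF assms(1), of 0 a]] bounded_linear_apply_c0, of x]
  by (simp add: time_average_def o_def)

lemma continuous_on_apply_orbit: "u \<in> C0 Q \<Longrightarrow> continuous_on {0..a} (\<lambda>r. apply_c0 (T r u) x)"
  using continuous_on_orbit'[of u 0 a] by (intro bounded_linear.continuous_on[OF bounded_linear_apply_c0]) auto

lemma time_average_nonneg:
  assumes "u \<in> C0 Q" "0 \<le> a" "\<And>x. 0 \<le> apply_c0 u x"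
  shows "0 \<le> apply_c0 (time_average a u) x"
  unfolding apply_time_average[OF assms(1,2)]
  by (intro integral_nonneg integrable_continuous_real continuous_on_apply_orbit assms(1)) (auto intro!: positivity assms)

text \<open>The average over [0, 1] includes time 0, where the integrand is strictly positive; by
  continuity, nonnegativity at the later times is then enough for a positive integral.\<close>

lemma exists_positive_generator:
  obtains w Bw where "(w, Bw) \<in> generator_on (C0 Q) T" "\<And>x. x \<in> Q \<Longrightarrow> 0 < apply_c0 w x"
proof -
  obtain w where w: "w \<in> C0 Q" "\<And>x. x \<in> Q \<Longrightarrow> 0 < apply_c0 w x" "\<And>x. 0 \<le> apply_c0 w x"
    by (rule exists_positive) blast
  have "0 < apply_c0 (time_average 1 w) x" if x: "x \<in> Q" for x
  proof -
    have "integral {0..1} (\<lambda>r. apply_c0 (T r w) x) \<noteq> 0"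
    proof
      assume "integral {0..1} (\<lambda>r. apply_c0 (T r w) x) = 0"
      then have "((\<lambda>r. apply_c0 (T r w) x) has_integral 0) (cbox 0 1)"
        using integrable_integral[OF integrable_continuous_real[OF continuous_on_apply_orbit[OF w(1), where a = 1 and x = x]]] by simp
      then have "apply_c0 (T 0 w) x = 0"
        by (rule has_integral_0_cbox_imp_0[rotated 2])
          (auto intro!: continuous_on_apply_orbit w positivity)
      then show False using w(2)[OF x] S_0[OF w(1)] by simp
    qed
    moreover have "0 \<le> apply_c0 (time_average 1 w) x" by (rule time_average_nonneg) (use w in auto)
    ultimately show ?thesis using apply_time_average[OF w(1), of 1 x] by simp
  qed
  then show thesis using that[OF time_average_generator[OF w(1), of 1]] by simp
qed

lemma generator_add:
  assumes "(u, f) \<in> generator_on (C0 Q) T" "(v, g) \<in> generator_on (C0 Q) T"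
  shows "(u + v, f + g) \<in> generator_on (C0 Q) T"
proof -
  have uv: "u \<in> C0 Q" "v \<in> C0 Q" "f \<in> C0 Q" "g \<in> C0 Q" using assms generator_in_X by blast+
  have "((\<lambda>t. (T t u - u) /\<^sub>R t + (T t v - v) /\<^sub>R t) \<longlongrightarrow> f + g) (at_right 0)"
    using assms by (intro tendsto_add) (auto simp: generator_on_def)
  then have "((\<lambda>t. (T t (u + v) - (u + v)) /\<^sub>R t) \<longlongrightarrow> f + g) (at_right 0)"
    by (rule Lim_transform_eventually)
      (use uv in \<open>auto intro!: eventually_at_rightI[of 0 1] simp: S_add algebra_simps\<close>)
  then show ?thesis using uv by (auto simp: generator_on_def intro!: subspace_add[OF subspace_C0])
qed

sublocale ip: bounded_bilinear "ip Q"
  by (rule bounded_bilinear_ip[OF open_Q bounded_Q])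

text \<open>Adding a strictly positive element reduces the claim to the strictly positive case.\<close>

lemma generator_symmetric:
  assumes u: "(u, f) \<in> generator_on (C0 Q) T" and v: "(v, g) \<in> generator_on (C0 Q) T"
    and nn: "\<And>x. 0 \<le> apply_c0 v x"
  shows "ip Q f v = ip Q u g"
proof -
  obtain w h where w: "(w, h) \<in> generator_on (C0 Q) T" "\<And>x. x \<in> Q \<Longrightarrow> 0 < apply_c0 w x"
    using exists_positive_generator by metis
  have pos: "ip Q f v = ip Q u g"
    if "(v, g) \<in> generator_on (C0 Q) T" "\<And>x. x \<in> Q \<Longrightarrow> 0 < apply_c0 v x" for v g
    using dirichlet_symmetric_pos[OF generatorD[OF u] generatorD[OF that(1)] that(2)]
    by (simp add: ip.minus_left ip.minus_right)
  have "ip Q f (v + w) = ip Q u (g + h)"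
    by (rule pos[OF generator_add[OF v w(1)]]) (use nn w(2) in \<open>auto intro: add_nonneg_pos\<close>)
  then show ?thesis using pos[OF w] by (simp add: ip.add_right)
qed

text \<open>As a function of s, \<open>ip Q (T s u) (T (t - s) v)\<close> is constant, since its two
  derivative terms cancel by symmetry of the generator; the values at the end points are the two
  sides. Nonnegativity of \<open>v\<close> persists along its orbit.\<close>

lemma symmetric_generator:
  assumes u: "(u, f) \<in> generator_on (C0 Q) T" and v: "(v, g) \<in> generator_on (C0 Q) T"
    and nn: "\<And>x. 0 \<le> apply_c0 v x" and t: "0 \<le> t"
  shows "ip Q (T t u) v = ip Q u (T t v)"
proof -
  have vC0: "v \<in> C0 Q" and uC0: "u \<in> C0 Q" using u v generator_in_X by blast+
  have "((\<lambda>s. ip Q (T s u) (T (t - s) v)) has_real_derivative 0) (at s within {0..t})" if s: "s \<in> {0..t}" for s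
  proof -
    have 1: "((\<lambda>s. T s u) has_vector_derivative T s f) (at s within {0..t})"
      using orbit_derivative[OF u, of s] s by (rule_tac has_vector_derivative_within_subset) auto
    have "((\<lambda>r. T r v) has_vector_derivative T (t - s) g) (at (t - s) within (\<lambda>s. t - s) ` {0..t})"
      using orbit_derivative[OF v, of "t - s"] s by (rule_tac has_vector_derivative_within_subset) auto
    moreover have "((\<lambda>s. t - s) has_vector_derivative - 1) (at s within {0..t})"
      by (auto intro!: derivative_eq_intros)
    ultimately have 2: "((\<lambda>s. T (t - s) v) has_vector_derivative - T (t - s) g) (at s within {0..t})"
      using vector_diff_chain_within[of "\<lambda>s. t - s" "- 1" s "{0..t}" "\<lambda>r. T r v" "T (t - s) g"] by (simp add: o_def)
    have "ip Q (T s f) (T (t - s) v) = ip Q (T s u) (T (t - s) g)"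
      using s by (intro generator_symmetric generator_invariant u v positivity vC0 nn) auto
    then show ?thesis
      using ip.has_vector_derivative[OF 1 2] by (simp add: has_real_derivative_iff_has_vector_derivative ip.minus_right)
  qed
  then obtain c where c: "\<And>s. s \<in> {0..t} \<Longrightarrow> ip Q (T s u) (T (t - s) v) = c"
    using has_field_derivative_zero_constant[of "{0..t}" "\<lambda>s. ip Q (T s u) (T (t - s) v)"] by auto
  show ?thesis using c[of 0] c[of t] t by (simp add: S_0 vC0 uC0)
qed

lemma generator_dense_seq:
  assumes u: "u \<in> C0 Q"
  obtains un fn where "\<And>n. (un n, fn n) \<in> generator_on (C0 Q) T" "un \<longlonglongrightarrow> u"
    "(\<And>x. 0 \<le> apply_c0 u x) \<Longrightarrow> (\<And>n x. 0 \<le> apply_c0 (un n) x)"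
proof -
  define a where "a n = inverse (real (Suc n))" for n
  have a: "0 < a n" for n by (simp add: a_def)
  have "filterlim a (at_right 0) sequentially"
    unfolding filterlim_at using LIMSEQ_inverse_real_of_nat a by (auto simp: a_def[abs_def])
  then have lim: "(\<lambda>n. time_average (a n) u /\<^sub>R a n) \<longlonglongrightarrow> u"
    by (rule filterlim_compose[OF time_average_tendsto[OF u]])
  show thesis
    by (rule that[OF generator_scale[OF time_average_generator[OF u less_imp_le[OF a]]] lim])
      (use a time_average_nonneg[OF u less_imp_le[OF a]] in \<open>auto intro!: mult_nonneg_nonneg less_imp_le[OF a]\<close>)
qed

lemma T_tendsto:
  assumes "\<And>n. un n \<in> C0 Q" "u \<in> C0 Q" "un \<longlonglongrightarrow> u" "0 \<le> t"
  shows "(\<lambda>n. T t (un n)) \<longlonglongrightarrow> T t u"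
proof (rule LIM_zero_cancel, rule Lim_null_comparison)
  show "\<forall>\<^sub>F n in sequentially. norm (T t (un n) - T t u) \<le> norm (un n - u)"
    using contraction[OF subspace_diff[OF subspace_C0 assms(1,2)] assms(4)] S_diff[OF assms(4) assms(1,2)] by simp
  show "(\<lambda>n. norm (un n - u)) \<longlonglongrightarrow> 0"
    using assms(3) by (simp add: tendsto_norm_zero_iff LIM_zero_iff)
qed

lemma symmetric_nonneg:
  assumes u: "u \<in> C0 Q" and v: "v \<in> C0 Q" and nn: "\<And>x. 0 \<le> apply_c0 v x" and t: "0 \<le> t"
  shows "ip Q (T t u) v = ip Q u (T t v)"
proof -
  obtain un fn where un: "\<And>n. (un n, fn n) \<in> generator_on (C0 Q) T" "un \<longlonglongrightarrow> u"
    by (rule generator_dense_seq[OF u]) blast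
  obtain vn gn where vn: "\<And>n. (vn n, gn n) \<in> generator_on (C0 Q) T" "vn \<longlonglongrightarrow> v" "\<And>n x. 0 \<le> apply_c0 (vn n) x"
    by (rule generator_dense_seq[OF v]) (use nn in blast)
  have uX: "un n \<in> C0 Q" and vX: "vn n \<in> C0 Q" for n using un(1) vn(1) generator_in_X by blast+
  have "(\<lambda>n. ip Q (T t (un n)) (vn n)) \<longlonglongrightarrow> ip Q (T t u) v"
    by (intro ip.tendsto T_tendsto uX u un t vn)
  moreover have "(\<lambda>n. ip Q (T t (un n)) (vn n)) = (\<lambda>n. ip Q (un n) (T t (vn n)))"
    using symmetric_generator[OF un(1) vn(1,3) t] by simp
  moreover have "(\<lambda>n. ip Q (un n) (T t (vn n))) \<longlonglongrightarrow> ip Q u (T t v)"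
    by (intro ip.tendsto T_tendsto vX v un t vn)
  ultimately show ?thesis using LIMSEQ_unique by metis
qed

lemma pos_part_C0:
  assumes u: "u \<in> C0 Q"
  obtains p where "p \<in> C0 Q" "\<And>x. apply_c0 p x = max 0 (apply_c0 u x)"
proof -
  have "((\<lambda>x. max 0 (apply_c0 u x)) \<longlongrightarrow> max 0 0) at_infinity"
    by (intro tendsto_max tendsto_const tendsto_apply_c0)
  then have lim: "((\<lambda>x. max 0 (apply_c0 u x)) \<longlongrightarrow> 0) at_infinity" by simp
  have "continuous_on UNIV (\<lambda>x. max 0 (apply_c0 u x))"
    by (intro continuous_on_max continuous_on_const continuous_apply_c0)
  then obtain p where "apply_c0 p = (\<lambda>x. max 0 (apply_c0 u x))"
    using c0_of_continuous[OF _ lim] by blast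
  then show thesis using that[of p] C0_zero[OF u] by (auto simp: C0_def)
qed

lemma symmetric:
  assumes u: "u \<in> C0 Q" and v: "v \<in> C0 Q" and t: "0 \<le> t"
  shows "ip Q (T t u) v = ip Q u (T t v)"
proof -
  obtain p where p: "p \<in> C0 Q" "\<And>x. apply_c0 p x = max 0 (apply_c0 v x)"
    by (rule pos_part_C0[OF v]) blast
  obtain m where m: "m \<in> C0 Q" "\<And>x. apply_c0 m x = max 0 (apply_c0 (- v) x)"
    by (rule pos_part_C0[OF subspace_neg[OF subspace_C0 v]]) blast
  have eq: "v = p - m" by (rule c0_eqI) (simp add: p m)
  have "ip Q (T t u) p = ip Q u (T t p)" "ip Q (T t u) m = ip Q u (T t m)"
    by (intro symmetric_nonneg u p t m; simp add: p m)+
  then show ?thesis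
    unfolding eq using S_diff[OF t p(1) m(1)] by (simp add: ip.diff_right)
qed

end

section \<open>Compactness and the decay rate\<close>

lemma quadratic_nonneg_discriminant:
  fixes a b c :: real
  assumes a0: "0 \<le> a" and "\<And>s. 0 \<le> a * s\<^sup>2 - 2 * b * s + c"
  shows "b\<^sup>2 \<le> a * c"
proof (cases "a = 0")
  case True
  have "b = 0"
  proof (rule ccontr)
    assume "b \<noteq> 0"
    \<comment> \<open>At this point the affine function takes the value -1.\<close>
    then show False using assms(2)[of "(c + 1) / (2 * b)"] True by simp
  qed
  then show ?thesis using True by simp
next
  case False
  then have a: "0 < a" using a0 by simp
  have "a * (b / a)\<^sup>2 - 2 * b * (b / a) + c = c - b\<^sup>2 / a"
    using False by (simp add: field_simps power2_eq_square)
  then have "b\<^sup>2 / a \<le> c" using assms(2)[of "b / a"] by simp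
  then show ?thesis using a by (simp add: field_simps)
qed

context dirichlet_semigroup
begin

abbreviation q :: "'a c0 \<Rightarrow> real" where "q u \<equiv> ip Q u u"

lemma q_diff: "q (u - s *\<^sub>R v) = q v * s\<^sup>2 - 2 * ip Q u v * s + q u"
  by (simp add: ip.diff_left ip.diff_right ip.scaleR_left ip.scaleR_right ip_commute[of Q v u] power2_eq_square
      right_diff_distrib mult.left_commute)

lemma ip_Cauchy_Schwarz: "(ip Q u v)\<^sup>2 \<le> q v * q u"
  by (rule quadratic_nonneg_discriminant[OF ip_nonneg]) (use ip_nonneg[of Q "u - s *\<^sub>R v" for s] in \<open>simp add: q_diff\<close>)

lemma q_scale: "q (s *\<^sub>R u) = s\<^sup>2 * q u"
  by (simp add: ip.scaleR_left ip.scaleR_right power2_eq_square)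

lemma q_zero_imp:
  assumes "u \<in> C0 Q" "q u = 0"
  shows "u = 0"
proof (rule c0_eqI)
  fix x
  have "apply_c0 u x * apply_c0 u x = 0"
  proof (rule continuous_nonneg_integral_zero[where f = "\<lambda>x. apply_c0 u x * apply_c0 u x"])
    show c: "continuous_on UNIV (\<lambda>x. apply_c0 u x * apply_c0 u x)"
      by (intro continuous_intros continuous_apply_c0)
    show "integrable lborel (\<lambda>x. apply_c0 u x * apply_c0 u x)"
      by (rule integrable_Q[OF c]) (simp add: C0_zero[OF assms(1)])
    show "(LINT x|lborel. apply_c0 u x * apply_c0 u x) = 0"
      using assms(2) ip_C0[OF assms(1), of u] by simp
  qed simp
  then show "apply_c0 u x = apply_c0 0 x" by simp
qed

lemma q_le_norm: "u \<in> C0 Q \<Longrightarrow> q u \<le> measure lborel Q * (norm u)\<^sup>2"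
proof -
  assume u: "u \<in> C0 Q"
  have c: "continuous_on UNIV (\<lambda>x. apply_c0 u x * apply_c0 u x)"
    by (intro continuous_intros continuous_apply_c0)
  have "q u \<le> (LINT x|lborel. (norm u)\<^sup>2 * indicat_real Q x)"
    unfolding ip_C0[OF u]
  proof (rule integral_mono[OF integrable_Q[OF c] integrable_indicator_Q])
    show "apply_c0 u x * apply_c0 u x \<le> (norm u)\<^sup>2 * indicat_real Q x" for x
      using C0_zero[OF u, of x] power_mono[OF norm_c0_bounded[of u x], of 2]
      by (cases "x \<in> Q") (auto simp: power2_eq_square)
  qed (simp add: C0_zero[OF u])
  then show ?thesis using open_Q by (simp add: mult.commute)
qed

text \<open>Cauchy-Schwarz against the indicator of \<open>Q\<close>, which in general is no element
  of \<open>C0 Q\<close>; hence the discriminant argument is applied directly to the integral of (s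
  |u| - 1)^2 over \<open>Q\<close>.\<close>

lemma L1_le_L2:
  assumes u: "u \<in> C0 Q"
  shows "(LINT x|lborel. \<bar>apply_c0 u x\<bar>)\<^sup>2 \<le> q u * measure lborel Q"
proof (rule quadratic_nonneg_discriminant[OF ip_nonneg])
  fix s
  have c: "continuous_on UNIV (\<lambda>x. apply_c0 u x * apply_c0 u x)"
    by (intro continuous_intros continuous_apply_c0)
  have z: "apply_c0 u x * apply_c0 u x = 0" if "x \<notin> Q" for x using C0_zero[OF u that] by simp
  have i1: "integrable lborel (\<lambda>x. s\<^sup>2 * (apply_c0 u x * apply_c0 u x))"
    by (intro integrable_mult_right integrable_Q[OF c] z)
  have i2: "integrable lborel (\<lambda>x. 2 * s * \<bar>apply_c0 u x\<bar>)"
    by (intro integrable_mult_right integrable_abs_C0[OF u])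
  have "0 \<le> (LINT x|lborel. (s\<^sup>2 * (apply_c0 u x * apply_c0 u x) - 2 * s * \<bar>apply_c0 u x\<bar>) + 1 * indicat_real Q x)"
  proof (rule integral_nonneg_AE[OF AE_I2])
    fix x
    have "s\<^sup>2 * (y * y) - 2 * s * \<bar>y\<bar> + 1 = (s * \<bar>y\<bar> - 1)\<^sup>2" for y :: real
      by (simp add: power2_eq_square algebra_simps)
    then show "0 \<le> (s\<^sup>2 * (apply_c0 u x * apply_c0 u x) - 2 * s * \<bar>apply_c0 u x\<bar>) + 1 * indicat_real Q x"
      using C0_zero[OF u, of x] by (cases "x \<in> Q") auto
  qed
  also have "\<dots> = (LINT x|lborel. s\<^sup>2 * (apply_c0 u x * apply_c0 u x)) - (LINT x|lborel. 2 * s * \<bar>apply_c0 u x\<bar>) + (LINT x|lborel. 1 * indicat_real Q x)"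
    by (subst Bochner_Integration.integral_add[OF Bochner_Integration.integrable_diff[OF i1 i2] integrable_indicator_Q],
        subst Bochner_Integration.integral_diff[OF i1 i2]) (rule refl)
  also have "\<dots> = q u * s\<^sup>2 - 2 * (LINT x|lborel. \<bar>apply_c0 u x\<bar>) * s + measure lborel Q"
    using open_Q by (simp add: ip_C0[OF u])
  finally show "0 \<le> q u * s\<^sup>2 - 2 * (LINT x|lborel. \<bar>apply_c0 u x\<bar>) * s + measure lborel Q" .
qed

lemma L2_Linf:
  assumes t: "0 < t"
  obtains C where "0 < C" "\<And>u. u \<in> C0 Q \<Longrightarrow> norm (T t u) \<le> C * sqrt (q u)"
proof -
  obtain C where C: "0 < C" "\<And>u. u \<in> C0 Q \<Longrightarrow> norm (T t u) \<le> C * (LINT y|lborel. \<bar>apply_c0 u y\<bar>)"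
    using ultracontractive[OF t] by metis
  show thesis
  proof
    \<comment> \<open>The summand 1 keeps the constant positive when \<open>Q\<close> has measure
      zero.\<close>
    show "0 < C * sqrt (measure lborel Q) + 1" using C(1) by (intro add_nonneg_pos) auto
    fix u assume u: "u \<in> C0 Q"
    have "(LINT y|lborel. \<bar>apply_c0 u y\<bar>) \<le> sqrt (q u) * sqrt (measure lborel Q)"
      unfolding real_sqrt_mult[symmetric] by (intro real_le_rsqrt L1_le_L2 u)
    then have "norm (T t u) \<le> C * (sqrt (q u) * sqrt (measure lborel Q))"
      using C(2)[OF u] C(1) by (meson less_imp_le mult_left_mono order_trans)
    also have "\<dots> \<le> (C * sqrt (measure lborel Q) + 1) * sqrt (q u)"
      using ip_nonneg[of Q u] by (simp add: algebra_simps)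
    finally show "norm (T t u) \<le> (C * sqrt (measure lborel Q) + 1) * sqrt (q u)" .
  qed
qed

section \<open>From almost everywhere convergence to norm convergence\<close>

lemma measure_space_Q: "emeasure (lebesgue_on Q) (space (lebesgue_on Q)) < \<infinity>"
  using finite_measure_Q open_Q by (simp add: emeasure_restrict_space)

lemma C0_measurable_on: "apply_c0 u \<in> borel_measurable (lebesgue_on Q)"
  using open_Q continuous_apply_c0 by (intro continuous_imp_measurable_on_sets_lebesgue) auto

lemma integral_C0_lebesgue_on:
  assumes "u \<in> C0 Q"
  shows "(LINT x|lborel. \<bar>apply_c0 u x\<bar>) = (LINT x|lebesgue_on Q. \<bar>apply_c0 u x\<bar>)"
proof -
  have m: "(\<lambda>x. \<bar>apply_c0 u x\<bar>) \<in> borel_measurable lborel"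
    using borel_measurable_continuous_onI[OF continuous_apply_c0[of UNIV u]] by simp
  have "(LINT x|lebesgue_on Q. \<bar>apply_c0 u x\<bar>) = (LINT x|lebesgue. indicator Q x *\<^sub>R \<bar>apply_c0 u x\<bar>)"
    using open_Q by (intro integral_restrict_space) auto
  also have "\<dots> = (LINT x|lebesgue. \<bar>apply_c0 u x\<bar>)"
    by (intro Bochner_Integration.integral_cong) (auto simp: indicator_def C0_zero[OF assms])
  also have "\<dots> = (LINT x|lborel. \<bar>apply_c0 u x\<bar>)"
    by (rule integral_completion[OF m])
  finally show ?thesis by simp
qed

lemma T_diff_L1:
  assumes t: "0 < t"
  obtains C where "0 < C" "\<And>u v. u \<in> C0 Q \<Longrightarrow> v \<in> C0 Q \<Longrightarrow>
    norm (T t u - T t v) \<le> C * (LINT x|lebesgue_on Q. \<bar>apply_c0 u x - apply_c0 v x\<bar>)"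
proof -
  obtain C where C: "0 < C" "\<And>u. u \<in> C0 Q \<Longrightarrow> norm (T t u) \<le> C * (LINT y|lborel. \<bar>apply_c0 u y\<bar>)"
    using ultracontractive[OF t] by metis
  show thesis
  proof (rule that[OF C(1)])
    fix u v assume u: "u \<in> C0 Q" and v: "v \<in> C0 Q"
    show "norm (T t u - T t v) \<le> C * (LINT x|lebesgue_on Q. \<bar>apply_c0 u x - apply_c0 v x\<bar>)"
      using C(2)[OF subspace_diff[OF subspace_C0 u v]] integral_C0_lebesgue_on[OF subspace_diff[OF subspace_C0 u v]]
        S_diff[of t u v] t u v by simp
  qed
qed

lemma L1_convergence:
  assumes h: "\<And>k. h k \<in> C0 Q" "\<And>k x. \<bar>apply_c0 (h k) x\<bar> \<le> B"
    and l: "l \<in> borel_measurable (lebesgue_on Q)" "AE x in lebesgue_on Q. (\<lambda>k. apply_c0 (h k) x) \<longlonglongrightarrow> l x"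
  shows "(\<lambda>k. LINT x|lebesgue_on Q. \<bar>apply_c0 (h k) x - l x\<bar>) \<longlonglongrightarrow> 0"
    and "\<And>k. integrable (lebesgue_on Q) (\<lambda>x. \<bar>apply_c0 (h k) x - l x\<bar>)"
proof -
  have B: "AE x in lebesgue_on Q. \<bar>apply_c0 (h k) x - l x\<bar> \<le> 2 * B" for k
    using l(2)
  proof eventually_elim
    case (elim x)
    have "\<bar>l x\<bar> \<le> B"
      by (rule tendsto_upperbound[OF tendsto_rabs[OF elim]]) (use h(2) in auto)
    then show ?case using h(2)[of k x] by linarith
  qed
  have m: "(\<lambda>x. \<bar>apply_c0 (h k) x - l x\<bar>) \<in> borel_measurable (lebesgue_on Q)" for k
    using C0_measurable_on[of "h k"] l(1) by measurable
  have c: "integrable (lebesgue_on Q) (\<lambda>_. 2 * B)"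
    using measure_space_Q by (intro finite_measure.integrable_const finite_measureI) auto
  show "integrable (lebesgue_on Q) (\<lambda>x. \<bar>apply_c0 (h k) x - l x\<bar>)" for k
    by (rule Bochner_Integration.integrable_bound[OF c m]) (use B[of k] in \<open>auto elim!: eventually_mono\<close>)
  have "(\<lambda>k. LINT x|lebesgue_on Q. \<bar>apply_c0 (h k) x - l x\<bar>) \<longlonglongrightarrow> (LINT x|lebesgue_on Q. 0)"
  proof (rule integral_dominated_convergence[OF _ m c])
    show "AE x in lebesgue_on Q. (\<lambda>k. \<bar>apply_c0 (h k) x - l x\<bar>) \<longlonglongrightarrow> 0"
      using l(2) by eventually_elim (simp add: tendsto_rabs_zero LIM_zero)
    show "AE x in lebesgue_on Q. norm \<bar>apply_c0 (h k) x - l x\<bar> \<le> 2 * B" for k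
      using B[of k] by simp
  qed simp
  then show "(\<lambda>k. LINT x|lebesgue_on Q. \<bar>apply_c0 (h k) x - l x\<bar>) \<longlonglongrightarrow> 0" by simp
qed

text \<open>On a set of finite measure, bounded almost everywhere convergence is convergence in L1,
  and \<open>T t\<close> maps L1-Cauchy sequences to norm-Cauchy ones. As \<open>l\<close> need not
  be continuous, only the images have a limit in \<open>C0 Q\<close>.\<close>

lemma smoothing_Cauchy:
  assumes t: "0 < t" and h: "\<And>k. h k \<in> C0 Q" "\<And>k x. \<bar>apply_c0 (h k) x\<bar> \<le> B"
    and l: "l \<in> borel_measurable (lebesgue_on Q)" "AE x in lebesgue_on Q. (\<lambda>k. apply_c0 (h k) x) \<longlonglongrightarrow> l x"
  obtains w where "w \<in> C0 Q" "(\<lambda>k. T t (h k)) \<longlonglongrightarrow> w"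
proof -
  obtain C where C: "0 < C" "\<And>u v. u \<in> C0 Q \<Longrightarrow> v \<in> C0 Q \<Longrightarrow>
    norm (T t u - T t v) \<le> C * (LINT x|lebesgue_on Q. \<bar>apply_c0 u x - apply_c0 v x\<bar>)"
    using T_diff_L1[OF t] by metis
  define a where "a k = (LINT x|lebesgue_on Q. \<bar>apply_c0 (h k) x - l x\<bar>)" for k
  have a0: "(\<lambda>k. C * a k) \<longlonglongrightarrow> 0"
    unfolding a_def by (intro tendsto_mult_right_zero L1_convergence(1)[OF h l])
  note i = L1_convergence(2)[OF h l]
  have ih: "integrable (lebesgue_on Q) (\<lambda>x. \<bar>apply_c0 (h k) x - apply_c0 (h m) x\<bar>)" for k m
  proof (rule Bochner_Integration.integrable_bound[OF Bochner_Integration.integrable_add[OF i[of k] i[of m]]])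
    show "(\<lambda>x. \<bar>apply_c0 (h k) x - apply_c0 (h m) x\<bar>) \<in> borel_measurable (lebesgue_on Q)"
      using C0_measurable_on[of "h k"] C0_measurable_on[of "h m"] by measurable
  qed auto
  have le: "norm (T t (h k) - T t (h m)) \<le> C * a k + C * a m" for k m
  proof -
    have "(LINT x|lebesgue_on Q. \<bar>apply_c0 (h k) x - apply_c0 (h m) x\<bar>) \<le>
        (LINT x|lebesgue_on Q. \<bar>apply_c0 (h k) x - l x\<bar> + \<bar>apply_c0 (h m) x - l x\<bar>)"
      by (intro integral_mono ih Bochner_Integration.integrable_add i) linarith
    also have "\<dots> = a k + a m" unfolding a_def by (rule Bochner_Integration.integral_add[OF i i])
    finally have "C * (LINT x|lebesgue_on Q. \<bar>apply_c0 (h k) x - apply_c0 (h m) x\<bar>) \<le> C * (a k + a m)"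
      using C(1) by simp
    then show ?thesis using C(2)[OF h(1) h(1), of k m] by (simp add: distrib_left)
  qed
  have "Cauchy (\<lambda>k. T t (h k))"
  proof (rule CauchyI)
    fix e :: real assume "0 < e"
    then obtain N where N: "\<And>k. k \<ge> N \<Longrightarrow> C * a k < e / 2"
      using order_tendstoD(2)[OF a0, of "e / 2"] by (auto simp: eventually_sequentially)
    have "norm (T t (h k) - T t (h m)) < e" if "k \<ge> N" "m \<ge> N" for k m
      using le[of k m] N[OF that(1)] N[OF that(2)] by linarith
    then show "\<exists>M. \<forall>m\<ge>M. \<forall>n\<ge>M. norm (T t (h m) - T t (h n)) < e" by blast
  qed
  then obtain w where w: "(\<lambda>k. T t (h k)) \<longlonglongrightarrow> w" using Cauchy_convergent convergent_def by blast
  moreover have "w \<in> C0 Q"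
    by (rule closed_sequentially[OF closed_C0 _ w]) (use t h in \<open>auto intro: in_X\<close>)
  ultimately show thesis using that by blast
qed

text \<open>An almost minimiser of \<open>q u - 2 * l u\<close> almost represents \<open>l\<close>.\<close>

lemma approximate_Riesz:
  assumes l: "linear_on_subspace (C0 Q) l" and C: "\<And>u. u \<in> C0 Q \<Longrightarrow> \<bar>l u\<bar> \<le> C * sqrt (q u)" and \<epsilon>: "0 < \<epsilon>"
  obtains e where "e \<in> C0 Q" "\<And>u. u \<in> C0 Q \<Longrightarrow> \<bar>l u - ip Q u e\<bar> \<le> \<epsilon> * sqrt (q u)"
proof -
  interpret linear_on_subspace "C0 Q" l by (rule l)
  define J where "J u = q u - 2 * l u" for u
  define E where "E = J ` C0 Q"
  have "- C\<^sup>2 \<le> J u" if u: "u \<in> C0 Q" for u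
  proof -
    have "0 \<le> (sqrt (q u) - C)\<^sup>2" by simp
    then have "2 * (C * sqrt (q u)) \<le> q u + C\<^sup>2" using ip_nonneg[of Q u] by (simp add: power2_diff mult_ac)
    then show ?thesis using C[OF u] unfolding J_def by linarith
  qed
  then have bE: "bdd_below E" unfolding E_def by (auto intro!: bdd_belowI)
  have neE: "E \<noteq> {}" using subspace_0[OF subspace_C0] by (auto simp: E_def)
  \<comment> \<open>In the L2 norm \<open>C0 Q\<close> is in general not complete, so the infimum
    need not be attained. The slack \<epsilon>^2 becomes the constant term of the
    discriminant.\<close>
  have "Inf E < Inf E + \<epsilon>\<^sup>2" using \<epsilon> by simp
  then obtain y where "y \<in> E" "y < Inf E + \<epsilon>\<^sup>2"
    using cInf_less_iff[OF neE bE] by blast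
  then obtain e where e: "e \<in> C0 Q" "J e < Inf E + \<epsilon>\<^sup>2"
    unfolding E_def by blast
  show thesis
  proof (rule that[OF e(1)])
    fix u assume u: "u \<in> C0 Q"
    have "(l u - ip Q u e)\<^sup>2 \<le> q u * \<epsilon>\<^sup>2"
    proof (rule quadratic_nonneg_discriminant[OF ip_nonneg])
      fix s
      have "e + s *\<^sub>R u \<in> C0 Q" by (intro subspace_add[OF subspace_C0] subspace_scale[OF subspace_C0] e u)
      then have "Inf E \<le> J (e + s *\<^sub>R u)" by (intro cInf_lower bE) (auto simp: E_def)
      also have "\<dots> = J e - 2 * (l u - ip Q u e) * s + q u * s\<^sup>2"
        using add[OF e(1) subspace_scale[OF subspace_C0 u, of s]] scale[OF u, of s]
        by (simp add: J_def ip.add_left ip.add_right ip.scaleR_left ip.scaleR_right ip_commute[of Q e u] power2_eq_square algebra_simps)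
      finally show "0 \<le> q u * s\<^sup>2 - 2 * (l u - ip Q u e) * s + \<epsilon>\<^sup>2" using e(2) by linarith
    qed
    then have "sqrt ((l u - ip Q u e)\<^sup>2) \<le> sqrt (q u * \<epsilon>\<^sup>2)" by (rule real_sqrt_le_mono)
    then show "\<bar>l u - ip Q u e\<bar> \<le> \<epsilon> * sqrt (q u)"
      using \<epsilon> by (simp add: real_sqrt_mult mult.commute)
  qed
qed

text \<open>Diagonal argument over a countable set that is dense in the supremum norm, which
  controls the L2 norm up to the constant \<open>m\<close>. Only the Cauchy property is claimed,
  since a weak limit may lie outside \<open>C0 Q\<close>.\<close>

lemma weak_subsequence:
  assumes f: "\<And>k. f k \<in> C0 Q" "\<And>k. q (f k) \<le> 1"
  obtains r where "strict_mono (r :: nat \<Rightarrow> nat)" "\<And>v. v \<in> C0 Q \<Longrightarrow> Cauchy (\<lambda>k. ip Q (f (r k)) v)"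
proof -
  obtain D where D: "countable D" "D \<subseteq> C0 Q" "C0 Q \<subseteq> closure D"
    using separable[of "C0 Q"] by metis
  have "0 \<in> closure D" using D(3) subspace_0[OF subspace_C0, of Q] by blast
  then have "D \<noteq> {}" by auto
  define d where "d = from_nat_into D"
  have d: "range d = D" using D(1) \<open>D \<noteq> {}\<close> by (simp add: d_def)
  have bnd: "\<bar>ip Q (f k) v\<bar> \<le> sqrt (q v)" for k v
  proof -
    have "(ip Q (f k) v)\<^sup>2 \<le> q v * 1"
      using ip_Cauchy_Schwarz[of "f k" v] f(2)[of k] mult_left_mono[OF f(2)[of k] ip_nonneg[of Q v]] by linarith
    then show ?thesis by (simp add: real_le_rsqrt)
  qed
  interpret subseqs "\<lambda>n s. convergent (\<lambda>k. ip Q (f (s k)) (d n))"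
  proof
    fix n and s :: "nat \<Rightarrow> nat"
    have "bounded (range (\<lambda>k. ip Q (f (s k)) (d n)))"
      unfolding bounded_iff using bnd by (intro exI[of _ "sqrt (q (d n))"]) auto
    then obtain l r where "strict_mono r" "((\<lambda>k. ip Q (f (s k)) (d n)) \<circ> r) \<longlonglongrightarrow> l"
      using bounded_imp_convergent_subsequence by metis
    then show "\<exists>r'. strict_mono r' \<and> convergent (\<lambda>k. ip Q (f ((s \<circ> r') k)) (d n))"
      by (auto simp: o_def convergent_def)
  qed
  define r where "r = diagseq"
  have conv: "convergent (\<lambda>k. ip Q (f (r k)) (d n))" for n
  proof -
    \<comment> \<open>Only from index \<open>Suc n\<close> on is the diagonal sequence a subsequence
      of the one chosen for \<open>d n\<close>.\<close>
    have "convergent (\<lambda>k. ip Q (f ((diagseq \<circ> (+) (Suc n)) k)) (d n))"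
    proof (rule diagseq_holds)
      fix r' s :: "nat \<Rightarrow> nat" and n assume "strict_mono r'" "convergent (\<lambda>k. ip Q (f (s k)) (d n))"
      then show "convergent (\<lambda>k. ip Q (f ((s \<circ> r') k)) (d n))"
        using convergent_subseq_convergent[of "\<lambda>k. ip Q (f (s k)) (d n)" r'] by (simp add: o_def)
    qed
    then have "convergent (\<lambda>k. ip Q (f (r (k + Suc n))) (d n))" by (simp add: r_def o_def add.commute)
    then show ?thesis by (subst (asm) convergent_ignore_initial_segment)
  qed
  show thesis
  proof (rule that)
    show "strict_mono r" unfolding r_def by (rule subseq_diagseq)
    fix v assume v: "v \<in> C0 Q"
    show "Cauchy (\<lambda>k. ip Q (f (r k)) v)"
    proof (rule CauchyI)
      fix e :: real assume e: "0 < e"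
      define m where "m = sqrt (measure lborel Q) + 1"
      have m: "0 < m" by (simp add: m_def add_nonneg_pos)
      obtain w where w: "w \<in> D" "dist w v < e / (3 * m)"
        using D(3) v e m unfolding closure_approachable by (metis closure_approachable divide_pos_pos mult_pos_pos subsetD zero_less_numeral)
      then obtain n where n: "w = d n" using d by blast
      have wX: "w \<in> C0 Q" using w D by blast
      obtain N where N: "\<And>k k'. k \<ge> N \<Longrightarrow> k' \<ge> N \<Longrightarrow> norm (ip Q (f (r k)) w - ip Q (f (r k')) w) < e / 3"
        using convergent_Cauchy[OF conv[of n]] e unfolding n by (metis CauchyD divide_pos_pos zero_less_numeral)
      have near: "\<bar>ip Q (f k) v - ip Q (f k) w\<bar> < e / 3" for k
      proof -
        have "\<bar>ip Q (f k) v - ip Q (f k) w\<bar> \<le> sqrt (q (v - w))"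
          using bnd[of k "v - w"] by (simp add: ip.diff_right)
        also have "\<dots> \<le> sqrt (measure lborel Q * (norm (v - w))\<^sup>2)"
          by (intro real_sqrt_le_mono q_le_norm subspace_diff[OF subspace_C0] v wX)
        also have "\<dots> = sqrt (measure lborel Q) * norm (v - w)" by (simp add: real_sqrt_mult)
        also have "\<dots> \<le> m * norm (v - w)" by (intro mult_right_mono) (auto simp: m_def)
        also have "\<dots> < m * (e / (3 * m))" using w(2) m by (intro mult_strict_left_mono) (auto simp: dist_norm norm_minus_commute)
        also have "\<dots> = e / 3" using m by simp
        finally show ?thesis .
      qed
      have "norm (ip Q (f (r k)) v - ip Q (f (r k')) v) < e" if "k \<ge> N" "k' \<ge> N" for k k'
        using near[of "r k"] near[of "r k'"] N[OF that] unfolding real_norm_def by linarith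
      then show "\<exists>M. \<forall>m\<ge>M. \<forall>n\<ge>M. norm (ip Q (f (r m)) v - ip Q (f (r n)) v) < e" by blast
    qed
  qed
qed

lemma linear_on_apply: "0 \<le> t \<Longrightarrow> linear_on_subspace (C0 Q) (\<lambda>u. apply_c0 (T t u) x)"
  using linear_on[of t] by (simp add: linear_on_subspace_def)

text \<open>One unit of time turns weak into pointwise convergence, because evaluation after
  \<open>T 1\<close> is nearly an inner product; a second unit turns bounded pointwise into norm
  convergence by smoothing. Hence the time 2.\<close>

lemma compactness:
  assumes f: "\<And>k. f k \<in> C0 Q" "\<And>k. q (f k) \<le> 1"
  obtains r g where "strict_mono (r :: nat \<Rightarrow> nat)" "g \<in> C0 Q" "(\<lambda>k. T 2 (f (r k))) \<longlonglongrightarrow> g"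
proof -
  obtain r where r: "strict_mono (r :: nat \<Rightarrow> nat)" "\<And>v. v \<in> C0 Q \<Longrightarrow> Cauchy (\<lambda>k. ip Q (f (r k)) v)"
    by (rule weak_subsequence[of f, OF f]) blast
  obtain C where C: "0 < C" "\<And>u. u \<in> C0 Q \<Longrightarrow> norm (T 1 u) \<le> C * sqrt (q u)"
    by (rule L2_Linf[OF zero_less_one]) blast
  define h where "h k = T 1 (f (r k))" for k
  have h: "h k \<in> C0 Q" for k using f by (simp add: h_def in_X)
  have "Cauchy (\<lambda>k. apply_c0 (h k) x)" for x
  proof (rule CauchyI)
    fix e :: real assume e: "0 < e"
    obtain w where w: "w \<in> C0 Q" "\<And>u. u \<in> C0 Q \<Longrightarrow> \<bar>apply_c0 (T 1 u) x - ip Q u w\<bar> \<le> e / 4 * sqrt (q u)"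
    proof (rule approximate_Riesz[OF linear_on_apply[of 1 x], of C "e / 4"])
      show "\<bar>apply_c0 (T 1 u) x\<bar> \<le> C * sqrt (q u)" if "u \<in> C0 Q" for u
        using C(2)[OF that] norm_c0_bounded[of "T 1 u" x] by linarith
    qed (use e in auto)
    have near: "\<bar>apply_c0 (h k) x - ip Q (f (r k)) w\<bar> \<le> e / 4" for k
    proof -
      have "e / 4 * sqrt (q (f (r k))) \<le> e / 4 * 1" using f(2)[of "r k"] e by (intro mult_left_mono) auto
      then show ?thesis using w(2)[OF f(1)[of "r k"]] by (simp add: h_def)
    qed
    obtain N where N: "\<And>k k'. k \<ge> N \<Longrightarrow> k' \<ge> N \<Longrightarrow> norm (ip Q (f (r k)) w - ip Q (f (r k')) w) < e / 2"
      using r(2)[OF w(1)] e by (metis CauchyD half_gt_zero)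
    have "norm (apply_c0 (h k) x - apply_c0 (h k') x) < e" if "k \<ge> N" "k' \<ge> N" for k k'
      using near[of k] near[of k'] N[OF that] unfolding real_norm_def by linarith
    then show "\<exists>M. \<forall>m\<ge>M. \<forall>n\<ge>M. norm (apply_c0 (h m) x - apply_c0 (h n) x) < e" by blast
  qed
  then have "convergent (\<lambda>k. apply_c0 (h k) x)" for x by (rule Cauchy_convergent)
  then obtain l where l: "\<And>x. (\<lambda>k. apply_c0 (h k) x) \<longlonglongrightarrow> l x" unfolding convergent_def by metis
  have hC: "\<bar>apply_c0 (h k) x\<bar> \<le> C" for k x
  proof -
    have "norm (h k) \<le> C * sqrt (q (f (r k)))" unfolding h_def by (rule C(2)[OF f(1)])
    also have "\<dots> \<le> C * 1" using f(2)[of "r k"] C(1) by (intro mult_left_mono) auto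
    finally show ?thesis using norm_c0_bounded[of "h k" x] by simp
  qed
  have ml: "l \<in> borel_measurable (lebesgue_on Q)"
    by (rule borel_measurable_LIMSEQ_real[OF _ C0_measurable_on[of "h k" for k]]) (rule l)
  obtain g where "g \<in> C0 Q" "(\<lambda>k. T 1 (h k)) \<longlonglongrightarrow> g"
    by (rule smoothing_Cauchy[of 1 h, OF zero_less_one h hC ml]) (use l in auto)
  moreover have "T 1 (h k) = T 2 (f (r k))" for k
    using S_plus[of 1 1 "f (r k)"] f(1) by (simp add: h_def)
  ultimately show thesis using that[OF r(1)] by simp
qed

section \<open>From an eigenvector of \<open>T 2\<close> to a Dirichlet eigenfunction\<close>

lemma ip_T_T: "u \<in> C0 Q \<Longrightarrow> 0 \<le> t \<Longrightarrow> ip Q (T (t + t) u) u = q (T t u)"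
  using symmetric[of "T t u" u t] S_plus[of t t u] in_X[of t u] by simp

text \<open>
  For \<open>w = T (s / 2) g - c g\<close> one has \<open>T (s / 2) w = - c w\<close>, and \<open>w = 0\<close> since \<open>T (s / 2)\<close> is the
  square of a symmetric operator.
\<close>

lemma eigenvector_half:
  assumes g: "g \<in> C0 Q" and s: "0 < s" and eig: "T s g = exp (- \<mu> * s) *\<^sub>R g"
  shows "T (s / 2) g = exp (- \<mu> * (s / 2)) *\<^sub>R g"
proof -
  define c where "c = exp (- \<mu> * (s / 2))"
  have c: "0 < c" "c * c = exp (- \<mu> * s)" by (simp_all add: c_def exp_add[symmetric] algebra_simps)
  define w where "w = T (s / 2) g - c *\<^sub>R g"
  have X: "T (s / 2) g \<in> C0 Q" "c *\<^sub>R g \<in> C0 Q" using g s by (auto intro: in_X subspace_scale[OF subspace_C0])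
  have w: "w \<in> C0 Q" unfolding w_def by (intro subspace_diff[OF subspace_C0] X)
  have "T (s / 2) w = T s g - c *\<^sub>R T (s / 2) g"
    using S_diff[of "s / 2", OF _ X] S_scale[of "s / 2" g c] S_plus[of "s / 2" "s / 2" g] g s by (simp add: w_def)
  also have "\<dots> = - c *\<^sub>R w"
    unfolding eig c(2)[symmetric] w_def by (simp add: algebra_simps)
  finally have "ip Q (T (s / 2) w) w = - c * q w" by (simp add: ip.minus_left ip.scaleR_left)
  then have "q (T (s / 4) w) = - c * q w"
    using ip_T_T[OF w, of "s / 4"] s by simp
  then have "q w \<le> 0"
    using ip_nonneg[of Q "T (s / 4) w"] c(1) by (simp add: mult_le_0_iff zero_le_mult_iff)
  then have "w = 0" using ip_nonneg[of Q w] q_zero_imp[OF w] by simp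
  then show ?thesis by (simp add: w_def c_def)
qed

lemma eigenvector_multiple:
  assumes g: "g \<in> C0 Q" and s: "0 \<le> s" and eig: "T s g = exp (- \<mu> * s) *\<^sub>R g"
  shows "T (real k * s) g = exp (- \<mu> * (real k * s)) *\<^sub>R g"
proof (induction k)
  case (Suc k)
  have "T (real (Suc k) * s) g = T s (T (real k * s) g)"
    using S_plus[of s "real k * s" g] g s by (simp add: algebra_simps)
  also have "\<dots> = exp (- \<mu> * (real k * s)) *\<^sub>R (exp (- \<mu> * s) *\<^sub>R g)"
    using S_scale[OF s g] by (simp add: Suc eig)
  also have "\<dots> = exp (- \<mu> * (real (Suc k) * s)) *\<^sub>R g"
    by (simp add: mult_exp_exp algebra_simps)
  finally show ?case .
qed (simp add: S_0 g)

text \<open>Halving gives the relation at the times \<open>2 / 2 ^ m\<close> and iteration at their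
  multiples; these are dense, and the orbit is continuous.\<close>

lemma eigenvector_all:
  assumes g: "g \<in> C0 Q" and eig: "T 2 g = exp (- \<mu> * 2) *\<^sub>R g" and t: "0 \<le> t"
  shows "T t g = exp (- \<mu> * t) *\<^sub>R g"
proof -
  define s :: "nat \<Rightarrow> real" where "s m = 2 / 2 ^ m" for m
  have s: "0 < s m" for m by (simp add: s_def)
  have s_eig: "T (s m) g = exp (- \<mu> * s m) *\<^sub>R g" for m
  proof (induction m)
    case (Suc m)
    have "s (Suc m) = s m / 2" by (simp add: s_def)
    then show ?case using eigenvector_half[OF g s Suc] by (simp only:)
  qed (use eig in \<open>simp add: s_def\<close>)
  define k where "k m = nat \<lfloor>t / s m\<rfloor>" for m
  define \<theta> where "\<theta> m = real (k m) * s m" for m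
  have \<theta>0: "0 \<le> \<theta> m" for m using s[of m] by (simp add: \<theta>_def)
  have km: "real (k m) \<le> t / s m" "t / s m < real (k m) + 1" for m
    using t s[of m] by (auto simp: k_def)
  have \<theta>: "\<theta> m \<le> t" "t - s m \<le> \<theta> m" for m
    using km[of m] s[of m] by (auto simp: \<theta>_def field_simps)
  have s0: "s \<longlonglongrightarrow> 0"
  proof -
    have "(\<lambda>m. 2 * (1 / 2 :: real) ^ m) \<longlonglongrightarrow> 0"
      by (intro tendsto_mult_right_zero LIMSEQ_power_zero) simp
    then show ?thesis by (simp add: s_def[abs_def] power_one_over)
  qed
  have "(\<lambda>m. t - s m) \<longlonglongrightarrow> t - 0" by (intro tendsto_intros s0)
  then have lim: "\<theta> \<longlonglongrightarrow> t"
    by (intro tendsto_sandwich[of "\<lambda>m. t - s m" \<theta> sequentially "\<lambda>_. t"]) (use \<theta> in auto)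
  have "(\<lambda>m. T (\<theta> m) g) \<longlonglongrightarrow> T t g"
    by (rule continuous_on_tendsto_compose[OF continuous_on_orbit[OF g] lim]) (use t \<theta>0 in auto)
  moreover have "(\<lambda>m. T (\<theta> m) g) = (\<lambda>m. exp (- \<mu> * \<theta> m) *\<^sub>R g)"
    using eigenvector_multiple[OF g less_imp_le[OF s] s_eig] by (simp add: \<theta>_def)
  moreover have "(\<lambda>m. exp (- \<mu> * \<theta> m) *\<^sub>R g) \<longlonglongrightarrow> exp (- \<mu> * t) *\<^sub>R g"
    by (intro tendsto_intros lim)
  ultimately show ?thesis using LIMSEQ_unique by metis
qed

lemma eigenvector_generator:
  assumes g: "g \<in> C0 Q" and eig: "\<And>t. 0 \<le> t \<Longrightarrow> T t g = exp (- \<mu> * t) *\<^sub>R g"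
  shows "(g, \<mu> *\<^sub>R g) \<in> dirichlet_neg_laplacian Q"
proof -
  have "((\<lambda>t. exp (- \<mu> * t)) has_real_derivative - \<mu>) (at 0)"
    by (auto intro!: derivative_eq_intros)
  then have "((\<lambda>t. (exp (- \<mu> * t) - 1) / t) \<longlongrightarrow> - \<mu>) (at 0)" by (simp add: DERIV_def)
  then have "((\<lambda>t. (exp (- \<mu> * t) - 1) / t) \<longlongrightarrow> - \<mu>) (at_right 0)"
    by (rule filterlim_mono) (auto simp: at_le)
  then have "((\<lambda>t. ((exp (- \<mu> * t) - 1) / t) *\<^sub>R g) \<longlongrightarrow> - \<mu> *\<^sub>R g) (at_right 0)"
    by (intro tendsto_intros)
  then have "((\<lambda>t. (T t g - g) /\<^sub>R t) \<longlongrightarrow> - \<mu> *\<^sub>R g) (at_right 0)"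
    by (rule Lim_transform_eventually)
      (auto intro!: eventually_at_rightI[of 0 1] simp: eig algebra_simps divide_inverse)
  then have "(g, - \<mu> *\<^sub>R g) \<in> generator_on (C0 Q) T"
    using g by (auto simp: generator_on_def intro: subspace_scale[OF subspace_C0] subspace_neg[OF subspace_C0])
  from generatorD[OF this] show ?thesis by simp
qed

section \<open>The L2 operator norm and the exponential decay\<close>

lemma L2_norm_sup:
  obtains \<rho> where "0 \<le> \<rho>" "\<And>u. u \<in> C0 Q \<Longrightarrow> q (T 1 u) \<le> \<rho> * q u"
    "\<And>e. 0 < e \<Longrightarrow> \<exists>u\<in>C0 Q. q u \<le> 1 \<and> \<rho> - e < q (T 1 u)"
proof -
  obtain C where C: "0 < C" "\<And>u. u \<in> C0 Q \<Longrightarrow> norm (T 1 u) \<le> C * sqrt (q u)"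
    by (rule L2_Linf[OF zero_less_one]) blast
  \<comment> \<open>Its supremum is the squared L2 operator norm of \<open>T 1\<close>. The unit
    ball is used, not the sphere, so that \<open>E\<close> contains 0 and is never empty.\<close>
  define E where "E = {q (T 1 u) | u. u \<in> C0 Q \<and> q u \<le> 1}"
  have bE: "bdd_above E"
  proof (rule bdd_aboveI)
    fix y assume "y \<in> E"
    then obtain u where u: "u \<in> C0 Q" "q u \<le> 1" "y = q (T 1 u)" by (auto simp: E_def)
    have "C * sqrt (q u) \<le> C * 1"
      using u(2) C(1) by (intro mult_left_mono) auto
    then have "norm (T 1 u) \<le> C"
      using C(2)[OF u(1)] by simp
    then have "(norm (T 1 u))\<^sup>2 \<le> C\<^sup>2" using C(1) by (intro power_mono) auto
    then have "measure lborel Q * (norm (T 1 u))\<^sup>2 \<le> measure lborel Q * C\<^sup>2" by (intro mult_left_mono) auto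
    then show "y \<le> measure lborel Q * C\<^sup>2" using q_le_norm[of "T 1 u"] u in_X[of 1 u] by simp
  qed
  have "q (T 1 0) \<in> E" unfolding E_def using subspace_0[OF subspace_C0] by (intro CollectI exI[of _ 0]) (auto simp: ip.zero_left)
  then have E0: "0 \<in> E" using S_zero[of 1] by (simp add: ip.zero_left)
  show thesis
  proof (rule that[of "Sup E"])
    show "0 \<le> Sup E" by (rule cSup_upper[OF E0 bE])
    fix u assume u: "u \<in> C0 Q"
    show "q (T 1 u) \<le> Sup E * q u"
    proof (cases "q u = 0")
      case True
      then have "u = 0" by (rule q_zero_imp[OF u])
      then show ?thesis using S_zero[of 1] by (simp add: ip.zero_left)
    next
      case False
      then have q: "0 < q u" using ip_nonneg[of Q u] by simp
      define v where "v = (1 / sqrt (q u)) *\<^sub>R u"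
      have v: "v \<in> C0 Q" "q v = 1" "q (T 1 v) = q (T 1 u) / q u"
        using u q S_scale[of 1 u "1 / sqrt (q u)"]
        by (auto simp: v_def q_scale power_divide intro: subspace_scale[OF subspace_C0])
      then have "q (T 1 v) \<in> E" unfolding E_def by (intro CollectI exI[of _ v]) simp
      then have "q (T 1 u) / q u \<le> Sup E" using cSup_upper[OF _ bE] v(3) by metis
      then show ?thesis using q by (simp add: field_simps)
    qed
  next
    fix e :: real assume "0 < e"
    then have "Sup E - e < Sup E" by simp
    then obtain y where "y \<in> E" "Sup E - e < y" using less_cSup_iff[OF _ bE] E0 by blast
    then show "\<exists>u\<in>C0 Q. q u \<le> 1 \<and> Sup E - e < q (T 1 u)" by (auto simp: E_def)
  qed
qed

text \<open>The eigenvector is the limit of \<open>T 2\<close> along a maximising sequence for the \<open>L\<^sup>2\<close>-norm of \<open>T 1\<close>.\<close>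

lemma top_eigenvector:
  assumes \<rho>: "0 < \<rho>" "\<And>u. u \<in> C0 Q \<Longrightarrow> q (T 1 u) \<le> \<rho> * q u"
    "\<And>e. 0 < e \<Longrightarrow> \<exists>u\<in>C0 Q. q u \<le> 1 \<and> \<rho> - e < q (T 1 u)"
  obtains g where "g \<in> C0 Q" "g \<noteq> 0" "T 2 g = \<rho> *\<^sub>R g"
proof -
  have "\<exists>u\<in>C0 Q. q u \<le> 1 \<and> \<rho> - inverse (real (Suc k)) < q (T 1 u)" for k
    by (rule \<rho>(3)) simp
  then obtain f where f: "\<And>k. f k \<in> C0 Q" "\<And>k. q (f k) \<le> 1" "\<And>k. \<rho> - inverse (real (Suc k)) < q (T 1 (f k))"
    by metis
  obtain r g where r: "strict_mono (r :: nat \<Rightarrow> nat)" and g: "g \<in> C0 Q" and lim: "(\<lambda>k. T 2 (f (r k))) \<longlonglongrightarrow> g"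
    by (rule compactness[of f, OF f(1,2)]) blast
  have T2: "ip Q (T 2 u) u = q (T 1 u)" if "u \<in> C0 Q" for u
    using ip_T_T[OF that, of 1] by simp
  define z where "z k = T 2 (f k) - \<rho> *\<^sub>R f k" for k
  have zX: "z k \<in> C0 Q" for k
    unfolding z_def by (intro subspace_diff[OF subspace_C0] subspace_scale[OF subspace_C0] in_X f) simp
  \<comment> \<open>Expand the square: \<open>ip Q (T 2 (f k)) (f k)\<close> is
    \<open>q (T 1 (f k))\<close>, which is nearly \<rho> or more, and \<open>q (T 2 (f k))\<close>
    is at most \<rho> times it, so little is left of the three terms.\<close>
  have qz: "q (z k) \<le> \<rho> * inverse (real (Suc k))" for k
  proof -
    have "T 2 (f k) = T 1 (T 1 (f k))" using S_plus[of 1 1 "f k"] f(1) by simp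
    then have "q (T 2 (f k)) \<le> \<rho> * q (T 1 (f k))" using \<rho>(2)[OF in_X[of 1, OF _ f(1)]] by simp
    moreover have "q (z k) = q (f k) * \<rho>\<^sup>2 - 2 * q (T 1 (f k)) * \<rho> + q (T 2 (f k))"
      unfolding z_def q_diff T2[OF f(1)] ..
    moreover have "q (f k) * \<rho>\<^sup>2 \<le> 1 * \<rho>\<^sup>2" by (intro mult_right_mono f) simp
    ultimately have "q (z k) \<le> \<rho> * (\<rho> - q (T 1 (f k)))" by (simp add: power2_eq_square algebra_simps)
    also have "\<dots> \<le> \<rho> * inverse (real (Suc k))" using f(3)[of k] \<rho>(1) by (intro mult_left_mono) auto
    finally show ?thesis .
  qed
  have inv0: "(\<lambda>k. \<rho> * inverse (real (Suc k))) \<longlonglongrightarrow> 0"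
    by (intro tendsto_mult_right_zero LIMSEQ_inverse_real_of_nat)
  have "(\<lambda>k. q (z k)) \<longlonglongrightarrow> 0"
    by (rule tendsto_sandwich[OF always_eventually always_eventually tendsto_const inv0]) (use ip_nonneg qz in blast)+
  then have qz0: "(\<lambda>k. sqrt (q (z k))) \<longlonglongrightarrow> 0" using tendsto_real_sqrt by fastforce
  obtain C where C: "0 < C" "\<And>u. u \<in> C0 Q \<Longrightarrow> norm (T 2 u) \<le> C * sqrt (q u)"
    by (rule L2_Linf[of 2]) (simp, blast)
  \<comment> \<open>A further \<open>T 2\<close> turns smallness in L2 into smallness in norm;
    moreover \<open>T 2 (z k)\<close> involves \<open>f k\<close> only through
    \<open>T 2 (f k)\<close>, which converges along the subsequence.\<close>
  have "(\<lambda>k. T 2 (z k)) \<longlonglongrightarrow> 0"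
    by (rule Lim_null_comparison[OF always_eventually tendsto_mult_right_zero[OF qz0]]) (use C(2)[OF zX] in blast)
  from LIMSEQ_subseq_LIMSEQ[OF this r] have "(\<lambda>k. T 2 (z (r k))) \<longlonglongrightarrow> 0" by (simp add: o_def)
  moreover have "T 2 (z k) = T 2 (T 2 (f k)) - \<rho> *\<^sub>R T 2 (f k)" for k
    unfolding z_def using S_diff[of 2 "T 2 (f k)" "\<rho> *\<^sub>R f k"] S_scale[of 2 "f k" \<rho>] f(1)
    by (simp add: in_X subspace_scale[OF subspace_C0])
  moreover have "(\<lambda>k. T 2 (T 2 (f (r k))) - \<rho> *\<^sub>R T 2 (f (r k))) \<longlonglongrightarrow> T 2 g - \<rho> *\<^sub>R g"
    by (intro tendsto_intros T_tendsto lim g) (use f in \<open>auto intro: in_X\<close>)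
  ultimately have eig: "T 2 g - \<rho> *\<^sub>R g = 0" using LIMSEQ_unique by fastforce
  \<comment> \<open>Otherwise \<open>q (T 1 (f (r k)))\<close> would tend to 0 together with
    \<open>T 2 (f (r k))\<close>, although its lower bounds tend to \<rho> > 0.\<close>
  have "g \<noteq> 0"
  proof
    assume "g = 0"
    have le: "q (T 1 (f (r k))) \<le> sqrt (measure lborel Q) * norm (T 2 (f (r k)))" for k
    proof -
      have "(q (T 1 (f (r k))))\<^sup>2 \<le> q (f (r k)) * q (T 2 (f (r k)))"
        using ip_Cauchy_Schwarz[of "T 2 (f (r k))" "f (r k)"] T2[OF f(1)] by simp
      also have "\<dots> \<le> 1 * (measure lborel Q * (norm (T 2 (f (r k))))\<^sup>2)"
        by (intro mult_mono f q_le_norm in_X ip_nonneg) auto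
      finally have "q (T 1 (f (r k))) \<le> sqrt (measure lborel Q * (norm (T 2 (f (r k))))\<^sup>2)"
        by (intro real_le_rsqrt) simp
      then show ?thesis by (simp add: real_sqrt_mult)
    qed
    have "(\<lambda>k. \<rho> - inverse (real (Suc (r k)))) \<longlonglongrightarrow> \<rho> - 0"
      using LIMSEQ_subseq_LIMSEQ[OF LIMSEQ_inverse_real_of_nat r] by (intro tendsto_diff tendsto_const) (simp add: o_def)
    moreover have "(\<lambda>k. sqrt (measure lborel Q) * norm (T 2 (f (r k)))) \<longlonglongrightarrow> sqrt (measure lborel Q) * norm (0 :: 'a c0)"
      using lim unfolding \<open>g = 0\<close> by (intro tendsto_intros)
    ultimately have "\<rho> - 0 \<le> sqrt (measure lborel Q) * norm (0 :: 'a c0)"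
    proof (rule LIMSEQ_le)
      show "\<exists>N. \<forall>k\<ge>N. \<rho> - inverse (real (Suc (r k))) \<le> sqrt (measure lborel Q) * norm (T 2 (f (r k)))"
        using f(3) le by (meson less_imp_le order_trans)
    qed
    then show False using \<rho>(1) by simp
  qed
  then show thesis using that[OF g] eig by simp
qed

lemma L2_decay:
  assumes lam: "\<And>\<mu>. dirichlet_eigenvalue Q \<mu> \<Longrightarrow> lam \<le> \<mu>" and u: "u \<in> C0 Q"
  shows "q (T 1 u) \<le> exp (- 2 * lam) * q u"
proof -
  obtain \<rho> where \<rho>: "0 \<le> \<rho>" "\<And>u. u \<in> C0 Q \<Longrightarrow> q (T 1 u) \<le> \<rho> * q u"
    "\<And>e. 0 < e \<Longrightarrow> \<exists>u\<in>C0 Q. q u \<le> 1 \<and> \<rho> - e < q (T 1 u)"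
    by (rule L2_norm_sup) blast
  have "\<rho> \<le> exp (- 2 * lam)"
  proof (cases "\<rho> = 0")
    case False
    then have pos: "0 < \<rho>" using \<rho>(1) by simp
    obtain g where g: "g \<in> C0 Q" "g \<noteq> 0" "T 2 g = \<rho> *\<^sub>R g"
      by (rule top_eigenvector[OF pos \<rho>(2,3)]) blast+
    \<comment> \<open>\<rho> is an eigenvalue of \<open>T 2\<close>, so its rate \<mu> is fixed by
      e^(-2\<mu>) = \<rho>.\<close>
    define \<mu> where "\<mu> = - ln \<rho> / 2"
    have \<mu>: "\<rho> = exp (- \<mu> * 2)" using pos by (simp add: \<mu>_def)
    have "(g, \<mu> *\<^sub>R g) \<in> dirichlet_neg_laplacian Q"
      by (rule eigenvector_generator[OF g(1) eigenvector_all[OF g(1)]]) (use g(3) \<mu> in simp_all)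
    then have "lam \<le> \<mu>" using g(2) by (intro lam) (auto simp: dirichlet_eigenvalue_def)
    then show ?thesis unfolding \<mu> by simp
  qed simp
  then show ?thesis using \<rho>(2)[OF u] ip_nonneg[of Q u] by (meson mult_right_mono order_trans)
qed

text \<open>For \<open>t \<ge> 1\<close> write \<open>t = 1 + n + s\<close> with
  \<open>0 \<le> s < 1\<close>: contraction handles \<open>s\<close>, the L2 decay the
  \<open>n\<close> units, and the last unit returns to the supremum norm. The factor exp(2 lam) in
  \<open>M\<close> pays for the time 1 + s < 2 that yields no decay, and also covers
  \<open>t < 1\<close>.\<close>

lemma decay:
  assumes lam: "\<And>\<mu>. dirichlet_eigenvalue Q \<mu> \<Longrightarrow> lam \<le> \<mu>" and "0 \<le> lam"
  obtains M where "0 < M" "\<And>t u. 0 \<le> t \<Longrightarrow> u \<in> C0 Q \<Longrightarrow> norm (T t u) \<le> M * exp (- lam * t) * norm u"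
proof -
  obtain C where C: "0 < C" "\<And>u. u \<in> C0 Q \<Longrightarrow> norm (T 1 u) \<le> C * sqrt (q u)"
    by (rule L2_Linf[OF zero_less_one]) blast
  have qn: "q (T (real n) u) \<le> exp (- 2 * lam * real n) * q u" if "u \<in> C0 Q" for n u
  proof (induction n)
    case 0
    then show ?case by (simp add: S_0 that)
  next
    case (Suc n)
    have "q (T (real (Suc n)) u) = q (T 1 (T (real n) u))"
      using S_plus[of 1 "real n" u] that by simp
    also have "\<dots> \<le> exp (- 2 * lam) * q (T (real n) u)" by (rule L2_decay[OF lam in_X]) (use that in auto)
    also have "\<dots> \<le> exp (- 2 * lam) * (exp (- 2 * lam * real n) * q u)" by (intro mult_left_mono Suc) simp
    also have "\<dots> = exp (- 2 * lam * real (Suc n)) * q u" by (simp add: exp_add[symmetric] algebra_simps)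
    finally show ?case .
  qed
  define m where "m = sqrt (measure lborel Q)"
  define M where "M = (C * m + 1) * exp (2 * lam)"
  have m: "0 \<le> m" by (simp add: m_def)
  show thesis
  proof (rule that)
    show "0 < M" unfolding M_def using C(1) m by (simp add: add_nonneg_pos)
    fix t u assume t: "0 \<le> (t :: real)" and u: "u \<in> C0 Q"
    show "norm (T t u) \<le> M * exp (- lam * t) * norm u"
    proof (cases "t < 1")
      case True
      have "norm (T t u) \<le> 1 * norm u" using contraction[OF u t] by simp
      also have "\<dots> \<le> M * exp (- lam * t) * norm u"
      proof (rule mult_right_mono)
        have "lam * t \<le> lam * 2" using True \<open>0 \<le> lam\<close> by (intro mult_left_mono) auto
        then have "1 \<le> exp (2 * lam) * exp (- lam * t)" by (simp add: exp_add[symmetric])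
        also have "\<dots> \<le> (C * m + 1) * (exp (2 * lam) * exp (- lam * t))"
          using C(1) m mult_right_mono[of 1 "C * m + 1" "exp (2 * lam) * exp (- lam * t)"] by simp
        finally show "1 \<le> M * exp (- lam * t)" by (simp add: M_def mult.assoc)
      qed simp
      finally show ?thesis .
    next
      case False
      define n where "n = nat \<lfloor>t - 1\<rfloor>"
      define s where "s = t - 1 - real n"
      have s: "0 \<le> s" "s < 1" using False by (auto simp: n_def s_def) linarith+
      have eq: "T t u = T 1 (T (real n) (T s u))"
        using S_plus[of 1 "real n + s" u] S_plus[of "real n" s u] s u by (simp add: s_def)
      have X: "T s u \<in> C0 Q" "T (real n) (T s u) \<in> C0 Q" using s u by (auto intro!: in_X)
      have "q (T s u) \<le> measure lborel Q * (norm u)\<^sup>2"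
        using q_le_norm[OF X(1)] power_mono[OF contraction[OF u s(1)] norm_ge_zero, of 2]
        by (meson measure_nonneg mult_left_mono order_trans)
      then have "sqrt (q (T s u)) \<le> sqrt (measure lborel Q * (norm u)\<^sup>2)" by (rule real_sqrt_le_mono)
      then have qs: "sqrt (q (T s u)) \<le> m * norm u" by (simp add: real_sqrt_mult m_def)
      have "norm (T t u) \<le> C * sqrt (q (T (real n) (T s u)))" unfolding eq by (rule C(2)[OF X(2)])
      also have "\<dots> \<le> C * sqrt (exp (- 2 * lam * real n) * q (T s u))"
        using C(1) by (intro mult_left_mono real_sqrt_le_mono qn X) auto
      also have "\<dots> = C * (exp (- lam * real n) * sqrt (q (T s u)))"
      proof -
        have "exp (- 2 * lam * real n) = (exp (- lam * real n))\<^sup>2" by (simp add: exp_double[symmetric] power2_eq_square exp_add[symmetric])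
        then show ?thesis by (simp add: real_sqrt_mult)
      qed
      also have "\<dots> \<le> C * (exp (- lam * real n) * (m * norm u))"
        using C(1) qs by (intro mult_left_mono) auto
      also have "\<dots> = C * m * exp (- lam * real n) * norm u" by simp
      also have "\<dots> \<le> M * exp (- lam * t) * norm u"
      proof (intro mult_right_mono)
        have "lam * (t - real n) \<le> lam * 2" using s \<open>0 \<le> lam\<close> by (intro mult_left_mono) (auto simp: s_def)
        then have "exp (- lam * real n) \<le> exp (2 * lam) * exp (- lam * t)" by (simp add: exp_add[symmetric] algebra_simps)
        then have "C * m * exp (- lam * real n) \<le> (C * m + 1) * (exp (2 * lam) * exp (- lam * t))"
          using C(1) m by (intro mult_mono) auto
        then show "C * m * exp (- lam * real n) \<le> M * exp (- lam * t)" by (simp add: M_def mult.assoc)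
      qed simp
      finally show ?thesis .
    qed
  qed
qed

end

section \<open>The extension to bounded measurable functions\<close>

lemma Linf_norm_le:
  assumes f: "f \<in> borel_measurable (lebesgue_on Q)" and c: "AE x in lebesgue_on Q. \<bar>f x\<bar> \<le> c" "0 \<le> c"
  shows "f \<in> Linf Q" "Linf_norm Q f \<le> c"
proof -
  have m: "(\<lambda>x. ereal \<bar>f x\<bar>) \<in> borel_measurable (lebesgue_on Q)" using f by measurable
  have le: "esssup (lebesgue_on Q) (\<lambda>x. ereal \<bar>f x\<bar>) \<le> ereal c"
    by (rule esssup_I[OF m]) (use c in auto)
  have "esssup (lebesgue_on Q) (\<lambda>x. ereal \<bar>f x\<bar>) < \<infinity>"
    by (rule le_less_trans[OF le]) simp
  then show "f \<in> Linf Q" using f by (simp add: Linf_def)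
  show "Linf_norm Q f \<le> c"
    using le c(2) unfolding Linf_norm_def by (cases "esssup (lebesgue_on Q) (\<lambda>x. ereal \<bar>f x\<bar>)") auto
qed

lemma Linf_measurable: "f \<in> Linf Q \<Longrightarrow> f \<in> borel_measurable (lebesgue_on Q)"
  by (simp add: Linf_def)

text \<open>An essential supremum of |f| can be negative only over a null space; there it is
  -\<infinity>, which \<open>real_of_ereal\<close> sends to 0.\<close>

lemma Linf_norm_nonneg:
  assumes "f \<in> Linf Q"
  shows "0 \<le> Linf_norm Q f"
proof (rule ccontr)
  assume neg: "\<not> 0 \<le> Linf_norm Q f"
  define e where "e = esssup (lebesgue_on Q) (\<lambda>x. ereal \<bar>f x\<bar>)"
  have m: "(\<lambda>x. ereal \<bar>f x\<bar>) \<in> borel_measurable (lebesgue_on Q)" using Linf_measurable[OF assms] by measurable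
  obtain r where r: "e = ereal r" "r < 0"
    using neg by (cases e) (auto simp: Linf_norm_def e_def)
  have "AE x in lebesgue_on Q. ereal \<bar>f x\<bar> \<le> e" unfolding e_def by (rule esssup_AE)
  then have "AE x in lebesgue_on Q. False" by eventually_elim (use r in auto)
  then have "emeasure (lebesgue_on Q) (space (lebesgue_on Q)) = 0"
    unfolding eventually_False ae_filter_eq_bot_iff .
  then have "e = - \<infinity>" unfolding e_def by (rule esssup_zero_space[OF _ m])
  then show False using r by simp
qed

lemma Linf_norm_AE:
  assumes "f \<in> Linf Q"
  shows "AE x in lebesgue_on Q. \<bar>f x\<bar> \<le> Linf_norm Q f"
proof -
  define e where "e = esssup (lebesgue_on Q) (\<lambda>x. ereal \<bar>f x\<bar>)"
  have e: "e < \<infinity>" using assms by (simp add: Linf_def e_def)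
  have "AE x in lebesgue_on Q. ereal \<bar>f x\<bar> \<le> e" unfolding e_def by (rule esssup_AE)
  then show ?thesis
    by eventually_elim (use e in \<open>cases e, auto simp: Linf_norm_def e_def\<close>)
qed

lemma Linf_diff:
  assumes "f \<in> Linf Q" "g \<in> Linf Q"
  shows "(\<lambda>x. f x - g x) \<in> Linf Q"
proof (rule Linf_norm_le(1))
  show "(\<lambda>x. f x - g x) \<in> borel_measurable (lebesgue_on Q)"
    using Linf_measurable[OF assms(1)] Linf_measurable[OF assms(2)] by measurable
  show "AE x in lebesgue_on Q. \<bar>f x - g x\<bar> \<le> Linf_norm Q f + Linf_norm Q g"
    using Linf_norm_AE[OF assms(1)] Linf_norm_AE[OF assms(2)] by eventually_elim linarith
qed (use Linf_norm_nonneg assms in \<open>auto intro: add_nonneg_nonneg\<close>)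

lemma Linf_forcing:
  assumes "f \<in> Linf Q" "g \<in> Linf Q"
  shows "(\<lambda>x. f x + \<bar>g x\<bar>) \<in> Linf Q" "Linf_norm Q (\<lambda>x. f x + \<bar>g x\<bar>) \<le> Linf_norm Q f + Linf_norm Q g"
proof -
  have m: "(\<lambda>x. f x + \<bar>g x\<bar>) \<in> borel_measurable (lebesgue_on Q)"
    using Linf_measurable[OF assms(1)] Linf_measurable[OF assms(2)] by measurable
  have b: "AE x in lebesgue_on Q. \<bar>f x + \<bar>g x\<bar>\<bar> \<le> Linf_norm Q f + Linf_norm Q g"
    using Linf_norm_AE[OF assms(1)] Linf_norm_AE[OF assms(2)] by eventually_elim linarith
  have "0 \<le> Linf_norm Q f + Linf_norm Q g"
    using Linf_norm_nonneg assms by (auto intro: add_nonneg_nonneg)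
  from Linf_norm_le[OF m b this] show "(\<lambda>x. f x + \<bar>g x\<bar>) \<in> Linf Q" "Linf_norm Q (\<lambda>x. f x + \<bar>g x\<bar>) \<le> Linf_norm Q f + Linf_norm Q g"
    by auto
qed

lemma strongly_measurable_forcing:
  assumes h: "strongly_measurable_Linf Q h" "range h \<subseteq> Linf Q" and g: "strongly_measurable_Linf Q g" "range g \<subseteq> Linf Q"
  shows "strongly_measurable_Linf Q (\<lambda>s x. h s x + \<bar>g s x\<bar>)"
proof -
  obtain H where H: "\<And>k. simple_function lebesgue (H k)" "\<And>k. range (H k) \<subseteq> Linf Q"
    "AE s in lebesgue. (\<lambda>k. Linf_norm Q (\<lambda>x. H k s x - h s x)) \<longlonglongrightarrow> 0"
    using h(1) unfolding strongly_measurable_Linf_def by blast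
  obtain G where G: "\<And>k. simple_function lebesgue (G k)" "\<And>k. range (G k) \<subseteq> Linf Q"
    "AE s in lebesgue. (\<lambda>k. Linf_norm Q (\<lambda>x. G k s x - g s x)) \<longlonglongrightarrow> 0"
    using g(1) unfolding strongly_measurable_Linf_def by blast
  define F where "F k s = (\<lambda>x. H k s x + \<bar>G k s x\<bar>)" for k s
  have HL: "H k s \<in> Linf Q" and GL: "G k s \<in> Linf Q" and hL: "h s \<in> Linf Q" and gL: "g s \<in> Linf Q" for k s
    using H(2) G(2) h(2) g(2) by blast+
  have FL: "F k s \<in> Linf Q" for k s unfolding F_def by (rule Linf_forcing[OF HL GL])
  have le: "Linf_norm Q (\<lambda>x. F k s x - (h s x + \<bar>g s x\<bar>))
      \<le> Linf_norm Q (\<lambda>x. H k s x - h s x) + Linf_norm Q (\<lambda>x. G k s x - g s x)" for k s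
  proof (rule Linf_norm_le(2))
    show "(\<lambda>x. F k s x - (h s x + \<bar>g s x\<bar>)) \<in> borel_measurable (lebesgue_on Q)"
      by (rule Linf_measurable[OF Linf_diff[OF FL Linf_forcing(1)[OF hL gL]]])
    show "AE x in lebesgue_on Q. \<bar>F k s x - (h s x + \<bar>g s x\<bar>)\<bar> \<le> Linf_norm Q (\<lambda>x. H k s x - h s x) + Linf_norm Q (\<lambda>x. G k s x - g s x)"
      using Linf_norm_AE[OF Linf_diff[OF HL[of k s] hL[of s]]] Linf_norm_AE[OF Linf_diff[OF GL[of k s] gL[of s]]]
      unfolding F_def by eventually_elim linarith
  qed (intro add_nonneg_nonneg Linf_norm_nonneg Linf_diff HL hL GL gL)
  show ?thesis
    unfolding strongly_measurable_Linf_def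
  proof (intro exI[of _ F] conjI allI)
    show "simple_function lebesgue (F k)" for k
      using simple_function_compose2[OF H(1)[of k] G(1)[of k], where h = "\<lambda>a b x. a x + \<bar>b x\<bar>"] by (simp add: F_def[abs_def])
    show "range (F k) \<subseteq> Linf Q" for k using FL by blast
    show "AE s in lebesgue. (\<lambda>k. Linf_norm Q (\<lambda>x. F k s x - (h s x + \<bar>g s x\<bar>))) \<longlonglongrightarrow> 0"
      using H(3) G(3)
    proof eventually_elim
      case (elim s)
      have U: "(\<lambda>k. Linf_norm Q (\<lambda>x. H k s x - h s x) + Linf_norm Q (\<lambda>x. G k s x - g s x)) \<longlonglongrightarrow> 0"
        using tendsto_add[OF elim] by simp
      show ?case
        by (rule tendsto_sandwich[OF always_eventually always_eventually tendsto_const U])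
          (use le Linf_norm_nonneg[OF Linf_diff[OF FL Linf_forcing(1)[OF hL gL]]] in blast)+
    qed
  qed
qed

text \<open>Lusin: \<^const>\<open>measurable_on\<close> provides continuous functions, which are then truncated and cut off.\<close>

lemma Linf_approximation:
  fixes Q :: "'a::euclidean_space set"
  assumes Q: "open Q" "bounded Q" and f: "f \<in> Linf Q"
  obtains fk :: "nat \<Rightarrow> 'a c0" where "\<And>k. fk k \<in> C0 Q" "\<And>k x. \<bar>apply_c0 (fk k) x\<bar> \<le> Linf_norm Q f"
    "AE x in lebesgue_on Q. (\<lambda>k. apply_c0 (fk k) x) \<longlonglongrightarrow> f x"
proof -
  have Qs: "Q \<in> sets lebesgue" using Q(1) by auto
  have ne: "- Q \<noteq> {}" using Q(2) not_bounded_UNIV by (metis compl_bot_eq double_compl)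
  obtain N gk where N: "negligible N" and gk: "\<And>n. continuous_on UNIV (gk n)"
    "\<And>x. x \<notin> N \<Longrightarrow> (\<lambda>n. gk n x) \<longlonglongrightarrow> (if x \<in> Q then f x else 0)"
    using Linf_measurable[OF f] unfolding measurable_on_iff_borel_measurable[OF Qs, symmetric] measurable_on_def by blast
  define L where "L = Linf_norm Q f"
  have L: "0 \<le> L" unfolding L_def by (rule Linf_norm_nonneg[OF f])
  \<comment> \<open>The cutoffs vanish off \<open>Q\<close> and are eventually 1 at each point of
    \<open>Q\<close>; truncation at \<open>L\<close> keeps the sequence bounded and changes
    \<open>f\<close> on a null set at most.\<close>
  define c where "c k x = min 1 (real k * infdist x (- Q))" for k x
  have c: "continuous_on UNIV (c k)" "0 \<le> c k x" "c k x \<le> 1" for k x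
    unfolding c_def[abs_def] by (auto intro!: continuous_intros simp: infdist_nonneg)
  define p where "p k x = c k x * max (- L) (min L (gk k x))" for k x
  have cp: "continuous_on UNIV (p k)" for k
    unfolding p_def[abs_def] by (intro continuous_intros c gk)
  have p0: "p k x = 0" if "x \<notin> Q" for k x using that by (simp add: p_def c_def)
  have pL: "\<bar>p k x\<bar> \<le> L" for k x
  proof -
    have "\<bar>max (- L) (min L (gk k x))\<bar> \<le> L" using L by auto
    then have "\<bar>c k x\<bar> * \<bar>max (- L) (min L (gk k x))\<bar> \<le> 1 * L" using c(2,3)[of k x] by (intro mult_mono) auto
    then show ?thesis by (simp add: p_def abs_mult)
  qed
  obtain b where b: "\<And>x. x \<in> Q \<Longrightarrow> norm x \<le> b"
    using Q(2) unfolding bounded_iff by blast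
  have "\<exists>u. apply_c0 u = p k" for k
  proof -
    have "\<forall>\<^sub>F x in at_infinity. p k x = 0"
      unfolding eventually_at_infinity
      by (intro exI[of _ "b + 1"] allI impI p0) (use b in force)
    then have "(p k \<longlongrightarrow> 0) at_infinity" by (rule tendsto_eventually)
    then show ?thesis using c0_of_continuous[OF cp] by blast
  qed
  then obtain fk where fk: "\<And>k. apply_c0 (fk k) = p k" by metis
  show thesis
  proof
    show "fk k \<in> C0 Q" for k using p0 by (simp add: C0_def fk)
    show "\<bar>apply_c0 (fk k) x\<bar> \<le> Linf_norm Q f" for k x using pL by (simp add: fk L_def)
    have "AE x in lebesgue. x \<notin> N" using N by (simp add: AE_not_in negligible_iff_null_sets)
    then have "AE x in lebesgue_on Q. x \<notin> N" using Qs by (auto simp: AE_restrict_space_iff elim!: eventually_mono)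
    moreover have "AE x in lebesgue_on Q. x \<in> Q" using AE_space[of "lebesgue_on Q"] by simp
    ultimately show "AE x in lebesgue_on Q. (\<lambda>k. apply_c0 (fk k) x) \<longlonglongrightarrow> f x"
      using Linf_norm_AE[OF f]
    proof eventually_elim
      case (elim x)
      have "0 < infdist x (- Q)"
      proof -
        have "closed (- Q)" using Q(1) by auto
        then have "infdist x (- Q) \<noteq> 0" using in_closed_iff_infdist_zero[of "- Q" x] ne elim by auto
        then show ?thesis using infdist_nonneg[of x "- Q"] by simp
      qed
      then obtain n where n: "1 < real n * infdist x (- Q)" using reals_Archimedean3 by blast
      have "c k x = 1" if "k \<ge> n" for k
      proof -
        have "real n * infdist x (- Q) \<le> real k * infdist x (- Q)"
          using that by (intro mult_right_mono infdist_nonneg) auto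
        then show ?thesis using n by (simp add: c_def)
      qed
      then have "(\<lambda>k. c k x) \<longlonglongrightarrow> 1" by (intro tendsto_eventually eventually_sequentiallyI[of n])
      moreover have "(\<lambda>k. gk k x) \<longlonglongrightarrow> f x" using gk(2)[of x] elim by simp
      ultimately have "(\<lambda>k. p k x) \<longlonglongrightarrow> 1 * max (- L) (min L (f x))"
        unfolding p_def by (intro tendsto_intros)
      moreover have "max (- L) (min L (f x)) = f x" using elim by (auto simp: L_def)
      ultimately show ?case by (simp add: fk)
    qed
  qed
qed

lemma interleave_tendsto:
  fixes f g :: "nat \<Rightarrow> 'b::topological_space"
  assumes "f \<longlonglongrightarrow> l" "g \<longlonglongrightarrow> l"
  shows "(\<lambda>n. if even n then f (n div 2) else g (n div 2)) \<longlonglongrightarrow> l"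
proof (rule topological_tendstoI)
  fix S assume "open S" "l \<in> S"
  then obtain N M where "\<And>n. n \<ge> N \<Longrightarrow> f n \<in> S" "\<And>n. n \<ge> M \<Longrightarrow> g n \<in> S"
    using topological_tendstoD[OF assms(1)] topological_tendstoD[OF assms(2)] by (metis eventually_sequentially)
  then show "\<forall>\<^sub>F n in sequentially. (if even n then f (n div 2) else g (n div 2)) \<in> S"
    by (intro eventually_sequentiallyI[of "2 * max N M"]) auto
qed

text \<open>By completeness every subset of the exceptional null set is measurable, whatever
  \<open>g\<close> does there.\<close>

lemma borel_measurable_lebesgue_AE:
  fixes f g :: "'a::euclidean_space \<Rightarrow> 'b::topological_space"
  assumes f: "f \<in> borel_measurable lebesgue" and eq: "AE x in lebesgue. f x = g x"
  shows "g \<in> borel_measurable lebesgue"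
proof (rule measurableI)
  obtain N where N: "N \<in> null_sets lebesgue" "{x. f x \<noteq> g x} \<subseteq> N"
    using eq by (auto simp: eventually_ae_filter)
  fix A :: "'b set" assume A: "A \<in> sets borel"
  have "f x = g x" if "x \<notin> N" for x using N(2) that by blast
  then have "g -` A \<inter> space lebesgue = (f -` A \<inter> space lebesgue - N) \<union> (g -` A \<inter> N)"
    by auto
  moreover have "f -` A \<inter> space lebesgue \<in> sets lebesgue" using f A by (rule measurable_sets)
  moreover have "g -` A \<inter> N \<in> sets lebesgue"
    using null_sets_completion_subset[of "g -` A \<inter> N" N] N(1) by auto
  ultimately show "g -` A \<inter> space lebesgue \<in> sets lebesgue"
    using null_setsD2[OF N(1)] by (metis sets.Un sets.Diff)
qed simp

lemma borel_measurable_lebesgue_AE_lim: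
  fixes u :: "nat \<Rightarrow> 'a::euclidean_space \<Rightarrow> 'b::{banach, second_countable_topology}"
  assumes "\<And>k. u k \<in> borel_measurable lebesgue" "AE x in lebesgue. (\<lambda>k. u k x) \<longlonglongrightarrow> l x"
  shows "l \<in> borel_measurable lebesgue"
proof (rule borel_measurable_lebesgue_AE)
  show "(\<lambda>x. lim (\<lambda>k. u k x)) \<in> borel_measurable lebesgue" by (rule borel_measurable_lim_metric[OF assms(1)])
  show "AE x in lebesgue. lim (\<lambda>k. u k x) = l x" using assms(2) by eventually_elim (rule limI)
qed

text \<open>What the forced problem draws from the semigroup: \<open>decay\<close> gives the rates,
  \<open>smoothing\<close> makes the extension to bounded functions well defined, and
  \<open>functional\<close> lets operators on a subspace pass under Bochner integrals.\<close>

locale smoothing_semigroup = semigroup_on "C0 Q" S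
  for Q :: "'a::euclidean_space set" and S :: "real \<Rightarrow> 'a c0 \<Rightarrow> 'a c0" +
  fixes M a :: real
  assumes open_Q: "open Q" and bounded_Q: "bounded Q" and M: "0 < M"
    and decay: "0 \<le> t \<Longrightarrow> u \<in> C0 Q \<Longrightarrow> norm (S t u) \<le> M * exp (- a * t) * norm u"
    and smoothing: "0 < t \<Longrightarrow> (\<And>k. h k \<in> C0 Q) \<Longrightarrow> (\<And>k x. \<bar>apply_c0 (h k) x\<bar> \<le> B) \<Longrightarrow>
      l \<in> borel_measurable (lebesgue_on Q) \<Longrightarrow> AE x in lebesgue_on Q. (\<lambda>k. apply_c0 (h k) x) \<longlonglongrightarrow> l x \<Longrightarrow>
      \<exists>w\<in>C0 Q. (\<lambda>k. S t (h k)) \<longlonglongrightarrow> w"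
    and functional: "0 < t \<Longrightarrow> 0 < e \<Longrightarrow> \<exists>L. bounded_linear L \<and> (\<forall>u\<in>C0 Q. \<bar>apply_c0 (S t u) x - L u\<bar> \<le> e * norm u)"
begin

abbreviation E :: "real \<Rightarrow> ('a \<Rightarrow> real) \<Rightarrow> 'a c0" where "E t \<equiv> Linf_extension Q (S t)"

text \<open>Two approximating sequences are interleaved: the result still converges almost
  everywhere to \<open>f\<close>, so its image converges, and both subsequences share the
  limit.\<close>

lemma extension_ex1:
  assumes t: "0 < t" and f: "f \<in> Linf Q"
  shows "\<exists>!u. u \<in> C0 Q \<and>
    (\<forall>fk :: nat \<Rightarrow> 'a c0. range fk \<subseteq> C0 Q \<and> bounded (range fk) \<and>
       (AE x in lebesgue_on Q. (\<lambda>k. apply_c0 (fk k) x) \<longlonglongrightarrow> f x) \<longrightarrow> (\<lambda>k. S t (fk k)) \<longlonglongrightarrow> u)"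
proof -
  obtain gk where gk: "\<And>k. gk k \<in> C0 Q" "\<And>k x. \<bar>apply_c0 (gk k) x\<bar> \<le> Linf_norm Q f"
    "AE x in lebesgue_on Q. (\<lambda>k. apply_c0 (gk k) x) \<longlonglongrightarrow> f x"
    using Linf_approximation[OF open_Q bounded_Q f] by blast
  have bgk: "norm (gk k) \<le> Linf_norm Q f" for k by (rule norm_c0_bound) (rule gk(2))
  obtain w where w: "w \<in> C0 Q" "(\<lambda>k. S t (gk k)) \<longlonglongrightarrow> w"
    using smoothing[OF t gk(1,2) Linf_measurable[OF f] gk(3)] by blast
  have lim: "(\<lambda>k. S t (fk k)) \<longlonglongrightarrow> w"
    if fk: "range fk \<subseteq> C0 Q" "bounded (range fk)" "AE x in lebesgue_on Q. (\<lambda>k. apply_c0 (fk k) x) \<longlonglongrightarrow> f x" for fk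
  proof -
    obtain B where B: "\<And>k. norm (fk k) \<le> B" using fk(2) unfolding bounded_iff by blast
    define h where "h n = (if even n then gk (n div 2) else fk (n div 2))" for n
    have "\<exists>w'\<in>C0 Q. (\<lambda>k. S t (h k)) \<longlonglongrightarrow> w'"
    proof (rule smoothing[OF t _ _ Linf_measurable[OF f]])
      show "h k \<in> C0 Q" for k using gk(1) fk(1) by (auto simp: h_def)
      show "\<bar>apply_c0 (h k) x\<bar> \<le> max (Linf_norm Q f) B" for k x
        using gk(2)[of "k div 2" x] norm_c0_bounded[of "fk (k div 2)" x] B[of "k div 2"] by (auto simp: h_def)
      show "AE x in lebesgue_on Q. (\<lambda>k. apply_c0 (h k) x) \<longlonglongrightarrow> f x"
        using gk(3) fk(3)
      proof eventually_elim
        case (elim x)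
        have "(\<lambda>n. apply_c0 (h n) x) = (\<lambda>n. if even n then apply_c0 (gk (n div 2)) x else apply_c0 (fk (n div 2)) x)"
          by (auto simp: h_def)
        then show ?case using interleave_tendsto[OF elim] by simp
      qed
    qed
    then obtain w' where w': "(\<lambda>k. S t (h k)) \<longlonglongrightarrow> w'" by blast
    have s: "strict_mono (\<lambda>n::nat. 2 * n)" "strict_mono (\<lambda>n::nat. 2 * n + 1)" by (auto simp: strict_mono_def)
    have "(\<lambda>k. S t (gk k)) \<longlonglongrightarrow> w'" "(\<lambda>k. S t (fk k)) \<longlonglongrightarrow> w'"
      using LIMSEQ_subseq_LIMSEQ[OF w' s(1)] LIMSEQ_subseq_LIMSEQ[OF w' s(2)] by (simp_all add: o_def h_def)
    then show ?thesis using LIMSEQ_unique[OF w(2)] by simp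
  qed
  show ?thesis
  proof (rule ex1I[of _ w])
    fix u assume u: "u \<in> C0 Q \<and> (\<forall>fk :: nat \<Rightarrow> 'a c0. range fk \<subseteq> C0 Q \<and> bounded (range fk) \<and>
       (AE x in lebesgue_on Q. (\<lambda>k. apply_c0 (fk k) x) \<longlonglongrightarrow> f x) \<longrightarrow> (\<lambda>k. S t (fk k)) \<longlonglongrightarrow> u)"
    have "bounded (range gk)" unfolding bounded_iff using bgk by blast
    then have "(\<lambda>k. S t (gk k)) \<longlonglongrightarrow> u" using u gk by blast
    then show "u = w" using w(2) LIMSEQ_unique by blast
  qed (use w(1) lim in blast)
qed

lemma extension_in_C0: "0 < t \<Longrightarrow> f \<in> Linf Q \<Longrightarrow> E t f \<in> C0 Q"
  using theI'[OF extension_ex1] unfolding Linf_extension_def by blast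

lemma extension_tendsto:
  assumes "0 < t" "f \<in> Linf Q" "\<And>k. fk k \<in> C0 Q" "\<And>k. norm (fk k) \<le> B" "AE x in lebesgue_on Q. (\<lambda>k. apply_c0 (fk k) x) \<longlonglongrightarrow> f x"
  shows "(\<lambda>k. S t (fk k)) \<longlonglongrightarrow> E t f"
proof -
  have "bounded (range fk)" unfolding bounded_iff using assms(4) by blast
  moreover have "range fk \<subseteq> C0 Q" using assms(3) by blast
  ultimately show ?thesis
    using theI'[OF extension_ex1[OF assms(1,2)]] assms(5) unfolding Linf_extension_def by blast
qed

text \<open>One sequence serves all times, so that values of the extension at different times can be
  compared along it.\<close>

lemma extension_approximation:
  assumes f: "f \<in> Linf Q"
  obtains fk where "\<And>k. fk k \<in> C0 Q" "\<And>k. norm (fk k) \<le> Linf_norm Q f" "AE x in lebesgue_on Q. (\<lambda>k. apply_c0 (fk k) x) \<longlonglongrightarrow> f x"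
    "\<And>t. 0 < t \<Longrightarrow> (\<lambda>k. S t (fk k)) \<longlonglongrightarrow> E t f"
proof -
  obtain fk where fk: "\<And>k. fk k \<in> C0 Q" "\<And>k x. \<bar>apply_c0 (fk k) x\<bar> \<le> Linf_norm Q f"
    "AE x in lebesgue_on Q. (\<lambda>k. apply_c0 (fk k) x) \<longlonglongrightarrow> f x"
    using Linf_approximation[OF open_Q bounded_Q f] by blast
  have "norm (fk k) \<le> Linf_norm Q f" for k by (rule norm_c0_bound) (rule fk(2))
  then show thesis using that[of fk] fk(1,3) extension_tendsto[OF _ f] by blast
qed

lemma extension_bound:
  assumes t: "0 < t" and f: "f \<in> Linf Q"
  shows "norm (E t f) \<le> M * exp (- a * t) * Linf_norm Q f"
proof -
  obtain fk where fk: "\<And>k. fk k \<in> C0 Q" "\<And>k. norm (fk k) \<le> Linf_norm Q f" "(\<lambda>k. S t (fk k)) \<longlonglongrightarrow> E t f"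
    using extension_approximation[OF f] t by metis
  have "norm (S t (fk k)) \<le> M * exp (- a * t) * Linf_norm Q f" for k
  proof -
    have "norm (S t (fk k)) \<le> M * exp (- a * t) * norm (fk k)" using t by (intro decay fk) simp
    also have "\<dots> \<le> M * exp (- a * t) * Linf_norm Q f" using M by (intro mult_left_mono fk) simp
    finally show ?thesis .
  qed
  then show ?thesis
    by (intro tendsto_upperbound[OF tendsto_norm[OF fk(3)]]) auto
qed

lemma extension_diff:
  assumes t: "0 < t" and f: "f \<in> Linf Q" and g: "g \<in> Linf Q"
  shows "E t (\<lambda>x. f x - g x) = E t f - E t g"
proof -
  obtain fk where fk: "\<And>k. fk k \<in> C0 Q" "\<And>k. norm (fk k) \<le> Linf_norm Q f"
    "AE x in lebesgue_on Q. (\<lambda>k. apply_c0 (fk k) x) \<longlonglongrightarrow> f x" "\<And>t. 0 < t \<Longrightarrow> (\<lambda>k. S t (fk k)) \<longlonglongrightarrow> E t f"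
    by (rule extension_approximation[OF f]) blast
  obtain gk where gk: "\<And>k. gk k \<in> C0 Q" "\<And>k. norm (gk k) \<le> Linf_norm Q g"
    "AE x in lebesgue_on Q. (\<lambda>k. apply_c0 (gk k) x) \<longlonglongrightarrow> g x" "\<And>t. 0 < t \<Longrightarrow> (\<lambda>k. S t (gk k)) \<longlonglongrightarrow> E t g"
    by (rule extension_approximation[OF g]) blast
  have "(\<lambda>k. S t (fk k - gk k)) \<longlonglongrightarrow> E t (\<lambda>x. f x - g x)"
  proof (rule extension_tendsto[OF t Linf_diff[OF f g]])
    show "fk k - gk k \<in> C0 Q" for k by (intro subspace_diff[OF subspace_C0] fk gk)
    show "norm (fk k - gk k) \<le> Linf_norm Q f + Linf_norm Q g" for k
      using norm_triangle_ineq4[of "fk k" "gk k"] fk(2)[of k] gk(2)[of k] by linarith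
    show "AE x in lebesgue_on Q. (\<lambda>k. apply_c0 (fk k - gk k) x) \<longlonglongrightarrow> f x - g x"
      using fk(3) gk(3) by eventually_elim (simp add: tendsto_diff)
  qed
  moreover have "(\<lambda>k. S t (fk k - gk k)) \<longlonglongrightarrow> E t f - E t g"
    using tendsto_diff[OF fk(4)[OF t] gk(4)[OF t]] S_diff[of t "fk _" "gk _"] t fk(1) gk(1) by simp
  ultimately show ?thesis using LIMSEQ_unique by blast
qed

lemma extension_dist:
  assumes t: "0 < t" and f: "f \<in> Linf Q" and g: "g \<in> Linf Q"
  shows "norm (E t f - E t g) \<le> M * exp (- a * t) * Linf_norm Q (\<lambda>x. f x - g x)"
  using extension_bound[OF t Linf_diff[OF f g]] extension_diff[OF t f g] by simp

lemma extension_cong: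
  assumes t: "0 < t" and f: "f \<in> Linf Q" and g: "g \<in> Linf Q" and eq: "AE x in lebesgue_on Q. f x = g x"
  shows "E t f = E t g"
proof -
  have "Linf_norm Q (\<lambda>x. f x - g x) \<le> 0"
    by (rule Linf_norm_le(2)[OF Linf_measurable[OF Linf_diff[OF f g]]]) (use eq in auto)
  then have "M * exp (- a * t) * Linf_norm Q (\<lambda>x. f x - g x) \<le> 0" using M by (simp add: mult_le_0_iff)
  then have "norm (E t f - E t g) \<le> 0" using extension_dist[OF t f g] by linarith
  then show ?thesis by simp
qed

lemma extension_semigroup:
  assumes r: "0 \<le> r" and t: "0 < t" and f: "f \<in> Linf Q"
  shows "S r (E t f) = E (r + t) f"
proof -
  obtain fk where fk: "\<And>k. fk k \<in> C0 Q" "\<And>k. norm (fk k) \<le> Linf_norm Q f"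
    "AE x in lebesgue_on Q. (\<lambda>k. apply_c0 (fk k) x) \<longlonglongrightarrow> f x" "\<And>t. 0 < t \<Longrightarrow> (\<lambda>k. S t (fk k)) \<longlonglongrightarrow> E t f"
    by (rule extension_approximation[OF f]) blast
  have X: "S t (fk k) \<in> C0 Q" "E t f \<in> C0 Q" for k using t fk(1) extension_in_C0[OF t f] by (auto intro: in_X)
  have L: "(\<lambda>k. norm (S t (fk k) - E t f)) \<longlonglongrightarrow> 0"
    using fk(4)[OF t] by (simp add: LIM_zero_iff tendsto_norm_zero_iff)
  have le: "norm (S r (S t (fk k)) - S r (E t f)) \<le> M * exp (- a * r) * norm (S t (fk k) - E t f)" for k
    using decay[OF r subspace_diff[OF subspace_C0 X]] S_diff[OF r X] by simp
  have "(\<lambda>k. S r (S t (fk k)) - S r (E t f)) \<longlonglongrightarrow> 0"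
    by (rule Lim_null_comparison[OF always_eventually tendsto_mult_right_zero[OF L]]) (use le in blast)
  then have "(\<lambda>k. S r (S t (fk k))) \<longlonglongrightarrow> S r (E t f)" by (rule LIM_zero_cancel)
  moreover have "(\<lambda>k. S (r + t) (fk k)) \<longlonglongrightarrow> E (r + t) f" using r t by (intro fk(4)) simp
  ultimately show ?thesis
    using S_plus[of r t] r t fk(1) LIMSEQ_unique by simp
qed

text \<open>Near \<open>t > 0\<close> the extension is an ordinary orbit, namely that of the element
  \<open>E (t / 2) f\<close> of \<open>C0 Q\<close>.\<close>

lemma continuous_on_extension:
  assumes f: "f \<in> Linf Q"
  shows "continuous_on {0<..} (\<lambda>t. E t f)"
proof (rule continuous_at_imp_continuous_on, rule ballI)
  fix t :: real assume "t \<in> {0<..}"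
  then have t: "0 < t" by simp
  have "continuous_on {t / 2<..} (\<lambda>r. S (r - t / 2) (E (t / 2) f))"
    by (rule continuous_on_compose2[OF continuous_on_orbit[OF extension_in_C0[OF _ f]]])
      (use t in \<open>auto intro!: continuous_intros\<close>)
  then have "continuous_on {t / 2<..} (\<lambda>r. E r f)"
    by (rule continuous_on_eq) (use t in \<open>simp add: extension_semigroup[OF _ _ f]\<close>)
  then show "isCont (\<lambda>t. E t f) t"
    using t by (simp add: continuous_on_eq_continuous_at)
qed

text \<open>For a fixed bounded function the dependence on time is continuous, a simple function
  takes finitely many values, and \<open>extension_dist\<close> carries strong approximation over to
  the images. The indicator keeps the time \<open>b - s\<close> positive.\<close>

lemma extension_measurable:
  assumes F: "strongly_measurable_Linf Q F" "range F \<subseteq> Linf Q"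
  shows "(\<lambda>s. indicator {..<b} s *\<^sub>R E (b - s) (F s)) \<in> borel_measurable lebesgue"
proof -
  obtain G where G: "\<And>k. simple_function lebesgue (G k)" "\<And>k. range (G k) \<subseteq> Linf Q"
    "AE s in lebesgue. (\<lambda>k. Linf_norm Q (\<lambda>x. G k s x - F s x)) \<longlonglongrightarrow> 0"
    using F(1) unfolding strongly_measurable_Linf_def by blast
  have fixed: "(\<lambda>s. indicator {..<b} s *\<^sub>R E (b - s) y) \<in> borel_measurable lebesgue" if y: "y \<in> Linf Q" for y
  proof -
    have "continuous_on {..<b} (\<lambda>s. E (b - s) y)"
      by (rule continuous_on_compose2[OF continuous_on_extension[OF y]]) (auto intro!: continuous_intros)
    then have "(\<lambda>s. indicator {..<b} s *\<^sub>R E (b - s) y) \<in> borel_measurable borel"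
      by (intro borel_measurable_continuous_on_indicator) auto
    then show ?thesis by (simp add: measurable_completion)
  qed
  have simple: "(\<lambda>s. indicator {..<b} s *\<^sub>R E (b - s) (G k s)) \<in> borel_measurable lebesgue" for k
  proof -
    have fin: "finite (range (G k))" using simple_functionD(1)[OF G(1)[of k]] by simp
    have "(\<lambda>s. indicator {..<b} s *\<^sub>R E (b - s) (G k s)) =
        (\<lambda>s. \<Sum>y\<in>range (G k). indicator (G k -` {y}) s *\<^sub>R (indicator {..<b} s *\<^sub>R E (b - s) y))"
    proof
      fix s
      have "(\<Sum>y\<in>range (G k). indicator (G k -` {y}) s *\<^sub>R (indicator {..<b} s *\<^sub>R E (b - s) y))
          = (\<Sum>y\<in>range (G k). if y = G k s then indicator {..<b} s *\<^sub>R E (b - s) y else 0)"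
        by (rule sum.cong) auto
      then show "indicator {..<b} s *\<^sub>R E (b - s) (G k s) =
          (\<Sum>y\<in>range (G k). indicator (G k -` {y}) s *\<^sub>R (indicator {..<b} s *\<^sub>R E (b - s) y))"
        using fin by simp
    qed
    moreover have "(\<lambda>s. \<Sum>y\<in>range (G k). indicator (G k -` {y}) s *\<^sub>R (indicator {..<b} s *\<^sub>R E (b - s) y)) \<in> borel_measurable lebesgue"
    proof (rule borel_measurable_sum)
      fix y assume "y \<in> range (G k)"
      then have y: "y \<in> Linf Q" using G(2)[of k] by auto
      have "G k -` {y} \<in> sets lebesgue"
        using simple_functionD(2)[OF G(1)[of k], of "{y}"] by simp
      then have "(indicator (G k -` {y}) :: real \<Rightarrow> real) \<in> borel_measurable lebesgue" by simp
      then show "(\<lambda>s. indicator (G k -` {y}) s *\<^sub>R (indicator {..<b} s *\<^sub>R E (b - s) y)) \<in> borel_measurable lebesgue"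
        using fixed[OF y] by (rule borel_measurable_scaleR)
    qed
    ultimately show ?thesis by simp
  qed
  show ?thesis
  proof (rule borel_measurable_lebesgue_AE_lim[OF simple])
    show "AE s in lebesgue. (\<lambda>k. indicator {..<b} s *\<^sub>R E (b - s) (G k s)) \<longlonglongrightarrow> indicator {..<b} s *\<^sub>R E (b - s) (F s)"
      using G(3)
    proof eventually_elim
      case (elim s)
      show ?case
      proof (cases "s < b")
        case True
        have GL: "G k s \<in> Linf Q" and FL: "F s \<in> Linf Q" for k using G(2) F(2) by blast+
        have le: "norm (E (b - s) (G k s) - E (b - s) (F s)) \<le> M * exp (- a * (b - s)) * Linf_norm Q (\<lambda>x. G k s x - F s x)" for k
          by (rule extension_dist[OF _ GL FL]) (use True in simp)
        have "(\<lambda>k. E (b - s) (G k s) - E (b - s) (F s)) \<longlonglongrightarrow> 0"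
          by (rule Lim_null_comparison[OF always_eventually tendsto_mult_right_zero[OF elim]]) (use le in blast)
        then have "(\<lambda>k. E (b - s) (G k s)) \<longlonglongrightarrow> E (b - s) (F s)" by (rule LIM_zero_cancel)
        then show ?thesis using True by simp
      qed simp
    qed
  qed
qed

text \<open>
  \<open>S t\<close> is only defined on a subspace, so its commuting with the integral is tested with functionals
  on the whole space that almost agree with the evaluations of \<open>S t\<close>.
\<close>

lemma S_integral:
  assumes t: "0 < t" and f: "integrable N f" and Sf: "integrable N (\<lambda>s. S t (f s))" and X: "\<And>s. f s \<in> C0 Q"
  shows "(LINT s|N. f s) \<in> C0 Q" "S t (LINT s|N. f s) = (LINT s|N. S t (f s))"
proof -
  have "apply_c0 (LINT s|N. f s) x = 0" if "x \<notin> Q" for x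
    using integral_bounded_linear[OF bounded_linear_apply_c0[of x] f] C0_zero[OF X that] by simp
  then show IX: "(LINT s|N. f s) \<in> C0 Q" by (simp add: C0_def)
  define c where "c = (LINT s|N. norm (f s))"
  have c: "0 \<le> c" unfolding c_def by (rule integral_nonneg_AE) simp
  have fc: "norm (LINT s|N. f s) \<le> c" unfolding c_def by (rule integral_norm_bound)
  show "S t (LINT s|N. f s) = (LINT s|N. S t (f s))"
  proof (rule c0_eqI)
    fix x
    have "\<bar>apply_c0 (S t (LINT s|N. f s)) x - apply_c0 (LINT s|N. S t (f s)) x\<bar> \<le> 0"
    proof (rule field_le_epsilon)
      fix \<epsilon> :: real assume \<epsilon>: "0 < \<epsilon>"
      define e where "e = \<epsilon> / (2 * (c + 1))"
      have e: "0 < e" "2 * (e * c) \<le> \<epsilon>" using \<epsilon> c by (auto simp: e_def field_simps)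
      obtain L where L: "bounded_linear L" "\<And>u. u \<in> C0 Q \<Longrightarrow> \<bar>apply_c0 (S t u) x - L u\<bar> \<le> e * norm u"
        using functional[OF t e(1)] by blast
      have iL: "integrable N (\<lambda>s. L (f s))" by (rule integrable_bounded_linear[OF L(1) f])
      have iS: "integrable N (\<lambda>s. apply_c0 (S t (f s)) x)"
        by (rule integrable_bounded_linear[OF bounded_linear_apply_c0 Sf])
      have "\<bar>apply_c0 (LINT s|N. S t (f s)) x - L (LINT s|N. f s)\<bar> = norm (LINT s|N. apply_c0 (S t (f s)) x - L (f s))"
        using integral_bounded_linear[OF bounded_linear_apply_c0[of x] Sf] integral_bounded_linear[OF L(1) f] iL iS by simp
      also have "\<dots> \<le> (LINT s|N. e * norm (f s))"
        using iL iS f L(2)[OF X]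
        by (intro order_trans[OF integral_norm_bound] integral_mono integrable_norm integrable_mult_right Bochner_Integration.integrable_diff) auto
      also have "\<dots> = e * c" by (simp add: c_def)
      finally have 1: "\<bar>apply_c0 (LINT s|N. S t (f s)) x - L (LINT s|N. f s)\<bar> \<le> e * c" .
      have 2: "\<bar>apply_c0 (S t (LINT s|N. f s)) x - L (LINT s|N. f s)\<bar> \<le> e * c"
        using L(2)[OF IX] mult_left_mono[OF fc, of e] e(1) by linarith
      show "\<bar>apply_c0 (S t (LINT s|N. f s)) x - apply_c0 (LINT s|N. S t (f s)) x\<bar> \<le> 0 + \<epsilon>"
        using 1 2 e(2) by linarith
    qed
    then show "apply_c0 (S t (LINT s|N. f s)) x = apply_c0 (LINT s|N. S t (f s)) x" by simp
  qed
qed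

end

section \<open>Translations and admissible paths\<close>

lemma lebesgue_shift:
  fixes t :: real
  shows "(\<lambda>s. s + t) \<in> lebesgue \<rightarrow>\<^sub>M lebesgue" "lebesgue = distr lebesgue lebesgue (\<lambda>s. s + t)"
proof -
  have e: "(\<lambda>s. t + 1 * s) = (\<lambda>s. s + t)" by (simp add: add.commute)
  show "(\<lambda>s. s + t) \<in> lebesgue \<rightarrow>\<^sub>M lebesgue"
    using lebesgue_affine_measurable[where c = "\<lambda>x::real. 1" and t = t] by (simp add: add.commute)
  have "lebesgue = density (distr lebesgue lebesgue (\<lambda>s. t + 1 * s)) (\<lambda>_. ennreal \<bar>1\<bar>)"
    by (rule lebesgue_real_affine) simp
  then show "lebesgue = distr lebesgue lebesgue (\<lambda>s. s + t)"
    unfolding e by (simp add: density_1)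
qed

lemma integrable_shift:
  fixes f :: "real \<Rightarrow> 'b::{banach, second_countable_topology}"
  assumes "integrable lebesgue f"
  shows "integrable lebesgue (\<lambda>s. f (s + t))" "(LINT s|lebesgue. f (s + t)) = (LINT s|lebesgue. f s)"
proof -
  have m: "f \<in> borel_measurable lebesgue" using assms by simp
  have "integrable (distr lebesgue lebesgue (\<lambda>s. s + t)) f" using assms lebesgue_shift(2)[of t] by simp
  then show "integrable lebesgue (\<lambda>s. f (s + t))"
    by (subst (asm) integrable_distr_eq[OF lebesgue_shift(1) m])
  have "(LINT s|lebesgue. f s) = (LINT s|distr lebesgue lebesgue (\<lambda>s. s + t). f s)" using lebesgue_shift(2)[of t] by simp
  also have "\<dots> = (LINT s|lebesgue. f (s + t))" by (rule integral_distr[OF lebesgue_shift(1) m])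
  finally show "(LINT s|lebesgue. f (s + t)) = (LINT s|lebesgue. f s)" by simp
qed

lemma AE_shift:
  fixes t :: real
  assumes "AE s in lebesgue. P s"
  shows "AE s in lebesgue. P (s + t)"
proof -
  have "AE s in distr lebesgue lebesgue (\<lambda>s. s + t). P s"
    by (subst lebesgue_shift(2)[of t, symmetric]) (rule assms)
  then show ?thesis by (rule AE_distrD[OF lebesgue_shift(1)])
qed

lemma AE_lebesgue_neq: "AE s in lebesgue. s \<noteq> (c :: real)"
  by (rule AE_completion) (rule AE_lborel_singleton)

lemma translate_translate: "translate s (translate t f) = translate (s + t) f"
  by (simp add: translate_def add.assoc)

lemma translate_0: "translate 0 f = f"
  by (simp add: translate_def)

lemma zfac_translate: "zfac \<alpha> s (translate t \<omega>) = zfac \<alpha> (s + t) \<omega>"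
  by (simp add: zfac_def translate_def)

lemma filterlim_shift_at_bot: "filterlim (\<lambda>s::real. s + r) at_bot at_bot"
  unfolding filterlim_at_bot eventually_at_bot_linorder
proof
  fix z show "\<exists>n. \<forall>s\<le>n. s + r \<le> z" by (rule exI[of _ "z - r"]) auto
qed

text \<open>What is kept of a noise path: both properties pass to translates, which need not vanish
  at 0 and so may leave \<Omega>.\<close>

definition sublinear_path :: "(real \<Rightarrow> real) \<Rightarrow> bool"
  where "sublinear_path p \<longleftrightarrow> continuous_on UNIV p \<and> ((\<lambda>s. p s / s) \<longlongrightarrow> 0) at_bot"

lemma sublinear_path_translate:
  assumes "sublinear_path p"
  shows "sublinear_path (translate r p)"
  unfolding sublinear_path_def
proof
  have c: "continuous_on UNIV p" and l: "((\<lambda>s. p s / s) \<longlongrightarrow> 0) at_bot"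
    using assms by (auto simp: sublinear_path_def)
  show "continuous_on UNIV (translate r p)"
    unfolding translate_def by (rule continuous_on_compose2[OF c]) (auto intro!: continuous_intros)
  have 1: "((\<lambda>s. p (s + r) / (s + r)) \<longlongrightarrow> 0) at_bot"
    by (rule filterlim_compose[OF l filterlim_shift_at_bot])
  have "((\<lambda>s. 1 + r / s) \<longlongrightarrow> 1 + 0) at_bot"
    by (intro tendsto_add tendsto_const tendsto_divide_0[OF tendsto_const] filterlim_at_bot_imp_at_infinity filterlim_ident)
  with 1 have "((\<lambda>s. p (s + r) / (s + r) * (1 + r / s)) \<longlongrightarrow> 0 * (1 + 0)) at_bot"
    by (rule tendsto_mult)
  then have 2: "((\<lambda>s. p (s + r) / (s + r) * (1 + r / s)) \<longlongrightarrow> 0) at_bot" by simp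
  show "((\<lambda>s. translate r p s / s) \<longlongrightarrow> 0) at_bot"
  proof (rule Lim_transform_eventually[OF 2])
    show "\<forall>\<^sub>F s in at_bot. p (s + r) / (s + r) * (1 + r / s) = translate r p s / s"
      unfolding eventually_at_bot_linorder
    proof (intro exI allI impI)
      fix s assume "s \<le> min (- 1) (- r - 1)"
      then have "s \<noteq> 0" "s + r \<noteq> 0" by auto
      then have "1 + r / s = (s + r) / s" by (simp add: field_simps)
      then show "p (s + r) / (s + r) * (1 + r / s) = translate r p s / s"
        using \<open>s + r \<noteq> 0\<close> by (simp add: translate_def)
    qed
  qed
qed

text \<open>Far out, \<alpha> |p r| is at most e |r| by sublinearity, and the remaining interval is
  compact. The rate \<open>e\<close> can thus be fitted into the gap between \<delta> and the decay
  rate.\<close>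

lemma zfac_bound:
  assumes p: "sublinear_path p" and \<alpha>: "0 < \<alpha>" and e: "0 < e"
  obtains C where "0 < C" "\<And>r. r \<le> b \<Longrightarrow> zfac \<alpha> r p \<le> C * exp (- e * r)"
proof -
  have c: "continuous_on UNIV p" and l: "((\<lambda>s. p s / s) \<longlongrightarrow> 0) at_bot"
    using p by (auto simp: sublinear_path_def)
  obtain r0 where r0: "\<And>r. r \<le> r0 \<Longrightarrow> \<bar>p r / r\<bar> < e / \<alpha>"
    using tendstoD[OF l, of "e / \<alpha>"] \<alpha> e by (auto simp: eventually_at_bot_linorder)
  define m where "m = min r0 (- 1)"
  have far: "zfac \<alpha> r p \<le> 1 * exp (- e * r)" if "r \<le> m" for r
  proof -
    have r: "r \<le> r0" "r < 0" using that by (auto simp: m_def)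
    have "\<bar>p r\<bar> / \<bar>r\<bar> < e / \<alpha>" using r0[OF r(1)] by simp
    then have "\<alpha> * \<bar>p r\<bar> \<le> e * \<bar>r\<bar>" using r \<alpha> by (simp add: field_simps)
    moreover have "- \<alpha> * p r \<le> \<alpha> * \<bar>p r\<bar>" using \<alpha> by (simp add: abs_if)
    ultimately have "- \<alpha> * p r \<le> - e * r" using r by simp
    then show ?thesis by (simp add: zfac_def)
  qed
  have "continuous_on {m..b} (\<lambda>r. zfac \<alpha> r p * exp (e * r))"
    unfolding zfac_def by (intro continuous_intros continuous_on_subset[OF c]) auto
  then have "bounded ((\<lambda>r. zfac \<alpha> r p * exp (e * r)) ` {m..b})"
    by (intro compact_imp_bounded compact_continuous_image) auto
  then obtain B where "\<forall>y\<in>(\<lambda>r. zfac \<alpha> r p * exp (e * r)) ` {m..b}. norm y \<le> B"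
    unfolding bounded_iff by blast
  then have B: "zfac \<alpha> r p * exp (e * r) \<le> B" if "r \<in> {m..b}" for r
    using that by (auto simp: abs_le_iff)
  show thesis
  proof
    show "0 < max 1 B" by simp
    fix r assume r: "r \<le> b"
    show "zfac \<alpha> r p \<le> max 1 B * exp (- e * r)"
    proof (cases "r \<le> m")
      case True
      have "1 * exp (- e * r) \<le> max 1 B * exp (- e * r)" by (intro mult_right_mono) auto
      then show ?thesis using far[OF True] by linarith
    next
      case False
      then have "zfac \<alpha> r p * exp (e * r) * exp (- e * r) \<le> max 1 B * exp (- e * r)"
        using B[of r] r by (intro mult_right_mono) auto
      then show ?thesis by (simp add: mult.assoc exp_minus)
    qed
  qed
qed

section \<open>The quasi-solution\<close>

locale forced_semigroup = smoothing_semigroup Q S M a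
  for Q :: "'a::euclidean_space set" and S M a +
  fixes \<alpha> \<delta> :: real and g h :: "real \<Rightarrow> 'a \<Rightarrow> real"
  assumes \<alpha>: "0 < \<alpha>" and \<delta>: "0 < \<delta>" "\<delta> < a"
    and g: "g \<in> L1loc_Linf Q" and h: "h \<in> L1loc_Linf Q"
    and integrable: "\<And>\<tau>. set_integrable lebesgue {..\<tau>} (\<lambda>s. exp (\<delta> * s) * (Linf_norm Q (g s) + Linf_norm Q (h s)))"
    and growth: "\<And>c. c > 0 \<Longrightarrow> ((\<lambda>r. exp (c * r) * (LINT s:{..0}|lebesgue.
        exp (\<delta> * s) * (Linf_norm Q (g (s + r)) + Linf_norm Q (h (s + r))))) \<longlongrightarrow> 0) at_bot"
begin

definition F :: "real \<Rightarrow> 'a \<Rightarrow> real" where "F r = (\<lambda>x. h r x + \<bar>g r x\<bar>)"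
definition N :: "real \<Rightarrow> real" where "N r = Linf_norm Q (g r) + Linf_norm Q (h r)"

text \<open>In absolute time, along the path \<open>p = \<omega>\<^bsup>-t\<^esup>\<close>, the quasi-solution at time \<open>t\<close> is \<open>K t p\<close>.\<close>

definition kernel :: "real \<Rightarrow> (real \<Rightarrow> real) \<Rightarrow> real \<Rightarrow> 'a c0"
  where "kernel t p r = indicator {..<t} r *\<^sub>R (zfac \<alpha> r p *\<^sub>R E (t - r) (F r))"

definition K :: "real \<Rightarrow> (real \<Rightarrow> real) \<Rightarrow> 'a c0"
  where "K t p = (LINT r|lebesgue. kernel t p r)"

lemma gL: "g r \<in> Linf Q" and hL: "h r \<in> Linf Q"
  using g h by (auto simp: L1loc_Linf_def)

lemma FL: "F r \<in> Linf Q"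
  unfolding F_def by (rule Linf_forcing(1)[OF hL gL])

lemma F_norm: "Linf_norm Q (F r) \<le> N r"
  using Linf_forcing(2)[OF hL gL, of r r] by (simp add: F_def N_def)

lemma N_nonneg: "0 \<le> N r"
  unfolding N_def by (intro add_nonneg_nonneg Linf_norm_nonneg gL hL)

lemma kernel_in_C0: "kernel t p r \<in> C0 Q"
  unfolding kernel_def
  by (cases "r < t") (auto intro!: subspace_scale[OF subspace_C0] extension_in_C0 FL subspace_0[OF subspace_C0])

lemma kernel_measurable:
  assumes p: "continuous_on UNIV p"
  shows "kernel t p \<in> borel_measurable lebesgue"
proof -
  have F: "strongly_measurable_Linf Q F"
    unfolding F_def[abs_def]
    by (rule strongly_measurable_forcing) (use g h in \<open>auto simp: L1loc_Linf_def\<close>)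
  have e: "(\<lambda>s. indicator {..<t} s *\<^sub>R E (t - s) (F s)) \<in> borel_measurable lebesgue"
    by (rule extension_measurable[OF F]) (use FL in blast)
  have "(\<lambda>s. zfac \<alpha> s p) \<in> borel_measurable borel"
    unfolding zfac_def by (intro borel_measurable_continuous_onI continuous_intros p)
  then have "(\<lambda>s. zfac \<alpha> s p) \<in> borel_measurable lebesgue" by (simp add: measurable_completion)
  from borel_measurable_scaleR[OF this e]
  have "(\<lambda>s. zfac \<alpha> s p *\<^sub>R (indicator {..<t} s *\<^sub>R E (t - s) (F s))) \<in> borel_measurable lebesgue" .
  then show ?thesis by (simp add: kernel_def[abs_def] mult.commute)
qed

text \<open>Of the decay rate \<open>a\<close> the part \<open>\<delta> + e\<close> is used:
  \<open>e\<close> absorbs the growth of the noise factor, and \<delta> leaves exactly the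
  integrable weight \<open>exp (\<delta> * r) * N r\<close>. The parameter \<open>e\<close> stays
  free because integrability and temperedness choose it differently.\<close>

lemma kernel_bound:
  assumes nn: "0 \<le> C" and C: "\<And>r. r \<le> b \<Longrightarrow> zfac \<alpha> r p \<le> C * exp (- e * r)" and t: "t \<le> b" and e: "e \<le> a - \<delta>"
  shows "norm (kernel t p r) \<le> C * M * exp (- (\<delta> + e) * t) * (indicator {..t} r * (exp (\<delta> * r) * N r))"
proof (cases "r < t")
  case True
  have C0: "0 \<le> C * exp (- e * r)" using nn by simp
  have "norm (kernel t p r) = zfac \<alpha> r p * norm (E (t - r) (F r))"
    using True by (simp add: kernel_def zfac_def)
  also have "\<dots> \<le> (C * exp (- e * r)) * (M * exp (- a * (t - r)) * N r)"
  proof (intro mult_mono C C0)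
    have "norm (E (t - r) (F r)) \<le> M * exp (- a * (t - r)) * Linf_norm Q (F r)"
      by (rule extension_bound[OF _ FL]) (use True in simp)
    also have "\<dots> \<le> M * exp (- a * (t - r)) * N r" using M by (intro mult_left_mono F_norm) simp
    finally show "norm (E (t - r) (F r)) \<le> M * exp (- a * (t - r)) * N r" .
  qed (use True t in auto)
  also have "\<dots> = (C * exp (- e * r)) * (M * N r) * exp (- a * (t - r))" by simp
  also have "\<dots> \<le> (C * exp (- e * r)) * (M * N r) * exp (- (\<delta> + e) * (t - r))"
  proof (intro mult_left_mono mult_nonneg_nonneg nn N_nonneg)
    have "(\<delta> + e) * (t - r) \<le> a * (t - r)" using e True by (intro mult_right_mono) auto
    then have "- a * (t - r) \<le> - (\<delta> + e) * (t - r)" by (simp only: minus_mult_left[symmetric] neg_le_iff_le)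
    then show "exp (- a * (t - r)) \<le> exp (- (\<delta> + e) * (t - r))" by (simp only: exp_le_cancel_iff)
  qed (use M in auto)
  also have "\<dots> = C * M * N r * (exp (- e * r) * exp (- (\<delta> + e) * (t - r)))" by simp
  also have "exp (- e * r) * exp (- (\<delta> + e) * (t - r)) = exp (- (\<delta> + e) * t) * exp (\<delta> * r)"
    by (simp add: mult_exp_exp algebra_simps)
  finally show ?thesis using True by (simp add: mult_ac)
next
  case False
  then show ?thesis using nn M N_nonneg[of r] by (simp add: kernel_def)
qed

lemma integrable_N: "Bochner_Integration.integrable lebesgue (\<lambda>r. indicator {..t} r * (exp (\<delta> * r) * N r))"
  using integrable[of t] by (simp add: set_integrable_def N_def)

lemma kernel_integrable:
  assumes p: "sublinear_path p"
  shows "Bochner_Integration.integrable lebesgue (kernel t p)"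
proof -
  have e: "0 < a - \<delta>" using \<delta> by simp
  obtain C where C: "0 < C" "\<And>r. r \<le> t \<Longrightarrow> zfac \<alpha> r p \<le> C * exp (- (a - \<delta>) * r)"
    by (rule zfac_bound[OF p \<alpha> e]) blast
  show ?thesis
  proof (rule Bochner_Integration.integrable_bound)
    show "Bochner_Integration.integrable lebesgue (\<lambda>r. C * M * exp (- (\<delta> + (a - \<delta>)) * t) * (indicator {..t} r * (exp (\<delta> * r) * N r)))"
      by (intro integrable_mult_right integrable_N)
    show "kernel t p \<in> borel_measurable lebesgue"
      using p by (intro kernel_measurable) (simp add: sublinear_path_def)
    show "AE r in lebesgue. norm (kernel t p r) \<le> norm (C * M * exp (- (\<delta> + (a - \<delta>)) * t) * (indicator {..t} r * (exp (\<delta> * r) * N r)))"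
    proof (rule AE_I2)
      fix r
      show "norm (kernel t p r) \<le> norm (C * M * exp (- (\<delta> + (a - \<delta>)) * t) * (indicator {..t} r * (exp (\<delta> * r) * N r)))"
        unfolding real_norm_def by (rule order_trans[OF kernel_bound[OF less_imp_le[OF C(1)] C(2)] abs_ge_self]) auto
    qed
  qed
qed

text \<open>\<open>S s\<close> moves the terminal time to \<open>s + t\<close> but leaves the cut at
  \<open>t\<close>, so the integral up to \<open>t\<close> becomes the past part of the later
  integral.\<close>

lemma S_kernel:
  assumes s: "0 < s"
  shows "S s (kernel t p r) = indicator {..<t} r *\<^sub>R kernel (s + t) p r"
proof (cases "r < t")
  case True
  have "E (t - r) (F r) \<in> C0 Q" by (rule extension_in_C0[OF _ FL]) (use True in simp)
  then have "S s (kernel t p r) = zfac \<alpha> r p *\<^sub>R S s (E (t - r) (F r))"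
    using True s by (simp add: kernel_def S_scale)
  also have "S s (E (t - r) (F r)) = E (s + t - r) (F r)"
    using extension_semigroup[OF less_imp_le[OF s] _ FL, of "t - r" r] True by (simp add: add_diff_eq)
  finally show ?thesis using True s by (simp add: kernel_def)
next
  case False
  then show ?thesis using S_zero[of s] s by (simp add: kernel_def)
qed

lemma K_in_C0:
  assumes p: "sublinear_path p"
  shows "K t p \<in> C0 Q"
proof -
  have "Bochner_Integration.integrable lebesgue (\<lambda>r. S 1 (kernel t p r))"
    unfolding S_kernel[OF zero_less_one] by (intro integrable_mult_indicator kernel_integrable p) auto
  then show ?thesis unfolding K_def
    by (intro S_integral(1)[OF zero_less_one kernel_integrable[OF p]] kernel_in_C0)
qed

lemma mild_solution_kernel:
  "mild_solution Q S \<alpha> t \<tau> p g h v = S (t - \<tau>) v + (LINT r|lebesgue. indicator {\<tau>..} r *\<^sub>R kernel t p r)"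
  if p: "sublinear_path p"
proof -
  have i: "Bochner_Integration.integrable lebesgue (\<lambda>r. indicator {\<tau>..} r *\<^sub>R kernel t p r)"
    by (intro integrable_mult_indicator kernel_integrable p) auto
  \<comment> \<open>The kernel stops short of \<open>t\<close>, while the mild solution integrates
    up to it; at \<open>r = t\<close> the extension may be unspecified, but a single point is a null
    set.\<close>
  have ae: "AE r in lebesgue. indicator {\<tau>..} r *\<^sub>R kernel t p r = indicator {\<tau>..t} r *\<^sub>R (zfac \<alpha> r p *\<^sub>R E (t - r) (F r))"
    using AE_lebesgue_neq[of t] by eventually_elim (auto simp: kernel_def indicator_def)
  have m: "(\<lambda>r. indicator {\<tau>..} r *\<^sub>R kernel t p r) \<in> borel_measurable lebesgue" using i by simp
  have "(LINT r|lebesgue. indicator {\<tau>..} r *\<^sub>R kernel t p r) = (LINT r:{\<tau>..t}|lebesgue. zfac \<alpha> r p *\<^sub>R E (t - r) (F r))"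
    unfolding set_lebesgue_integral_def
    by (rule integral_cong_AE[OF m borel_measurable_lebesgue_AE[OF m ae] ae])
  then show ?thesis by (simp add: mild_solution_def F_def)
qed

text \<open>Split the integral for time \<open>s + \<tau>\<close> at \<tau>: the past is
  \<open>S s\<close> applied to \<open>K \<tau> p\<close>, the rest is the Duhamel term.\<close>

lemma K_mild:
  assumes p: "sublinear_path p" and s: "0 < s"
  shows "mild_solution Q S \<alpha> (s + \<tau>) \<tau> p g h (K \<tau> p) = K (s + \<tau>) p"
proof -
  have i: "Bochner_Integration.integrable lebesgue (\<lambda>r. indicator A r *\<^sub>R kernel (s + \<tau>) p r)" if "A \<in> sets lebesgue" for A
    using that by (intro integrable_mult_indicator kernel_integrable p) auto
  have "S s (K \<tau> p) = (LINT r|lebesgue. indicator {..<\<tau>} r *\<^sub>R kernel (s + \<tau>) p r)"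
    unfolding K_def S_kernel[OF s, symmetric]
    by (rule S_integral(2)[OF s kernel_integrable[OF p] _ kernel_in_C0]) (use i in \<open>simp add: S_kernel[OF s]\<close>)
  then have "mild_solution Q S \<alpha> (s + \<tau>) \<tau> p g h (K \<tau> p) =
      (LINT r|lebesgue. indicator {..<\<tau>} r *\<^sub>R kernel (s + \<tau>) p r) + (LINT r|lebesgue. indicator {\<tau>..} r *\<^sub>R kernel (s + \<tau>) p r)"
    by (simp add: mild_solution_kernel[OF p])
  also have "\<dots> = (LINT r|lebesgue. indicator {..<\<tau>} r *\<^sub>R kernel (s + \<tau>) p r + indicator {\<tau>..} r *\<^sub>R kernel (s + \<tau>) p r)"
    by (rule Bochner_Integration.integral_add[symmetric]) (intro i; simp)+
  also have "\<dots> = K (s + \<tau>) p"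
    unfolding K_def by (rule Bochner_Integration.integral_cong) (auto simp: indicator_def)
  finally show ?thesis .
qed

lemma mild_diff:
  assumes p: "sublinear_path p" and v: "v \<in> C0 Q" and w: "w \<in> C0 Q" and t: "\<tau> \<le> t"
  shows "norm (mild_solution Q S \<alpha> t \<tau> p g h v - mild_solution Q S \<alpha> t \<tau> p g h w)
    \<le> M * exp (- a * (t - \<tau>)) * (norm v + norm w)"
proof -
  have "mild_solution Q S \<alpha> t \<tau> p g h v - mild_solution Q S \<alpha> t \<tau> p g h w = S (t - \<tau>) (v - w)"
    using S_diff[of "t - \<tau>" v w] v w t by (simp add: mild_solution_kernel[OF p])
  moreover have "norm (S (t - \<tau>) (v - w)) \<le> M * exp (- a * (t - \<tau>)) * norm (v - w)"
    by (rule decay) (use t v w in \<open>auto intro: subspace_diff[OF subspace_C0]\<close>)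
  moreover have "M * exp (- a * (t - \<tau>)) * norm (v - w) \<le> M * exp (- a * (t - \<tau>)) * (norm v + norm w)"
    using M by (intro mult_left_mono norm_triangle_ineq4) simp
  ultimately show ?thesis by simp
qed

lemma K_growth:
  assumes p: "sublinear_path p" and c: "0 < c"
  shows "((\<lambda>t. exp (c * t) * norm (K t p)) \<longlongrightarrow> 0) at_bot"
proof -
  \<comment> \<open>At most half of \<open>c\<close> goes to the noise: after a shift of time the
    exponential factors combine to \<open>exp ((c - e) * t)\<close>, and the growth assumption needs
    \<open>c - e > 0\<close>.\<close>
  define e where "e = min (a - \<delta>) (c / 2)"
  have e: "0 < e" "e \<le> a - \<delta>" "0 < c - e" using \<delta> c by (auto simp: e_def)
  obtain C where C: "0 < C" "\<And>r. r \<le> 0 \<Longrightarrow> zfac \<alpha> r p \<le> C * exp (- e * r)"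
    by (rule zfac_bound[OF p \<alpha> e(1)]) blast
  define D where "D t = (LINT s:{..0}|lebesgue. exp (\<delta> * s) * (Linf_norm Q (g (s + t)) + Linf_norm Q (h (s + t))))" for t
  have bound: "norm (exp (c * t) * norm (K t p)) \<le> C * M * (exp ((c - e) * t) * D t)" if t: "t \<le> 0" for t
  proof -
    have "norm (K t p) \<le> (LINT r|lebesgue. norm (kernel t p r))" unfolding K_def by (rule integral_norm_bound)
    also have "\<dots> \<le> (LINT r|lebesgue. C * M * exp (- (\<delta> + e) * t) * (indicator {..t} r * (exp (\<delta> * r) * N r)))"
      by (intro integral_mono integrable_norm kernel_integrable p integrable_mult_right integrable_N kernel_bound[OF less_imp_le[OF C(1)] C(2) t e(2)])
    also have "\<dots> = C * M * exp (- (\<delta> + e) * t) * (LINT r|lebesgue. indicator {..t} r * (exp (\<delta> * r) * N r))" by simp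
    also have "(LINT r|lebesgue. indicator {..t} r * (exp (\<delta> * r) * N r)) = (LINT s|lebesgue. indicator {..t} (s + t) * (exp (\<delta> * (s + t)) * N (s + t)))"
      by (rule integrable_shift(2)[OF integrable_N, symmetric])
    also have "\<dots> = (LINT s|lebesgue. exp (\<delta> * t) * (indicator {..0} s * (exp (\<delta> * s) * N (s + t))))"
      by (rule Bochner_Integration.integral_cong) (auto simp: indicator_def distrib_left exp_add)
    also have "\<dots> = exp (\<delta> * t) * D t" by (simp add: D_def N_def set_lebesgue_integral_def)
    finally have "norm (K t p) \<le> C * M * exp (- (\<delta> + e) * t) * (exp (\<delta> * t) * D t)" .
    then have "exp (c * t) * norm (K t p) \<le> exp (c * t) * (C * M * exp (- (\<delta> + e) * t) * (exp (\<delta> * t) * D t))"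
      by (intro mult_left_mono) auto
    also have "\<dots> = C * M * ((exp (c * t) * exp (- (\<delta> + e) * t) * exp (\<delta> * t)) * D t)" by simp
    also have "exp (c * t) * exp (- (\<delta> + e) * t) * exp (\<delta> * t) = exp ((c - e) * t)"
      by (simp add: mult_exp_exp algebra_simps)
    finally show ?thesis by simp
  qed
  have "((\<lambda>t. C * M * (exp ((c - e) * t) * D t)) \<longlongrightarrow> 0) at_bot"
    unfolding D_def by (intro tendsto_mult_right_zero growth e)
  then show ?thesis
    by (rule Lim_null_comparison[rotated]) (use bound in \<open>auto simp: eventually_at_bot_linorder intro!: exI[of _ 0]\<close>)
qed

section \<open>The quasi-solution in relative time\<close>

definition \<xi> :: "real \<Rightarrow> (real \<Rightarrow> real) \<Rightarrow> 'a c0"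
  where "\<xi> t \<omega> = (LINT s:{..0}|lebesgue. zfac \<alpha> s \<omega> *\<^sub>R E \<bar>s\<bar> (\<lambda>x. translate t h s x + \<bar>translate t g s x\<bar>))"

text \<open>Substitute \<open>r = s + t\<close>: the path translated by -t takes at
  \<open>s + t\<close> the value of \<omega> at \<open>s\<close>. The integrands agree except
  perhaps at \<open>s = 0\<close>.\<close>

lemma \<xi>_integrable_K:
  assumes \<omega>: "sublinear_path \<omega>"
  shows "set_integrable lebesgue {..0} (\<lambda>s. zfac \<alpha> s \<omega> *\<^sub>R E \<bar>s\<bar> (\<lambda>x. translate t h s x + \<bar>translate t g s x\<bar>))"
    and "\<xi> t \<omega> = K t (translate (- t) \<omega>)"
proof -
  define p where "p = translate (- t) \<omega>"
  have p: "sublinear_path p" unfolding p_def by (rule sublinear_path_translate[OF \<omega>])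
  have i: "Bochner_Integration.integrable lebesgue (\<lambda>s. kernel t p (s + t))"
    by (rule integrable_shift(1)[OF kernel_integrable[OF p]])
  then have m: "(\<lambda>s. kernel t p (s + t)) \<in> borel_measurable lebesgue" by simp
  have ae: "AE s in lebesgue. kernel t p (s + t) =
      indicator {..0} s *\<^sub>R (zfac \<alpha> s \<omega> *\<^sub>R E \<bar>s\<bar> (\<lambda>x. translate t h s x + \<bar>translate t g s x\<bar>))"
    using AE_lebesgue_neq[of 0]
  proof eventually_elim
    case (elim s)
    have "zfac \<alpha> (s + t) p = zfac \<alpha> s \<omega>" by (simp add: p_def zfac_translate)
    then show ?case
      using elim by (cases "s < 0") (auto simp: kernel_def F_def translate_def)
  qed
  show "set_integrable lebesgue {..0} (\<lambda>s. zfac \<alpha> s \<omega> *\<^sub>R E \<bar>s\<bar> (\<lambda>x. translate t h s x + \<bar>translate t g s x\<bar>))"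
    unfolding set_integrable_def
    by (rule Bochner_Integration.integrable_cong_AE_imp[OF i borel_measurable_lebesgue_AE[OF m ae]]) (use ae in \<open>auto elim!: eventually_mono\<close>)
  have "\<xi> t \<omega> = (LINT s|lebesgue. kernel t p (s + t))"
    unfolding \<xi>_def set_lebesgue_integral_def
    by (rule integral_cong_AE[OF m borel_measurable_lebesgue_AE[OF m ae] ae, symmetric])
  also have "\<dots> = K t p" unfolding K_def by (rule integrable_shift(2)[OF kernel_integrable[OF p]])
  finally show "\<xi> t \<omega> = K t (translate (- t) \<omega>)" by (simp add: p_def)
qed

lemma \<xi>_in_C0: "sublinear_path \<omega> \<Longrightarrow> \<xi> t \<omega> \<in> C0 Q"
  by (simp add: \<xi>_integrable_K(2) K_in_C0 sublinear_path_translate)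

text \<open>In absolute time, \<omega> at time \<tau> and its translate by \<open>t\<close> at time
  \<open>\<tau> + t\<close> give the same path \<open>translate (- \<tau>) \<omega>\<close>, so this
  is \<open>K_mild\<close> along one path.\<close>

lemma \<xi>_mild:
  assumes \<omega>: "sublinear_path \<omega>" and t: "0 < t"
  shows "mild_solution Q S \<alpha> (t + \<tau>) \<tau> (translate (- \<tau>) \<omega>) g h (\<xi> \<tau> \<omega>) = \<xi> (\<tau> + t) (translate t \<omega>)"
  using K_mild[OF sublinear_path_translate[OF \<omega>] t, of \<tau> "- \<tau>"]
  by (simp add: \<xi>_integrable_K(2) \<omega> sublinear_path_translate translate_translate add.commute)

text \<open>The path in absolute time does not move with \<open>t\<close>, so
  \<open>K_growth\<close> applies; replacing \<open>t\<close> by \<open>\<tau> + t\<close> costs the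
  factor exp(-c\<tau>).\<close>

lemma \<xi>_tempered:
  assumes \<omega>: "sublinear_path \<omega>" and c: "0 < c"
  shows "((\<lambda>t. exp (c * t) * norm (\<xi> (\<tau> + t) (translate t \<omega>))) \<longlongrightarrow> 0) at_bot"
proof -
  have shift: "filterlim (\<lambda>t::real. \<tau> + t) at_bot at_bot"
    using filterlim_shift_at_bot[of \<tau>] by (simp add: add.commute)
  have "((\<lambda>t. exp (c * (\<tau> + t)) * norm (K (\<tau> + t) (translate (- \<tau>) \<omega>))) \<longlongrightarrow> 0) at_bot"
    by (rule filterlim_compose[OF K_growth[OF sublinear_path_translate[OF \<omega>] c] shift])
  then have "((\<lambda>t. exp (- (c * \<tau>)) * (exp (c * (\<tau> + t)) * norm (K (\<tau> + t) (translate (- \<tau>) \<omega>)))) \<longlongrightarrow> 0) at_bot"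
    by (rule tendsto_mult_right_zero)
  moreover have "exp (- (c * \<tau>)) * (exp (c * (\<tau> + t)) * norm (K (\<tau> + t) (translate (- \<tau>) \<omega>))) =
      exp (c * t) * norm (\<xi> (\<tau> + t) (translate t \<omega>))" for t
    by (simp add: \<xi>_integrable_K(2) \<omega> sublinear_path_translate translate_translate mult.assoc[symmetric] mult_exp_exp algebra_simps)
  ultimately show ?thesis by simp
qed

text \<open>Periodicity holds up to null sets only; the extension ignores those in space and the
  integral those in time.\<close>

lemma \<xi>_periodic:
  assumes \<omega>: "sublinear_path \<omega>"
    and gT: "AE s in lebesgue. AE x in lebesgue_on Q. g (s + T) x = g s x"
    and hT: "AE s in lebesgue. AE x in lebesgue_on Q. h (s + T) x = h s x"
  shows "\<xi> (t + T) \<omega> = \<xi> t \<omega>"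
  unfolding \<xi>_def set_lebesgue_integral_def
proof (rule integral_cong_AE)
  show "AE s in lebesgue. indicator {..0} s *\<^sub>R (zfac \<alpha> s \<omega> *\<^sub>R E \<bar>s\<bar> (\<lambda>x. translate (t + T) h s x + \<bar>translate (t + T) g s x\<bar>)) =
      indicator {..0} s *\<^sub>R (zfac \<alpha> s \<omega> *\<^sub>R E \<bar>s\<bar> (\<lambda>x. translate t h s x + \<bar>translate t g s x\<bar>))"
    using AE_shift[OF gT, of t] AE_shift[OF hT, of t] AE_lebesgue_neq[of 0]
  proof eventually_elim
    case (elim s)
    show ?case
    proof (cases "s < 0")
      case True
      have "E \<bar>s\<bar> (F (s + t + T)) = E \<bar>s\<bar> (F (s + t))"
      proof (rule extension_cong[OF _ FL FL])
        show "AE x in lebesgue_on Q. F (s + t + T) x = F (s + t) x"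
          using elim(1,2) by eventually_elim (simp add: F_def)
      qed (use True in simp)
      then show ?thesis by (simp add: F_def translate_def add.assoc)
    qed (use elim in auto)
  qed
qed (use \<xi>_integrable_K(1)[OF \<omega>] in \<open>auto simp: set_integrable_def\<close>)

end

section \<open>Passage from the semigroup of A to the heat semigroup\<close>

lemma smoothing_semigroup_of_A:
  fixes Q :: "'a::euclidean_space set"
  assumes Q: "open Q" "bounded Q" and eig: "first_dirichlet_eigenvalue Q lam" and lam: "0 \<le> lam"
    and sg: "semigroup_of_A Q \<beta> S"
  obtains M where "smoothing_semigroup Q S M (lam - \<beta>)"
proof -
  have S: "semigroup_on (C0 Q) S"
    using sg by (simp add: semigroup_on_def closed_C0 subspace_C0 semigroup_of_A_def)
  \<comment> \<open>The generator of \<open>S\<close> is the Laplacian plus \<beta>, and the factor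
    exp(-\<beta>t) removes the shift.\<close>
  define T where "T = (\<lambda>t u. exp (- \<beta> * t) *\<^sub>R S t u)"
  have T: "semigroup_on (C0 Q) T" "generator_on (C0 Q) T = {(u, f + (- \<beta>) *\<^sub>R u) | u f. (u, f) \<in> generator_on (C0 Q) S}"
    unfolding T_def by (rule semigroup_on_rescale[OF S])+
  have "generator_on (C0 Q) S = {(u, - (f - \<beta> *\<^sub>R u)) | u f. (u, f) \<in> dirichlet_neg_laplacian Q}"
    using sg unfolding semigroup_of_A_def A_op_def by force
  then have gen: "generator_on (C0 Q) T = {(u, - f) | u f. (u, f) \<in> dirichlet_neg_laplacian Q}"
    unfolding T(2) by force
  interpret D: dirichlet_semigroup Q T
    by (intro dirichlet_semigroup.intro dirichlet_semigroup_axioms.intro T(1) Q gen)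
  have ST: "S t u = exp (\<beta> * t) *\<^sub>R T t u" for t u
    by (simp add: T_def mult_exp_exp)
  obtain M where M: "0 < M" "\<And>t u. 0 \<le> t \<Longrightarrow> u \<in> C0 Q \<Longrightarrow> norm (T t u) \<le> M * exp (- lam * t) * norm u"
    by (rule D.decay[of lam]) (use eig lam in \<open>auto simp: first_dirichlet_eigenvalue_def\<close>)
  have "smoothing_semigroup Q S M (lam - \<beta>)"
  proof (intro smoothing_semigroup.intro smoothing_semigroup_axioms.intro S Q M(1))
    fix t :: real and u assume tu: "0 \<le> t" "u \<in> C0 Q"
    have "norm (S t u) \<le> exp (\<beta> * t) * (M * exp (- lam * t) * norm u)"
      using mult_left_mono[OF M(2)[OF tu], of "exp (\<beta> * t)"] by (simp add: ST)
    also have "\<dots> = M * (exp (\<beta> * t) * exp (- lam * t)) * norm u" by simp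
    also have "exp (\<beta> * t) * exp (- lam * t) = exp (- (lam - \<beta>) * t)" by (simp add: mult_exp_exp algebra_simps)
    finally show "norm (S t u) \<le> M * exp (- (lam - \<beta>) * t) * norm u" .
  next
    fix t :: real and h :: "nat \<Rightarrow> 'a c0" and B l
    assume a: "0 < t" "\<And>k. h k \<in> C0 Q" "\<And>k x. \<bar>apply_c0 (h k) x\<bar> \<le> B"
      "l \<in> borel_measurable (lebesgue_on Q)" "AE x in lebesgue_on Q. (\<lambda>k. apply_c0 (h k) x) \<longlonglongrightarrow> l x"
    obtain w where w: "w \<in> C0 Q" "(\<lambda>k. T t (h k)) \<longlonglongrightarrow> w"
      by (rule D.smoothing_Cauchy[of t h B l, OF a(1) a(2) a(3) a(4) a(5)]) blast
    then have "(\<lambda>k. S t (h k)) \<longlonglongrightarrow> exp (\<beta> * t) *\<^sub>R w"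
      unfolding ST by (intro tendsto_intros)
    then show "\<exists>w\<in>C0 Q. (\<lambda>k. S t (h k)) \<longlonglongrightarrow> w"
      using w(1) subspace_scale[OF subspace_C0] by blast
  next
    fix t e :: real and x assume t: "0 < t" and e: "0 < e"
    define m where "m = sqrt (measure lborel Q) + 1"
    have m: "0 < m" by (simp add: m_def add_nonneg_pos)
    \<comment> \<open>The divisors compensate the factor exp(\<beta>t) and the passage from the L2
      norm to the supremum norm.\<close>
    define \<epsilon> where "\<epsilon> = e / (exp (\<beta> * t) * m)"
    have \<epsilon>: "0 < \<epsilon>" using e m by (simp add: \<epsilon>_def)
    obtain C where C: "0 < C" "\<And>u. u \<in> C0 Q \<Longrightarrow> norm (T t u) \<le> C * sqrt (ip Q u u)"
      by (rule D.L2_Linf[OF t]) blast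
    obtain w where w: "w \<in> C0 Q" "\<And>u. u \<in> C0 Q \<Longrightarrow> \<bar>apply_c0 (T t u) x - ip Q u w\<bar> \<le> \<epsilon> * sqrt (ip Q u u)"
    proof (rule D.approximate_Riesz[OF D.linear_on_apply[of t x], of C \<epsilon>])
      show "\<bar>apply_c0 (T t u) x\<bar> \<le> C * sqrt (ip Q u u)" if "u \<in> C0 Q" for u
        using C(2)[OF that] norm_c0_bounded[of "T t u" x] by linarith
    qed (use t \<epsilon> in auto)
    show "\<exists>L. bounded_linear L \<and> (\<forall>u\<in>C0 Q. \<bar>apply_c0 (S t u) x - L u\<bar> \<le> e * norm u)"
    proof (intro exI[of _ "\<lambda>u. exp (\<beta> * t) * ip Q u w"] conjI ballI)
      \<comment> \<open>The inner product with \<open>w\<close> is bounded on the whole type, as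
        required of a functional that is to commute with Bochner integrals.\<close>
      show "bounded_linear (\<lambda>u. exp (\<beta> * t) * ip Q u w)"
        by (intro bounded_linear_const_mult D.ip.bounded_linear_left)
      fix u assume u: "u \<in> C0 Q"
      have "sqrt (ip Q u u) \<le> sqrt (measure lborel Q * (norm u)\<^sup>2)"
        by (intro real_sqrt_le_mono D.q_le_norm u)
      also have "\<dots> = sqrt (measure lborel Q) * norm u" by (simp add: real_sqrt_mult)
      also have "\<dots> \<le> m * norm u" by (intro mult_right_mono) (auto simp: m_def)
      finally have sq: "sqrt (ip Q u u) \<le> m * norm u" .
      have "\<bar>apply_c0 (S t u) x - exp (\<beta> * t) * ip Q u w\<bar> = exp (\<beta> * t) * \<bar>apply_c0 (T t u) x - ip Q u w\<bar>"
        by (simp add: ST right_diff_distrib[symmetric] abs_mult)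
      also have "\<dots> \<le> exp (\<beta> * t) * (\<epsilon> * (m * norm u))"
        using w(2)[OF u] mult_left_mono[OF sq less_imp_le[OF \<epsilon>]] by (intro mult_left_mono) auto
      also have "\<dots> = e * norm u" using m by (simp add: \<epsilon>_def)
      finally show "\<bar>apply_c0 (S t u) x - exp (\<beta> * t) * ip Q u w\<bar> \<le> e * norm u" .
    qed
  qed
  then show thesis by (rule that)
qed

section \<open>Attraction and uniqueness\<close>

context forced_semigroup
begin

text \<open>\<xi> is itself a mild solution along the same path, started at
  \<open>\<tau> - t\<close> from its own value, so the forcing cancels in the difference.\<close>

lemma \<xi>_attracts:
  assumes \<omega>: "sublinear_path \<omega>" and v: "v \<in> C0 Q" and t: "0 < t"
  shows "norm (mild_solution Q S \<alpha> \<tau> (\<tau> - t) (translate (- \<tau>) \<omega>) g h v - \<xi> \<tau> \<omega>)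
    \<le> M * exp (- a * t) * (norm v + norm (\<xi> (\<tau> - t) (translate (- t) \<omega>)))"
proof -
  have p: "sublinear_path (translate (- t) \<omega>)" by (rule sublinear_path_translate[OF \<omega>])
  have "\<xi> \<tau> \<omega> = mild_solution Q S \<alpha> \<tau> (\<tau> - t) (translate (- \<tau>) \<omega>) g h (\<xi> (\<tau> - t) (translate (- t) \<omega>))"
    using \<xi>_mild[OF p t, of "\<tau> - t"] by (simp add: translate_translate translate_0)
  then show ?thesis
    using mild_diff[OF sublinear_path_translate[OF \<omega>] v \<xi>_in_C0[OF p], of "\<tau> - t" \<tau> "- \<tau>" "\<tau> - t"] t by simp
qed

lemma \<xi>_unique:
  assumes \<Omega>: "\<And>\<omega>. \<omega> \<in> \<Omega> \<Longrightarrow> sublinear_path \<omega>"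
    and \<eta>: "complete_quasi_solution Q S \<alpha> \<Omega> g h \<eta>" "tempered \<Omega> \<eta>" and \<omega>: "\<omega> \<in> translates \<Omega>"
  shows "\<eta> \<tau> \<omega> = \<xi> \<tau> \<omega>"
proof -
  obtain r \<omega>0 where \<omega>0: "\<omega>0 \<in> \<Omega>" "\<omega> = translate r \<omega>0" using \<omega> by (auto simp: translates_def)
  have p: "sublinear_path \<omega>" unfolding \<omega>0(2) by (intro sublinear_path_translate \<Omega> \<omega>0)
  define d where "d t = norm (\<eta> (\<tau> - t) (translate (- t) \<omega>)) + norm (\<xi> (\<tau> - t) (translate (- t) \<omega>))" for t
  have le: "norm (\<eta> \<tau> \<omega> - \<xi> \<tau> \<omega>) \<le> M * exp (- a * t) * d t" if t: "0 < t" for t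
  proof -
    have m: "translate (- t) \<omega> \<in> translates \<Omega>"
      unfolding \<omega>0(2) translate_translate using \<omega>0(1) by (auto simp: translates_def)
    have "mild_solution Q S \<alpha> (t + (\<tau> - t)) (\<tau> - t) (translate (- (\<tau> - t)) (translate (- t) \<omega>)) g h
        (\<eta> (\<tau> - t) (translate (- t) \<omega>)) = \<eta> (\<tau> - t + t) (translate t (translate (- t) \<omega>))"
      using \<eta>(1) m t unfolding complete_quasi_solution_def by blast
    then have "\<eta> \<tau> \<omega> = mild_solution Q S \<alpha> \<tau> (\<tau> - t) (translate (- \<tau>) \<omega>) g h (\<eta> (\<tau> - t) (translate (- t) \<omega>))"
      by (simp add: translate_translate translate_0)
    moreover have "\<eta> (\<tau> - t) (translate (- t) \<omega>) \<in> C0 Q"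
      using \<eta>(1) m unfolding complete_quasi_solution_def by blast
    ultimately show ?thesis
      using \<xi>_attracts[OF p _ t] unfolding d_def by metis
  qed
  have a: "0 < a" using \<delta> by simp
  \<comment> \<open>Temperedness speaks of elements of \<Omega>, while \<omega> is a translate of
    one by \<open>r\<close>. The base time \<open>\<tau> - r\<close> and the variable s = r - t turn
    one limit into the other; the rate \<open>a\<close> is that of the attraction.\<close>
  have tail: "((\<lambda>s. exp (a * s) * norm (\<zeta> ((\<tau> - r) + s) (translate s \<omega>0))) \<longlongrightarrow> 0) at_bot \<Longrightarrow>
      ((\<lambda>t. exp (- a * t) * norm (\<zeta> (\<tau> - t) (translate (- t) \<omega>))) \<longlongrightarrow> 0) at_top" for \<zeta> :: "real \<Rightarrow> (real \<Rightarrow> real) \<Rightarrow> 'a c0"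
  proof -
    assume l: "((\<lambda>s. exp (a * s) * norm (\<zeta> ((\<tau> - r) + s) (translate s \<omega>0))) \<longlongrightarrow> 0) at_bot"
    have "filterlim (\<lambda>t::real. - t + r) at_bot at_top"
      by (rule filterlim_compose[OF filterlim_shift_at_bot filterlim_uminus_at_bot_at_top])
    from filterlim_compose[OF l this]
    have "((\<lambda>t. exp (- (a * r)) * (exp (a * (- t + r)) * norm (\<zeta> ((\<tau> - r) + (- t + r)) (translate (- t + r) \<omega>0)))) \<longlongrightarrow> 0) at_top"
      by (rule tendsto_mult_right_zero)
    moreover have "exp (- (a * r)) * (exp (a * (- t + r)) * norm (\<zeta> ((\<tau> - r) + (- t + r)) (translate (- t + r) \<omega>0)))
        = exp (- a * t) * norm (\<zeta> (\<tau> - t) (translate (- t) \<omega>))" for t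
      by (simp add: \<omega>0(2) translate_translate mult.assoc[symmetric] mult_exp_exp algebra_simps)
    ultimately show ?thesis by simp
  qed
  have "((\<lambda>t. exp (- a * t) * norm (\<eta> (\<tau> - t) (translate (- t) \<omega>))) \<longlongrightarrow> 0) at_top"
    using \<eta>(2) a \<omega>0(1) unfolding tempered_def by (intro tail) blast
  moreover have "((\<lambda>t. exp (- a * t) * norm (\<xi> (\<tau> - t) (translate (- t) \<omega>))) \<longlongrightarrow> 0) at_top"
    by (intro tail \<xi>_tempered \<Omega> \<omega>0 a)
  ultimately have "((\<lambda>t. exp (- a * t) * norm (\<eta> (\<tau> - t) (translate (- t) \<omega>)) + exp (- a * t) * norm (\<xi> (\<tau> - t) (translate (- t) \<omega>))) \<longlongrightarrow> 0 + 0) at_top"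
    by (rule tendsto_add)
  then have "((\<lambda>t. exp (- a * t) * d t) \<longlongrightarrow> 0) at_top"
    by (simp add: d_def distrib_left)
  then have "((\<lambda>t. M * (exp (- a * t) * d t)) \<longlongrightarrow> 0) at_top" by (rule tendsto_mult_right_zero)
  then have "norm (\<eta> \<tau> \<omega> - \<xi> \<tau> \<omega>) \<le> 0"
  proof (rule tendsto_lowerbound)
    show "\<forall>\<^sub>F t in at_top. norm (\<eta> \<tau> \<omega> - \<xi> \<tau> \<omega>) \<le> M * (exp (- a * t) * d t)"
      unfolding eventually_at_top_dense by (intro exI[of _ 0] allI impI) (use le in \<open>simp add: mult.assoc\<close>)
  qed simp
  then show ?thesis by simp
qed

end

theorem lemma3p1:
  fixes Q :: "(real ^ 'n) set"
    and \<alpha> \<beta> \<delta> lam :: real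
    and S :: "real \<Rightarrow> (real ^ 'n) c0 \<Rightarrow> (real ^ 'n) c0"
    and W :: "(real \<Rightarrow> real) measure"
    and \<Omega> :: "(real \<Rightarrow> real) set"
    and g h :: "real \<Rightarrow> real ^ 'n \<Rightarrow> real"
  assumes Q: "open Q" "bounded Q" "smooth_boundary Q"
    and eigenvalue: "first_dirichlet_eigenvalue Q lam"
    and parameters: "0 < \<alpha>" "0 < \<beta>" "\<beta> < lam" "0 < \<delta>" "\<delta> < lam - \<beta>"
    and semigroup: "semigroup_of_A Q \<beta> S"
    and noise: "two_sided_wiener_measure W" "noise_paths W \<Omega>"
    and g: "g \<in> L1loc_Linf Q"
    and h: "h \<in> L1loc_Linf Q"
    and integrable: "\<And>\<tau>. set_integrable lebesgue {..\<tau>}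
        (\<lambda>s. exp (\<delta> * s) * (Linf_norm Q (g s) + Linf_norm Q (h s)))"
    and growth: "\<And>c. c > 0 \<Longrightarrow>
        ((\<lambda>r. exp (c * r) * (LINT s:{..0}|lebesgue.
            exp (\<delta> * s) * (Linf_norm Q (g (s + r)) + Linf_norm Q (h (s + r))))) \<longlongrightarrow> 0) at_bot"
  shows "\<exists>\<xi> :: real \<Rightarrow> (real \<Rightarrow> real) \<Rightarrow> (real ^ 'n) c0.
    complete_quasi_solution Q S \<alpha> \<Omega> g h \<xi> \<and> tempered \<Omega> \<xi> \<and>
    (\<forall>\<eta>. complete_quasi_solution Q S \<alpha> \<Omega> g h \<eta> \<and> tempered \<Omega> \<eta> \<longrightarrow>
       (\<forall>t. \<forall>\<omega>\<in>translates \<Omega>. \<eta> t \<omega> = \<xi> t \<omega>)) \<and>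
    (\<forall>t. \<forall>\<omega>\<in>translates \<Omega>.
       set_integrable lebesgue {..0} (\<lambda>s. zfac \<alpha> s \<omega> *\<^sub>R
         Linf_extension Q (S \<bar>s\<bar>) (\<lambda>x. translate t h s x + \<bar>translate t g s x\<bar>)) \<and>
       \<xi> t \<omega> = (LINT s:{..0}|lebesgue. zfac \<alpha> s \<omega> *\<^sub>R
         Linf_extension Q (S \<bar>s\<bar>) (\<lambda>x. translate t h s x + \<bar>translate t g s x\<bar>))) \<and>
    (\<exists>M>0. \<forall>t>0. \<forall>\<tau>. \<forall>\<omega>\<in>\<Omega>. \<forall>v\<in>C0 Q.
       norm (mild_solution Q S \<alpha> \<tau> (\<tau> - t) (translate (- \<tau>) \<omega>) g h v - \<xi> \<tau> \<omega>)
         \<le> M * exp (- (lam - \<beta>) * t) * (norm v + norm (\<xi> (\<tau> - t) (translate (- t) \<omega>)))) \<and>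
    (\<forall>T>0.
       (AE s in lebesgue. AE x in lebesgue_on Q. g (s + T) x = g s x) \<and>
       (AE s in lebesgue. AE x in lebesgue_on Q. h (s + T) x = h s x) \<longrightarrow>
       (\<forall>t. \<forall>\<omega>\<in>\<Omega>. \<xi> (t + T) \<omega> = \<xi> t \<omega>))"
proof -
  have "0 \<le> lam" using parameters by simp
  then obtain M where sm: "smoothing_semigroup Q S M (lam - \<beta>)"
    using smoothing_semigroup_of_A[OF Q(1,2) eigenvalue _ semigroup] by blast
  interpret forced_semigroup Q S M "lam - \<beta>" \<alpha> \<delta> g h
    by (intro forced_semigroup.intro forced_semigroup_axioms.intro sm parameters g h integrable growth)
  have \<Omega>: "sublinear_path \<omega>" if "\<omega> \<in> \<Omega>" for \<omega>
    using noise(2) that by (auto simp: noise_paths_def wiener_paths_def sublinear_path_def)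
  have tr: "sublinear_path \<omega>" if w: "\<omega> \<in> translates \<Omega>" for \<omega>
  proof -
    obtain t \<omega>0 where "\<omega>0 \<in> \<Omega>" "\<omega> = translate t \<omega>0" using w by (auto simp: translates_def)
    then show ?thesis using sublinear_path_translate[OF \<Omega>] by simp
  qed
  show ?thesis
  proof (intro exI[of _ \<xi>] conjI)
    show "complete_quasi_solution Q S \<alpha> \<Omega> g h \<xi>"
      unfolding complete_quasi_solution_def using \<xi>_in_C0[OF tr] \<xi>_mild[OF tr] by blast
    show "tempered \<Omega> \<xi>"
      unfolding tempered_def using \<xi>_tempered[OF \<Omega>] by blast
    show "\<forall>\<eta>. complete_quasi_solution Q S \<alpha> \<Omega> g h \<eta> \<and> tempered \<Omega> \<eta> \<longrightarrow> (\<forall>t. \<forall>\<omega>\<in>translates \<Omega>. \<eta> t \<omega> = \<xi> t \<omega>)"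
      using \<xi>_unique[OF \<Omega>] by blast
    show "\<forall>t. \<forall>\<omega>\<in>translates \<Omega>.
       set_integrable lebesgue {..0} (\<lambda>s. zfac \<alpha> s \<omega> *\<^sub>R
         Linf_extension Q (S \<bar>s\<bar>) (\<lambda>x. translate t h s x + \<bar>translate t g s x\<bar>)) \<and>
       \<xi> t \<omega> = (LINT s:{..0}|lebesgue. zfac \<alpha> s \<omega> *\<^sub>R
         Linf_extension Q (S \<bar>s\<bar>) (\<lambda>x. translate t h s x + \<bar>translate t g s x\<bar>))"
      using \<xi>_integrable_K(1)[OF tr] \<xi>_def by blast
    show "\<exists>M>0. \<forall>t>0. \<forall>\<tau>. \<forall>\<omega>\<in>\<Omega>. \<forall>v\<in>C0 Q.
       norm (mild_solution Q S \<alpha> \<tau> (\<tau> - t) (translate (- \<tau>) \<omega>) g h v - \<xi> \<tau> \<omega>)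
         \<le> M * exp (- (lam - \<beta>) * t) * (norm v + norm (\<xi> (\<tau> - t) (translate (- t) \<omega>)))"
      using M \<xi>_attracts[OF \<Omega>] by blast
    show "\<forall>T>0.
       (AE s in lebesgue. AE x in lebesgue_on Q. g (s + T) x = g s x) \<and>
       (AE s in lebesgue. AE x in lebesgue_on Q. h (s + T) x = h s x) \<longrightarrow>
       (\<forall>t. \<forall>\<omega>\<in>\<Omega>. \<xi> (t + T) \<omega> = \<xi> t \<omega>)"
      using \<xi>_periodic[OF \<Omega>] by blast
  qed
qed

end
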